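(* For every integer $m\ge2$, as $N\to\infty$, \[ C_1(N)-m\,C_m(N)=(m-1)\frac{\pi}{16\sqrt[4]{54}}N^{-3/4}I_{-3/2}\!\left(\pi\sqrt{\tfrac{2N}{3}}\right)+O\!\left(N^{-5/4}e^{\pi\sqrt{2N/3}}\right), \] where $I_s$ is the modified Bessel function of the first kind.
   Context: For a positive integer $m$, an $m$-string in an ordinary partition is a collection of parts of sizes $m(1+k),m(3+k),\dots,m(2j-1+k)$ for a positive integer $j$ and an integer $0\le k\le j$; its weight is $1$ if $k=0$ or $k=j$, and $2$ otherwise. $C_m(n)$ is the sum over all partitions $\lambda$ of $n$ and all $m$-strings $\pi$ of $\lambda$ of the weight of $\pi$. Equivalently $\sum_{n\ge 0}C_m(n)q^n=h(q^m)/(q;q)_\infty$, where $(q;q)_\infty=\prod_{j\ge1}(1-q^j)$ and $h(q)=\sum_{n=1}^\infty\frac{(-1)^{n+1}q^{n(n+1)/2}}{1-q^n}$. *)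

theory Defs
  imports "HOL-Analysis.Analysis" "HOL-Library.Multiset" "HOL-Library.Landau_Symbols"
begin

definition partitions :: "nat \<Rightarrow> nat multiset set" where
  "partitions n = {P. (\<forall>x\<in>#P. 0 < x) \<and> sum_mset P = n}"

definition mstrings :: "nat \<Rightarrow> nat multiset \<Rightarrow> (nat \<times> nat) set" where
  "mstrings m P = {(j, k). 1 \<le> j \<and> k \<le> j \<and> (\<forall>i\<in>{1..j}. m * (2 * i - 1 + k) \<in># P)}"

definition string_weight :: "nat \<Rightarrow> nat \<Rightarrow> nat" where
  "string_weight j k = (if k = 0 \<or> k = j then 1 else 2)"

definition C :: "nat \<Rightarrow> nat \<Rightarrow> nat" where
  "C m n = (\<Sum>P\<in>partitions n. \<Sum>(j, k)\<in>mstrings m P. string_weight j k)"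

text \<open>Modified Bessel function of the first kind (series definition), for x > 0:
  I_s(x) = sum_k (x/2)^(2k+s) / (k! Gamma(k+s+1)); rGamma = 1/Gamma.\<close>
definition bessel_I :: "real \<Rightarrow> real \<Rightarrow> real" where
  "bessel_I s x = (\<Sum>k. (x / 2) powr (2 * real k + s) * rGamma (real k + s + 1) / fact k)"

end

theory Submission
  imports Defs "HOL-Complex_Analysis.Complex_Analysis" "HOL-Real_Asymp.Real_Asymp" "HOL-Probability.Distributions"
begin

text \<open>
  Removing the parts of an \<open>m\<close>-string from a partition gives
  \<open>\<Sum>n. C m n q^n = P(q) H(q^m)\<close> with \<open>P(q) = exp (\<Sum>k. q^k / (k (1 - q^k)))\<close> and
  \<open>H(q) = \<Sum>j. (q^(j^2) - q^(2j^2)) (1 + q^j) / (1 - q^j)\<close>.  For \<open>q = e^(-z)\<close>, \<open>z \<rightarrow> 0\<close> in the cone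
  \<open>\<bar>Im z\<bar> \<le> Re z\<close>, the pole of \<open>H(q)\<close> at \<open>z = 0\<close> cancels in \<open>H(q) - m H(q^m)\<close>, which equals
  \<open>(m - 1)/8 + O(\<bar>z\<bar>^(1/2))\<close>, while \<open>P(q)\<close> behaves like \<open>(z/2\<pi>)^(1/2) exp (\<pi>^2/6z)\<close>.  Outside the cone
  \<open>P(q)\<close> is exponentially smaller.  Integrating over \<open>Re z = \<pi>/(6N)^(1/2)\<close> shows that
  \<open>C 1 N - m C m N\<close> is \<open>(m - 1) / (32 \<surd>3 N) exp (\<pi> (2N/3)^(1/2))\<close> with relative error
  \<open>O(N^(-1/4))\<close>, and \<open>I_{-3/2}(x) = (2/\<pi>x)^(1/2) (sinh x - cosh x / x)\<close> gives the claim.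
\<close>

subsection \<open>Partitions containing a given multiset\<close>

text \<open>No modular transformation is invoked; the expansions at z = 0 come from elementary
  summation. The constant (m - 1)/8 arises by splitting coth(w/2) = 2/w + w/6 + ... at w = j z. The
  pole part contributes (2/z) (U(z) - U(m z)), where U(z) is the sum over j of (exp(-j^2 z) - exp(-2
  j^2 z)) / j. Since U' tends to -1/12 at 0, this gives (m - 1)/6, and the value of U at 0 never
  enters. The rest of H(q) tends to 1/24 and carries the total weight 1 - m, which gives -(m -
  1)/24. For P(q) the factor (z/2 pi)^(1/2) is established on the real axis only and kept as (x/2
  pi)^(1/2) in the whole cone, at a relative cost of order |y|/x for z = x + i y. The Gaussian at
  the saddle has width |y|/x of order x^(1/2), so this loss has the same order as the O(|z|^(1/2))
  error of H(q) - m H(q^m). Both become the relative error N^(-1/4), because x has order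
  N^(-1/2).\<close>

lemma finite_partitions: "finite (partitions n)"
proof -
  have "partitions n \<subseteq> mset ` {xs. set xs \<subseteq> {1..n} \<and> length xs \<le> n}"
  proof
    fix P assume P: "P \<in> partitions n"
    obtain xs where xs: "P = mset xs" using ex_mset by metis
    have pos: "\<forall>x\<in>set xs. 0 < x" and sum: "sum_list xs = n"
      using P unfolding partitions_def xs by (auto simp: sum_mset_sum_list)
    have "length xs \<le> sum_list xs"
      using pos by (induction xs) (auto simp: Suc_le_eq add_increasing)
    moreover have "x \<le> sum_list xs" if "x \<in> set xs" for x
      using that by (simp add: member_le_sum_list)
    ultimately show "P \<in> mset ` {xs. set xs \<subseteq> {1..n} \<and> length xs \<le> n}"
      unfolding xs using pos sum by (intro imageI) (auto simp: Suc_le_eq)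
  qed
  thus ?thesis
    by (rule finite_subset) (intro finite_imageI finite_lists_length_le finite_atLeastAtMost)
qed

definition num_partitions :: "nat \<Rightarrow> nat" where
  "num_partitions n = card (partitions n)"

lemma num_partitions_0: "num_partitions 0 = 1"
proof -
  have "P = {#}" if "\<forall>x\<in>#P. 0 < x" "sum_mset P = 0" for P :: "nat multiset"
    using that by (cases P) auto
  hence "partitions 0 = {{#}}"
    unfolding partitions_def by auto
  thus ?thesis by (simp add: num_partitions_def)
qed

text \<open>Deleting \<open>A\<close> is inverse to adding it. The count is used twice: with
  \<open>A\<close> consisting of equal parts for the recurrence of the partition numbers, and with
  \<open>A\<close> an \<open>m\<close>-string.\<close>

lemma card_partitions_containing:
  assumes "\<forall>x\<in>#A. 0 < x"
  shows "card {P \<in> partitions n. A \<subseteq># P} = (if sum_mset A \<le> n then num_partitions (n - sum_mset A) else 0)"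
proof (cases "sum_mset A \<le> n")
  case True
  have "bij_betw (\<lambda>P. P + A) (partitions (n - sum_mset A)) {P \<in> partitions n. A \<subseteq># P}"
  proof (rule bij_betwI[where g = "\<lambda>P. P - A"])
    show "(\<lambda>P. P + A) \<in> partitions (n - sum_mset A) \<rightarrow> {P \<in> partitions n. A \<subseteq># P}"
      using assms True by (auto simp: partitions_def)
    show "(\<lambda>P. P - A) \<in> {P \<in> partitions n. A \<subseteq># P} \<rightarrow> partitions (n - sum_mset A)"
      by (auto simp: partitions_def sum_mset_diff dest: in_diffD)
  qed auto
  thus ?thesis using True by (simp add: num_partitions_def bij_betw_same_card)
next
  case False
  have "{P \<in> partitions n. A \<subseteq># P} = {}"
    using False by (auto simp: partitions_def subset_mset.le_iff_add)
  thus ?thesis using False by (simp only: card.empty if_False)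
qed

lemma sum_mset_eq_sum_count:
  fixes P :: "nat multiset"
  assumes "finite S" "set_mset P \<subseteq> S"
  shows "sum_mset P = (\<Sum>d\<in>S. count P d * d)"
  using assms(2)
proof (induction P)
  case (add x P)
  have "(\<Sum>d\<in>S. count (add_mset x P) d * d) = (\<Sum>d\<in>S. (if d = x then d else 0) + count P d * d)"
    by (intro sum.cong) auto
  also have "\<dots> = x + (\<Sum>d\<in>S. count P d * d)"
    using add.prems assms(1) by (simp add: sum.distrib)
  finally show ?case using add by simp
qed simp

text \<open>Both sides count \<open>n\<close> as the sum of the parts of each partition of \<open>n\<close>, on the right via the pairs
  \<open>(d, r)\<close> such that \<open>d\<close> occurs at least \<open>r\<close> times.\<close>

lemma num_partitions_recurrence:
  "n * num_partitions n = (\<Sum>k\<in>{1..n}. (\<Sum>d | d dvd k. d) * num_partitions (n - k))"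
proof -
  let ?I = "{1..n} \<times> {1..n}"
  have "n * num_partitions n = (\<Sum>P\<in>partitions n. sum_mset P)"
    by (simp add: num_partitions_def partitions_def)
  also have "\<dots> = (\<Sum>P\<in>partitions n. \<Sum>(d,r)\<in>?I. if replicate_mset r d \<subseteq># P then d else 0)"
  proof (rule sum.cong[OF refl])
    fix P assume P: "P \<in> partitions n"
    have le: "count P d * d \<le> n" for d
    proof -
      have "replicate_mset (count P d) d \<subseteq># P" by (simp add: count_le_replicate_mset_subset_eq [symmetric])
      then obtain Q where "P = replicate_mset (count P d) d + Q" by (auto simp: subset_mset.le_iff_add)
      hence "sum_mset P = count P d * d + sum_mset Q"
        by (metis sum_mset.union sum_mset_replicate_mset of_nat_id)
      thus ?thesis using P by (simp add: partitions_def)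
    qed
    have sub: "set_mset P \<subseteq> {1..n}"
    proof
      fix d assume d: "d \<in># P"
      hence "1 \<le> count P d" by (simp add: Suc_le_eq)
      hence "d \<le> count P d * d" by simp
      also have "\<dots> \<le> n" by (rule le)
      finally show "d \<in> {1..n}" using P d unfolding partitions_def
        by (auto simp: Suc_le_eq)
    qed
    have "sum_mset P = (\<Sum>d\<in>{1..n}. count P d * d)"
      using sub by (intro sum_mset_eq_sum_count) auto
    also have "\<dots> = (\<Sum>d\<in>{1..n}. \<Sum>r\<in>{1..n}. if replicate_mset r d \<subseteq># P then d else 0)"
    proof (rule sum.cong[OF refl])
      fix d assume d: "d \<in> {1..n}"
      have "count P d \<le> count P d * d" using d by simp
      also have "\<dots> \<le> n" by (rule le)
      finally have "{r \<in> {1..n}. r \<le> count P d} = {1..count P d}" by auto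
      thus "count P d * d = (\<Sum>r\<in>{1..n}. if replicate_mset r d \<subseteq># P then d else 0)"
        by (simp add: sum.inter_filter [symmetric] count_le_replicate_mset_subset_eq [symmetric])
    qed
    also have "\<dots> = (\<Sum>(d,r)\<in>?I. if replicate_mset r d \<subseteq># P then d else 0)"
      by (simp add: sum.cartesian_product)
    finally show "sum_mset P = (\<Sum>(d,r)\<in>?I. if replicate_mset r d \<subseteq># P then d else 0)" .
  qed
  also have "\<dots> = (\<Sum>(d,r)\<in>?I. d * card {P \<in> partitions n. replicate_mset r d \<subseteq># P})"
    unfolding split_def
  proof (subst sum.swap, rule sum.cong[OF refl])
    fix x assume "x \<in> ?I"
    show "(\<Sum>P\<in>partitions n. if replicate_mset (snd x) (fst x) \<subseteq># P then fst x else 0) =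
      fst x * card {P \<in> partitions n. replicate_mset (snd x) (fst x) \<subseteq># P}"
      by (subst sum.inter_filter [symmetric]) (simp_all add: finite_partitions)
  qed
  also have "\<dots> = (\<Sum>(d,r)\<in>?I. if d * r \<le> n then d * num_partitions (n - d * r) else 0)"
    by (intro sum.cong) (auto simp: card_partitions_containing mult.commute)
  also have "\<dots> = (\<Sum>(d,r)\<in>{(d,r)\<in>?I. d * r \<le> n}. d * num_partitions (n - d * r))"
    by (rule sum.mono_neutral_cong_right) (auto split: if_splits)
  \<comment> \<open>Grouping the pairs by their product k = d r makes r the cofactor
    \<open>k div d\<close>, so what remains of r is the condition \<open>d dvd k\<close>.\<close>
  also have "\<dots> = (\<Sum>(k,d)\<in>Sigma {1..n} (\<lambda>k. {d. d dvd k}). d * num_partitions (n - k))"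
  proof (rule sum.reindex_bij_witness[where i = "\<lambda>(k,d). (d, k div d)" and j = "\<lambda>(d,r). (d * r, d)"])
    fix a assume a: "a \<in> Sigma {1..n} (\<lambda>k. {d. d dvd k})"
    then obtain d r where dr: "a = (d * r, d)" "1 \<le> d * r" "d * r \<le> n"
      by (auto elim!: dvdE)
    have "1 \<le> d" "1 \<le> r" using dr(2) by (auto simp: Suc_le_eq)
    moreover from this have "d * 1 \<le> d * r" "1 * r \<le> d * r" by (auto intro: mult_le_mono)
    hence "d \<le> n" "r \<le> n" using dr(3) by linarith+
    ultimately
    show "(case a of (k, d) \<Rightarrow> (d, k div d)) \<in> {(d,r)\<in>?I. d * r \<le> n}"
      using dr by simp
  qed (auto simp: Suc_le_eq)
  also have "\<dots> = (\<Sum>k\<in>{1..n}. \<Sum>d | d dvd k. d * num_partitions (n - k))"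
    by (rule sum.Sigma [symmetric]) (auto intro: finite_divisors_nat)
  finally show ?thesis by (simp add: sum_distrib_right)
qed

section \<open>Counting strings by their total size\<close>

lemma sum_odd_numbers: "(\<Sum>i\<in>{1..j}. 2 * i - 1 + k) = j * (j + k)" for j k :: nat
  by (induction j) (auto simp: algebra_simps)

definition string_count :: "nat \<Rightarrow> nat \<Rightarrow> nat" where
  "string_count m s = (\<Sum>(j,k)\<in>{(j,k). 1 \<le> j \<and> k \<le> j \<and> m * (j * (j + k)) = s}. string_weight j k)"

lemma string_index_bound:
  assumes "1 \<le> m" "1 \<le> j" "k \<le> j" "m * (j * (j + k)) \<le> n"
  shows "j \<le> n" "k \<le> (n::nat)"
proof -
  have "j * 1 \<le> j * (j + k)" using assms by (intro mult_le_mono) auto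
  also have "1 * \<dots> \<le> m * \<dots>" using assms by (intro mult_le_mono) auto
  finally show "j \<le> n" using assms(4) by linarith
  thus "k \<le> n" using assms(3) by linarith
qed

lemma finite_string_index:
  assumes "1 \<le> m"
  shows "finite {(j,k). 1 \<le> j \<and> k \<le> j \<and> m * (j * (j + k)) \<le> (n::nat)}"
proof (rule finite_subset)
  show "{(j,k). 1 \<le> j \<and> k \<le> j \<and> m * (j * (j + k)) \<le> n} \<subseteq> {..n} \<times> {..n}"
    using string_index_bound[OF assms] by blast
qed simp

text \<open>The parts of one string are distinct, so containing each of them is the same as
  containing their \<open>mset_set\<close> as a sub-multiset.\<close>

lemma card_partitions_string:
  assumes "1 \<le> m"
  shows "card {P \<in> partitions n. \<forall>i\<in>{1..j}. m * (2 * i - 1 + k) \<in># P} =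
    (if m * (j * (j + k)) \<le> n then num_partitions (n - m * (j * (j + k))) else 0)"
proof -
  define A where "A = mset_set ((\<lambda>i. m * (2 * i - 1 + k)) ` {1..j})"
  have inj: "inj_on (\<lambda>i. m * (2 * i - 1 + k)) {1..j}"
    using assms by (auto simp: inj_on_def)
  have "A \<subseteq># P \<longleftrightarrow> (\<forall>i\<in>{1..j}. m * (2 * i - 1 + k) \<in># P)" for P
  proof
    show "\<forall>i\<in>{1..j}. m * (2 * i - 1 + k) \<in># P" if "A \<subseteq># P"
      using set_mset_mono[OF that] by (auto simp: A_def)
    show "A \<subseteq># P" if "\<forall>i\<in>{1..j}. m * (2 * i - 1 + k) \<in># P"
      using that by (auto simp: A_def subseteq_mset_def count_mset_set' Suc_le_eq)
  qed
  moreover have "sum_mset A = m * (j * (j + k))"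
  proof -
    have "sum_mset A = sum (\<lambda>x. x) ((\<lambda>i. m * (2 * i - 1 + k)) ` {1..j})"
      by (simp add: A_def sum_unfold_sum_mset)
    also have "\<dots> = (\<Sum>i\<in>{1..j}. m * (2 * i - 1 + k))"
      using sum.reindex[OF inj, of "\<lambda>x. x"] by (simp only: o_def)
    also have "\<dots> = m * (j * (j + k))"
      by (simp only: sum_odd_numbers sum_distrib_left [symmetric])
    finally show ?thesis .
  qed
  moreover have "\<forall>x\<in>#A. 0 < x" using assms by (auto simp: A_def)
  ultimately show ?thesis using card_partitions_containing[of A n] by simp
qed

text \<open>Exchanging the sums leaves, for each string, the number of partitions that contain it.
  That number depends on the string only through its total size s, so the result is a Cauchy
  product.\<close>

lemma C_eq_convolution:
  assumes m: "1 \<le> m"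
  shows "C m n = (\<Sum>s\<le>n. string_count m s * num_partitions (n - s))"
proof -
  \<comment> \<open>A finite index set that does not depend on the partition: it holds every pair
    (j, k) that can occur in some partition of \<open>n\<close>, which permits the exchange of
    sums.\<close>
  define J where "J = {(j,k). 1 \<le> j \<and> k \<le> j \<and> m * (j * (j + k)) \<le> n}"
  have finJ: "finite J" unfolding J_def by (rule finite_string_index[OF m])
  have sub: "mstrings m P = {(j,k)\<in>J. \<forall>i\<in>{1..j}. m * (2 * i - 1 + k) \<in># P}" if P: "P \<in> partitions n" for P
  proof -
    have "m * (j * (j + k)) \<le> n" if "\<forall>i\<in>{1..j}. m * (2 * i - 1 + k) \<in># P" for j k
    proof (rule ccontr)
      assume "\<not> ?thesis"
      hence "{P \<in> partitions n. \<forall>i\<in>{1..j}. m * (2 * i - 1 + k) \<in># P} = {}"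
        using card_partitions_string[OF m, of n j k] finite_partitions[of n] by simp
      thus False using P that by blast
    qed
    thus ?thesis unfolding mstrings_def J_def by auto
  qed
  have "C m n = (\<Sum>P\<in>partitions n. \<Sum>(j,k)\<in>J. if \<forall>i\<in>{1..j}. m * (2 * i - 1 + k) \<in># P then string_weight j k else 0)"
    unfolding C_def
  proof (rule sum.cong[OF refl])
    fix P assume P: "P \<in> partitions n"
    show "(\<Sum>(j,k)\<in>mstrings m P. string_weight j k) =
       (\<Sum>(j,k)\<in>J. if \<forall>i\<in>{1..j}. m * (2 * i - 1 + k) \<in># P then string_weight j k else 0)"
      unfolding sub[OF P] by (rule sum.mono_neutral_cong_left) (use finJ in \<open>auto split: if_splits\<close>)
  qed
  also have "\<dots> = (\<Sum>(j,k)\<in>J. string_weight j k * card {P \<in> partitions n. \<forall>i\<in>{1..j}. m * (2 * i - 1 + k) \<in># P})"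
    unfolding split_def
  proof (subst sum.swap, rule sum.cong[OF refl])
    fix x assume "x \<in> J"
    show "(\<Sum>P\<in>partitions n. if \<forall>i\<in>{1..fst x}. m * (2 * i - 1 + snd x) \<in># P then string_weight (fst x) (snd x) else 0) =
      string_weight (fst x) (snd x) * card {P \<in> partitions n. \<forall>i\<in>{1..fst x}. m * (2 * i - 1 + snd x) \<in># P}"
      by (subst sum.inter_filter [symmetric]) (simp_all add: finite_partitions)
  qed
  also have "\<dots> = (\<Sum>(j,k)\<in>J. string_weight j k * num_partitions (n - m * (j * (j + k))))"
  proof (intro sum.cong refl, clarify)
    fix j k assume "(j, k) \<in> J"
    thus "string_weight j k * card {P \<in> partitions n. \<forall>i\<in>{1..j}. m * (2 * i - 1 + k) \<in># P} =
      string_weight j k * num_partitions (n - m * (j * (j + k)))"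
      unfolding card_partitions_string[OF m] by (simp add: J_def)
  qed
  also have "\<dots> = (\<Sum>s\<le>n. \<Sum>(j,k)\<in>{x\<in>J. (case x of (j,k) \<Rightarrow> m * (j * (j + k))) = s}. string_weight j k * num_partitions (n - m * (j * (j + k))))"
    by (rule sum.group[symmetric]) (use finJ in \<open>auto simp: J_def\<close>)
  also have "\<dots> = (\<Sum>s\<le>n. string_count m s * num_partitions (n - s))"
  proof (rule sum.cong[OF refl])
    fix s assume s: "s \<in> {..n}"
    have eq: "{x\<in>J. (case x of (j,k) \<Rightarrow> m * (j * (j + k))) = s} = {(j,k). 1 \<le> j \<and> k \<le> j \<and> m * (j * (j + k)) = s}"
      using s by (auto simp: J_def)
    show "(\<Sum>(j,k)\<in>{x\<in>J. (case x of (j,k) \<Rightarrow> m * (j * (j + k))) = s}. string_weight j k * num_partitions (n - m * (j * (j + k)))) =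
       string_count m s * num_partitions (n - s)"
      unfolding eq string_count_def sum_distrib_right by (intro sum.cong) auto
  qed
  finally show ?thesis .
qed

subsection \<open>Generating functions\<close>

definition num_fps :: "complex fps" where
  "num_fps = Abs_fps (\<lambda>n. of_nat (num_partitions n))"

text \<open>The coefficients of log P(q), which is the double sum of q^(r d) / r. For n = 0 the set
  of divisors is infinite and the sum is 0 by convention, so the constant term vanishes as
  composition with the exponential requires.\<close>

definition lambert_fps :: "complex fps" where
  "lambert_fps = Abs_fps (\<lambda>n. \<Sum>d | d dvd n. 1 / of_nat d)"

lemma sum_divisors_reciprocal:
  "n > 0 \<Longrightarrow> of_nat n * (\<Sum>d | d dvd n. 1 / of_nat d) = (of_nat (\<Sum>d | d dvd n. d) :: 'a :: field_char_0)"
proof -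
  assume n: "n > 0"
  have "of_nat n * (\<Sum>d | d dvd n. 1 / of_nat d) = (\<Sum>d | d dvd n. of_nat n / (of_nat d :: 'a))"
    by (simp add: sum_distrib_left)
  also have "\<dots> = (\<Sum>d | d dvd n. of_nat d)"
  proof (rule sum.reindex_bij_witness[where i = "\<lambda>d. n div d" and j = "\<lambda>d. n div d"])
    fix d assume "d \<in> {d. d dvd n}"
    hence d: "d dvd n" by simp
    show "of_nat (n div d) = of_nat n / (of_nat d :: 'a)"
      using d n by (auto elim!: dvdE)
    show "n div (n div d) = d" using d n by (simp add: div_div_eq_right)
    show "n div d \<in> {d. d dvd n}" using d by (auto elim!: dvdE)
    show "n div (n div d) = d" using d n by (simp add: div_div_eq_right)
    show "n div d \<in> {d. d dvd n}" using d by (auto elim!: dvdE)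
  qed
  finally show ?thesis by simp
qed

text \<open>With L for \<open>lambert_fps\<close>, the series F = exp(L) satisfies F' = F L', and n
  times the n-th coefficient of L is the divisor sum. Comparing coefficients gives exactly
  \<open>num_partitions_recurrence\<close>, so an infinite product never has to be expanded.\<close>

lemma num_fps_eq_exp: "num_fps = fps_compose (fps_exp 1) lambert_fps"
proof -
  define F where "F = fps_compose (fps_exp 1) lambert_fps"
  have F0: "fps_nth F 0 = 1" by (simp add: F_def)
  have "fps_deriv F = F * fps_deriv lambert_fps"
    unfolding F_def by (subst fps_compose_deriv) (simp_all add: lambert_fps_def fps_exp_deriv)
  hence *: "of_nat (Suc n) * fps_nth F (Suc n) =
      (\<Sum>i=0..n. fps_nth F i * (of_nat (Suc (n - i)) * fps_nth lambert_fps (Suc (n - i))))" for n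
    by (metis (no_types, lifting) fps_deriv_nth fps_mult_nth sum.cong Suc_eq_plus1)
  have "fps_nth F n = of_nat (num_partitions n)" for n
  proof (induction n rule: less_induct)
    case (less n)
    show ?case
    proof (cases n)
      case 0
      thus ?thesis by (simp add: F0 num_partitions_0)
    next
      case (Suc k)
      have "of_nat (Suc k) * fps_nth F (Suc k) =
          (\<Sum>i=0..k. of_nat (num_partitions i) * of_nat (\<Sum>d | d dvd (Suc (k - i)). d))"
        unfolding * by (intro sum.cong refl) (simp add: less Suc lambert_fps_def sum_divisors_reciprocal del: of_nat_Suc of_nat_sum)
      also have "\<dots> = of_nat (\<Sum>i=0..k. (\<Sum>d | d dvd (Suc (k - i)). d) * num_partitions i)"
        by (simp add: mult.commute)
      also have "(\<Sum>i=0..k. (\<Sum>d | d dvd (Suc (k - i)). d) * num_partitions i) =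
          (\<Sum>i\<in>{1..Suc k}. (\<Sum>d | d dvd i. d) * num_partitions (Suc k - i))"
        by (rule sum.reindex_bij_witness[where i = "\<lambda>i. Suc k - i" and j = "\<lambda>i. Suc k - i"]) (auto simp: Suc_diff_le)
      also have "\<dots> = Suc k * num_partitions (Suc k)"
        by (rule num_partitions_recurrence [symmetric])
      finally have "of_nat (Suc k) * fps_nth F (Suc k) = of_nat (Suc k) * of_nat (num_partitions (Suc k))"
        by (simp only: of_nat_mult)
      thus ?thesis unfolding Suc by (simp only: mult_cancel_left of_nat_eq_0_iff) simp
    qed
  qed
  thus ?thesis by (simp add: F_def num_fps_def fps_eq_iff)
qed

text \<open>Absolute convergence lets the double series be grouped in three ways: by the product of
  the indices (power series), for fixed r (geometric series) and for fixed d (logarithms).\<close>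

lemma summable_on_lambert:
  fixes q :: complex
  assumes "norm q < 1"
  shows "(\<lambda>(r,d). q ^ (Suc r * Suc d) / of_nat (Suc r)) summable_on UNIV \<times> UNIV"
proof -
  define \<rho> where "\<rho> = norm q"
  have \<rho>: "0 \<le> \<rho>" "\<rho> < 1" using assms by (auto simp: \<rho>_def)
  let ?g = "\<lambda>r. \<rho> ^ Suc r / (1 - \<rho> ^ Suc r) / real (Suc r)"
  have pow: "\<rho> ^ Suc r \<le> \<rho>" for r using \<rho> by (simp add: mult_left_le power_le_one)
  have row: "((\<lambda>d. \<rho> ^ (Suc r * Suc d) / real (Suc r)) has_sum ?g r) UNIV" for r
  proof (rule sums_nonneg_imp_has_sum)
    have "(\<lambda>d. (\<rho> ^ Suc r) ^ Suc d) sums (\<rho> ^ Suc r * (1 / (1 - \<rho> ^ Suc r)))"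
      unfolding power_Suc[of "\<rho> ^ Suc r"]
      by (intro sums_mult geometric_sums) (use \<rho> pow[of r] in \<open>auto simp del: power_Suc\<close>)
    thus "(\<lambda>d. \<rho> ^ (Suc r * Suc d) / real (Suc r)) sums ?g r"
      by (intro sums_divide) (simp only: power_mult times_divide_eq_right mult_1_right)
  qed (use \<rho> in auto)
  have "?g summable_on UNIV"
  proof (rule summable_nonneg_imp_summable_on)
    show "summable ?g"
    proof (rule summable_comparison_test')
      show "summable (\<lambda>r. \<rho> ^ Suc r / (1 - \<rho>))"
        using \<rho> by (intro summable_divide) (simp add: summable_geometric)
      fix r
      have "?g r \<le> \<rho> ^ Suc r / (1 - \<rho> ^ Suc r) / 1"
        using \<rho> pow[of r] by (intro divide_left_mono) (auto intro!: divide_nonneg_nonneg)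
      also have "\<dots> \<le> \<rho> ^ Suc r / (1 - \<rho>)"
        using \<rho> pow[of r] by (simp only: div_by_1, intro divide_left_mono) auto
      finally show "norm (?g r) \<le> \<rho> ^ Suc r / (1 - \<rho>)"
        using \<rho> pow[of r] by (simp add: power_le_one)
    qed
  qed (use \<rho> in \<open>auto simp: power_le_one simp del: power_Suc intro!: divide_nonneg_nonneg\<close>)
  hence "(\<lambda>(r,d). \<rho> ^ (Suc r * Suc d) / real (Suc r)) summable_on (SIGMA r:UNIV. UNIV)"
    by (intro summable_on_SigmaI[where g = "?g"]) (use row \<rho> in auto)
  moreover have "norm (q ^ (Suc r * Suc d) / of_nat (Suc r)) = \<rho> ^ (Suc r * Suc d) / real (Suc r)" for r d
    by (simp only: norm_divide norm_power norm_of_nat \<rho>_def)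
  ultimately have "(\<lambda>x. norm ((\<lambda>(r,d). q ^ (Suc r * Suc d) / of_nat (Suc r)) x)) summable_on UNIV \<times> UNIV"
    by (simp only: case_prod_unfold)
  thus ?thesis by (rule abs_summable_summable)
qed

lemma lambert_fps_sums:
  assumes "norm q < 1"
  shows "(\<lambda>n. fps_nth lambert_fps n * q ^ n) sums
    (\<Sum>\<^sub>\<infinity>(r,d)\<in>UNIV \<times> UNIV. q ^ (Suc r * Suc d) / of_nat (Suc r))" (is "_ sums ?S")
proof -
  have "((\<lambda>(r,d). q ^ (Suc r * Suc d) / of_nat (Suc r)) has_sum ?S) (UNIV \<times> UNIV)"
    using summable_on_lambert[OF assms] by (rule has_sum_infsum)
  also have "?this \<longleftrightarrow> ((\<lambda>(n,d). q ^ n / of_nat d) has_sum ?S) (SIGMA n:{1..}. {d. d dvd n})"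
  proof (rule has_sum_reindex_bij_witness[where i = "\<lambda>(n,d). (d - 1, n div d - 1)" and j = "\<lambda>(r,d). (Suc r * Suc d, Suc r)"])
    fix b :: "nat \<times> nat" assume "b \<in> (SIGMA n:{1..}. {d. d dvd n})"
    then obtain d e where b: "b = (d * e, d)" "d * e > 0" by (auto elim!: dvdE)
    then obtain d' e' where "d = Suc d'" "e = Suc e'" by (metis gr0_conv_Suc nat_0_less_mult_iff)
    with b show "(\<lambda>(r,d). (Suc r * Suc d, Suc r)) ((\<lambda>(n,d). (d - 1, n div d - 1)) b) = b"
      by (simp del: mult_Suc mult_Suc_right)
  qed (auto simp del: mult_Suc mult_Suc_right)
  finally have "((\<lambda>n. \<Sum>d | d dvd n. q ^ n / of_nat d) has_sum ?S) {1..}"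
    by (rule has_sum_SigmaD) (auto intro!: has_sum_finite finite_divisors_nat)
  also have "?this \<longleftrightarrow> ((\<lambda>n. fps_nth lambert_fps n * q ^ n) has_sum ?S) UNIV"
    by (rule has_sum_cong_neutral) (auto simp: lambert_fps_def sum_distrib_right not_le)
  finally show ?thesis by (rule has_sum_imp_sums)
qed

lemma fps_conv_radius_geI_sums:
  fixes F :: "complex fps"
  assumes "\<And>q. norm q < 1 \<Longrightarrow> (\<lambda>n. fps_nth F n * q ^ n) sums f q"
  shows "fps_conv_radius F \<ge> 1"
  unfolding fps_conv_radius_def
proof (rule conv_radius_geI_ex)
  fix r :: real assume "0 < r" "ereal r < 1"
  thus "\<exists>z. norm z = r \<and> summable (\<lambda>n. fps_nth F n * z ^ n)"
    using assms[of "of_real r"] by (intro exI[of _ "of_real r"]) (auto simp: summable_def)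
qed

lemma fps_conv_radius_lambert: "fps_conv_radius lambert_fps \<ge> 1"
  using lambert_fps_sums by (rule fps_conv_radius_geI_sums)

text \<open>The composite of \<open>exp\<close> with the Lambert series is holomorphic on the unit
  disc. Uniqueness of expansions identifies its Taylor series with \<open>num_fps\<close>, which
  bounds the radius without a growth estimate for the partition numbers.\<close>

lemma fps_conv_radius_num: "fps_conv_radius num_fps \<ge> 1"
  and eval_num_fps: "norm q < 1 \<Longrightarrow> eval_fps num_fps q = exp (eval_fps lambert_fps q)"
proof -
  let ?f = "exp \<circ> eval_fps lambert_fps"
  have rad: "eball 0 1 \<subseteq> eball 0 (fps_conv_radius lambert_fps)"
    using fps_conv_radius_lambert by (rule eball_mono)
  have holo: "?f holomorphic_on eball 0 1"
    by (intro holomorphic_on_compose holomorphic_on_exp holomorphic_on_eval_fps rad)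
  have "?f has_fps_expansion num_fps"
    unfolding num_fps_eq_exp
    by (intro has_fps_expansion_compose has_fps_expansion_exp1 eval_fps_has_fps_expansion)
       (use fps_conv_radius_lambert in \<open>auto simp: lambert_fps_def intro: order.strict_trans2[of _ 1]\<close>)
  moreover have "?f has_fps_expansion fps_expansion ?f 0"
    using holo by (intro has_fps_expansion_fps_expansion[of "eball 0 1"]) (auto simp: open_eball)
  ultimately have eq: "num_fps = fps_expansion ?f 0"
    by (rule fps_expansion_unique_complex)
  show "fps_conv_radius num_fps \<ge> 1"
    unfolding eq by (rule conv_radius_fps_expansion[OF holo])
  show "eval_fps num_fps q = exp (eval_fps lambert_fps q)" if "norm q < 1"
    unfolding eq using eval_fps_expansion'[OF holo, of q] that by simp
qed

text \<open>A logarithm of P(exp(-z)) given by a series, so that no branch has to be chosen.\<close>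

definition lambert :: "complex \<Rightarrow> complex" where
  "lambert z = eval_fps lambert_fps (exp (-z))"

lemma has_sum_lambert:
  assumes "Re z > 0"
  shows "((\<lambda>(r,d). exp (-z) ^ (Suc r * Suc d) / of_nat (Suc r)) has_sum lambert z) (UNIV \<times> UNIV)"
proof -
  have q: "norm (exp (-z)) < 1" using assms by simp
  have "lambert z = (\<Sum>\<^sub>\<infinity>(r,d)\<in>UNIV \<times> UNIV. exp (-z) ^ (Suc r * Suc d) / of_nat (Suc r))"
    using lambert_fps_sums[OF q] by (simp add: lambert_def eval_fps_def sums_iff)
  thus ?thesis using has_sum_infsum[OF summable_on_lambert[OF q]] by simp
qed

lemma exp_neg_Suc_power: "exp (-z) ^ Suc r = exp (- (of_nat (Suc r) * z))" for z :: "'a :: {banach, real_normed_field}"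
  by (simp only: exp_of_nat_mult [symmetric] mult_minus_right)

abbreviation lambert_term :: "nat \<Rightarrow> complex \<Rightarrow> complex" where
  "lambert_term k z \<equiv> exp (- (of_nat (Suc k) * z)) / (1 - exp (- (of_nat (Suc k) * z))) / of_nat (Suc k)"

lemma lambert_sums:
  assumes "Re z > 0"
  shows "(\<lambda>k. lambert_term k z) sums lambert z"
proof (rule has_sum_imp_sums, rule has_sum_SigmaD[OF has_sum_lambert[OF assms]])
  fix k :: nat
  define w where "w = exp (- (of_nat (Suc k) * z))"
  have w: "norm w < 1" using assms by (simp add: w_def del: of_nat_Suc)
  have "((\<lambda>d. w ^ Suc d / of_nat (Suc k)) has_sum (w / (1 - w) / of_nat (Suc k))) UNIV"
  proof (rule norm_summable_imp_has_sum)
    show "(\<lambda>d. w ^ Suc d / of_nat (Suc k)) sums (w / (1 - w) / of_nat (Suc k))"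
      using sums_mult[OF geometric_sums[OF w], of w] by (intro sums_divide) simp
    show "summable (\<lambda>d. norm (w ^ Suc d / of_nat (Suc k)))"
      using w by (simp add: norm_divide norm_mult norm_power summable_geometric summable_mult summable_divide del: of_nat_Suc)
  qed
  thus "((\<lambda>y. case (k, y) of (r, d) \<Rightarrow> exp (- z) ^ (Suc r * Suc d) / of_nat (Suc r)) has_sum
      (lambert_term k z)) UNIV"
    by (simp only: w_def prod.case power_mult exp_neg_Suc_power[symmetric])
qed

text \<open>For fixed d the sum over r is the series of a logarithm. This is the Euler product in
  logarithmic form, kept to the real axis, where it is compared with the product for sinh.\<close>

lemma lambert_real_sums:
  assumes "x > 0"
  shows "(\<lambda>k. - ln (1 - exp (- (real (Suc k) * x)))) sums Re (lambert (of_real x))"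
proof -
  have "((\<lambda>(r,d). exp (-of_real x) ^ (Suc r * Suc d) / of_nat (Suc r)) has_sum lambert (of_real x)) (UNIV \<times> UNIV)"
    using assms by (intro has_sum_lambert) auto
  hence "((\<lambda>(d,r). exp (-of_real x) ^ (Suc r * Suc d) / of_nat (Suc r)) has_sum lambert (of_real x)) (UNIV \<times> UNIV)"
    by (subst (asm) has_sum_swap) simp
  moreover have "exp (-of_real x) ^ (Suc r * Suc d) / of_nat (Suc r) = (of_real (exp (-x) ^ (Suc d * Suc r) / real (Suc r)) :: complex)" for r d
    by (simp only: exp_of_real [symmetric] of_real_minus of_real_power of_real_divide of_real_of_nat_eq mult.commute)
  ultimately have "((\<lambda>p. of_real (case p of (d,r) \<Rightarrow> exp (-x) ^ (Suc d * Suc r) / real (Suc r))) has_sum lambert (of_real x)) (UNIV \<times> UNIV)"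
    by (simp only: case_prod_unfold)
  hence "((\<lambda>(d,r). exp (-x) ^ (Suc d * Suc r) / real (Suc r)) has_sum Re (lambert (of_real x))) (UNIV \<times> UNIV)"
    by (drule_tac has_sum_Re) (simp only: Re_complex_of_real)
  thus ?thesis
  proof (rule has_sum_imp_sums[OF has_sum_SigmaD])
    fix k :: nat
    define w where "w = exp (- (real (Suc k) * x))"
    have w: "0 < w" "w < 1" using assms by (auto simp: w_def simp del: of_nat_Suc)
    have "(\<lambda>r. w ^ Suc r / real (Suc r)) sums (- ln (1 - w))"
      using sums_minus[OF ln_series'[of "-w"]] w by (subst sums_Suc_iff) simp
    hence "((\<lambda>r. w ^ Suc r / real (Suc r)) has_sum (- ln (1 - w))) UNIV"
      by (rule sums_nonneg_imp_has_sum) (use w in auto)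
    thus "((\<lambda>y. case (k, y) of (d, r) \<Rightarrow> exp (- x) ^ (Suc d * Suc r) / real (Suc r)) has_sum
      (- ln (1 - exp (- (real (Suc k) * x))))) UNIV"
      by (simp only: w_def prod.case power_mult exp_neg_Suc_power[symmetric])
  qed
qed


text \<open>\<open>cth w\<close> is \<open>coth (w/2)\<close>.\<close>

definition cth :: "complex \<Rightarrow> complex" where
  "cth w = (1 + exp (-w)) / (1 - exp (-w))"

abbreviation ediff :: "nat \<Rightarrow> complex \<Rightarrow> complex" where
  "ediff j z \<equiv> exp (- (of_nat (j * j) * z)) - exp (- (2 * of_nat (j * j) * z))"

definition hterm :: "nat \<Rightarrow> complex \<Rightarrow> complex" where
  "hterm j z = ediff j z * cth (of_nat j * z)"

definition hsum :: "complex \<Rightarrow> complex" where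
  "hsum z = (\<Sum>j. hterm (Suc j) z)"

section \<open>The generating function of the strings\<close>

definition string_fps :: "nat \<Rightarrow> complex fps" where
  "string_fps m = Abs_fps (\<lambda>s. of_nat (string_count m s))"

definition C_fps :: "nat \<Rightarrow> complex fps" where
  "C_fps m = Abs_fps (\<lambda>n. of_nat (C m n))"

lemma C_fps_eq: "1 \<le> m \<Longrightarrow> C_fps m = string_fps m * num_fps"
  by (simp add: C_fps_def string_fps_def num_fps_def fps_eq_iff fps_mult_nth C_eq_convolution atLeast0AtMost)

text \<open>The weights 1, 2, ..., 2, 1 are the coefficients of (1 + v)(1 + v + ... +
  v^(j-1)).\<close>

lemma sum_string_weight:
  fixes v :: "'a :: field"
  assumes "1 \<le> j" "v \<noteq> 1"
  shows "(\<Sum>k\<le>j. of_nat (string_weight j k) * v ^ k) = (1 + v) * (1 - v ^ j) / (1 - v)"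
proof -
  have "(\<Sum>k\<le>j. of_nat (string_weight j k) * v ^ k) =
      (\<Sum>k\<le>j. (if k < j then v ^ k else 0) + (if 0 < k then v ^ k else 0))"
    using assms(1) by (intro sum.cong) (auto simp: string_weight_def)
  also have "\<dots> = (\<Sum>k<j. v ^ k) + (\<Sum>k\<in>{0<..j}. v ^ k)"
    unfolding sum.distrib
    by (intro arg_cong2[where f = "(+)"] sum.mono_neutral_cong_right) auto
  also have "(\<Sum>k\<in>{0<..j}. v ^ k) = (\<Sum>k<j. v * v ^ k)"
    by (rule sum.reindex_bij_witness[where i = Suc and j = "\<lambda>k. k - 1"]) (auto simp flip: power_Suc)
  also have "(\<Sum>k<j. v ^ k) + (\<Sum>k<j. v * v ^ k) = (1 + v) * (\<Sum>k<j. v ^ k)"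
    by (simp only: sum_distrib_left [symmetric] distrib_right mult_1_left)
  also have "(\<Sum>k<j. v ^ k) = (1 - v ^ j) / (1 - v)"
    using assms(2) by (simp add: sum_gp_strict)
  finally show ?thesis by simp
qed

lemma string_weight_le: "string_weight j k \<le> 2"
  by (simp add: string_weight_def)

abbreviation string_term :: "nat \<Rightarrow> complex \<Rightarrow> nat \<Rightarrow> nat \<Rightarrow> complex" where
  "string_term m q j k \<equiv> of_nat (string_weight (Suc j) k) * q ^ (m * (Suc j * (Suc j + k)))"

lemma summable_on_string:
  fixes q :: complex
  assumes "norm q < 1" "1 \<le> m"
  shows "(\<lambda>(j,k). string_term m q j k) summable_on (SIGMA j:UNIV. {..Suc j})"
proof -
  define \<rho> where "\<rho> = norm q"
  have \<rho>: "0 \<le> \<rho>" "\<rho> < 1" using assms by (auto simp: \<rho>_def)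
  let ?b = "\<lambda>j k. real (string_weight (Suc j) k) * \<rho> ^ (m * (Suc j * (Suc j + k)))"
  have "(\<lambda>j. \<Sum>k\<le>Suc j. ?b j k) summable_on UNIV"
  proof (rule summable_nonneg_imp_summable_on)
    show "summable (\<lambda>j. \<Sum>k\<le>Suc j. ?b j k)"
    proof (rule summable_comparison_test')
      have "summable (\<lambda>j. real (Suc j) * \<rho> ^ j)"
        using geometric_deriv_sums[of \<rho>] \<rho> by (simp add: sums_iff)
      from summable_mult[OF this, of 4]
      show "summable (\<lambda>j. 4 * (real (Suc j) * \<rho> ^ j))" .
      fix j
      have "?b j k \<le> 2 * \<rho> ^ j" for k
      proof (rule mult_mono)
        show "real (string_weight (Suc j) k) \<le> 2" using string_weight_le[of "Suc j" k] by linarith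
        have "j * 1 \<le> Suc j * (Suc j + k)" by (rule mult_le_mono) auto
        also have "1 * \<dots> \<le> m * \<dots>" using assms by (intro mult_le_mono) auto
        finally show "\<rho> ^ (m * (Suc j * (Suc j + k))) \<le> \<rho> ^ j"
          using \<rho> by (intro power_decreasing) auto
      qed (use \<rho> in auto)
      hence "(\<Sum>k\<le>Suc j. ?b j k) \<le> (\<Sum>k\<le>Suc j. 2 * \<rho> ^ j)" by (rule sum_mono)
      also have "\<dots> = (2 * real (Suc (Suc j))) * \<rho> ^ j" by (simp del: of_nat_Suc)
      also have "\<dots> \<le> (4 * real (Suc j)) * \<rho> ^ j" using \<rho> by (intro mult_right_mono) auto
      finally have "(\<Sum>k\<le>Suc j. ?b j k) \<le> 4 * (real (Suc j) * \<rho> ^ j)" by (simp only: mult.assoc)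
      moreover have "(\<Sum>k\<le>Suc j. ?b j k) \<ge> 0" using \<rho> by (intro sum_nonneg) auto
      ultimately show "norm (\<Sum>k\<le>Suc j. ?b j k) \<le> 4 * (real (Suc j) * \<rho> ^ j)" by (simp only: real_norm_def abs_of_nonneg)
    qed
  qed (use \<rho> in \<open>auto intro!: sum_nonneg simp del: sum.atMost_Suc\<close>)
  hence "(\<lambda>(j,k). ?b j k) summable_on (SIGMA j:UNIV. {..Suc j})"
    by (intro summable_on_SigmaI[where g = "\<lambda>j. \<Sum>k\<le>Suc j. ?b j k"])
       (use \<rho> in \<open>auto intro!: has_sum_finite simp del: sum.atMost_Suc mult_Suc\<close>)
  moreover have "norm (string_term m q j k) = ?b j k" for j k
    by (simp only: norm_mult norm_power norm_of_nat \<rho>_def)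
  ultimately have "(\<lambda>x. norm ((\<lambda>(j,k). string_term m q j k) x)) summable_on (SIGMA j:UNIV. {..Suc j})"
    by (simp only: case_prod_unfold)
  thus ?thesis by (rule abs_summable_summable)
qed

lemma string_fps_sums:
  assumes "norm q < 1" "1 \<le> m"
  shows "(\<lambda>n. fps_nth (string_fps m) n * q ^ n) sums
    (\<Sum>\<^sub>\<infinity>(j,k)\<in>(SIGMA j:UNIV. {..Suc j}). string_term m q j k)" (is "_ sums ?S")
proof -
  define D where "D s = {(j,k). 1 \<le> j \<and> k \<le> j \<and> m * (j * (j + k)) = s}" for s
  have fin: "finite (D s)" for s
    by (rule finite_subset[OF _ finite_string_index[OF assms(2), of s]]) (auto simp: D_def)
  have "((\<lambda>(j,k). string_term m q j k) has_sum ?S) (SIGMA j:UNIV. {..Suc j})"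
    using summable_on_string[OF assms] by (rule has_sum_infsum)
  also have "?this \<longleftrightarrow> ((\<lambda>(s,(j,k)). of_nat (string_weight j k) * q ^ s) has_sum ?S) (SIGMA s:UNIV. D s)"
    by (rule has_sum_reindex_bij_witness[where j = "\<lambda>(j,k). (m * (Suc j * (Suc j + k)), (Suc j, k))" and i = "\<lambda>(s,(j,k)). (j - 1, k)"])
       (auto simp: D_def simp del: mult_Suc mult_Suc_right)
  finally have "((\<lambda>s. \<Sum>p\<in>D s. (\<lambda>(s,(j,k)). of_nat (string_weight j k) * q ^ s) (s, p)) has_sum ?S) UNIV"
    by (rule has_sum_SigmaD) (intro has_sum_finite fin)
  also have "(\<lambda>s. \<Sum>p\<in>D s. (\<lambda>(s,(j,k)). of_nat (string_weight j k) * q ^ s) (s, p)) = (\<lambda>n. fps_nth (string_fps m) n * q ^ n)"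
    by (simp add: string_fps_def string_count_def D_def sum_distrib_right case_prod_unfold fun_eq_iff)
  finally show ?thesis by (rule has_sum_imp_sums)
qed

lemma fps_conv_radius_string: "1 \<le> m \<Longrightarrow> fps_conv_radius (string_fps m) \<ge> 1"
  using string_fps_sums by (rule fps_conv_radius_geI_sums)

text \<open>Put p = exp(-m z) and v = p^j. For fixed j the sum over k is p^(j^2) (1 - v^j) (1 +
  v)/(1 - v), and p^(j^2) v^j = p^(2 j^2) yields \<open>ediff\<close> times \<open>cth\<close>. The
  parameter m enters only by replacing z with m z.\<close>

lemma hterm_sums:
  assumes "Re z > 0" "1 \<le> m"
  shows "(\<lambda>j. hterm (Suc j) (of_nat m * z)) sums eval_fps (string_fps m) (exp (-z))"
proof -
  have q: "norm (exp (-z)) < 1" using assms by simp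
  have ev: "eval_fps (string_fps m) (exp (-z)) =
    (\<Sum>\<^sub>\<infinity>(j,k)\<in>(SIGMA j:UNIV. {..Suc j}). string_term m (exp (-z)) j k)"
    using string_fps_sums[OF q assms(2)] by (simp add: eval_fps_def sums_iff)
  show ?thesis
  proof (rule has_sum_imp_sums, rule has_sum_SigmaD)
    show "((\<lambda>(j,k). string_term m (exp (-z)) j k) has_sum eval_fps (string_fps m) (exp (-z))) (SIGMA j:UNIV. {..Suc j})"
      unfolding ev by (rule has_sum_infsum[OF summable_on_string[OF q assms(2)]])
    fix j :: nat
    define J where "J = Suc j"
    define p where "p = exp (- (of_nat m * z))"
    define v where "v = p ^ J"
    have v: "v = exp (- (of_nat J * (of_nat m * z)))"
      by (simp add: v_def p_def exp_of_nat_mult [symmetric])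
    have p: "p = exp (-z) ^ m" by (simp add: p_def exp_of_nat_mult [symmetric])
    have "norm v < 1" unfolding v norm_exp_eq_Re using assms by (simp add: J_def del: of_nat_Suc)
    hence v1: "v \<noteq> 1" by auto
    have pow: "exp (-z) ^ (m * (J * (J + k))) = p ^ (J * J) * v ^ k" for k
    proof -
      have "m * (J * (J + k)) = m * (J * J) + m * J * k" by (simp add: algebra_simps)
      thus ?thesis by (simp only: p v_def power_add power_mult)
    qed
    have "(\<Sum>k\<le>J. of_nat (string_weight J k) * exp (-z) ^ (m * (J * (J + k)))) = p ^ (J * J) * (\<Sum>k\<le>J. of_nat (string_weight J k) * v ^ k)"
      unfolding pow sum_distrib_left by (intro sum.cong refl) (simp only: mult.left_commute)
    also have "\<dots> = (p ^ (J * J) - p ^ (J * J) * v ^ J) * ((1 + v) / (1 - v))"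
    proof -
      have "(\<Sum>k\<le>J. of_nat (string_weight J k) * v ^ k) = (1 + v) * (1 - v ^ J) / (1 - v)"
        using v1 by (intro sum_string_weight) (simp add: J_def)
      moreover have "P * ((1 + v) * (1 - w) / (1 - v)) = (P - P * w) * ((1 + v) / (1 - v))" for P w :: complex
        by (simp add: divide_inverse algebra_simps)
      ultimately show ?thesis by (simp only:)
    qed
    also have "p ^ (J * J) * v ^ J = p ^ (2 * (J * J))"
      unfolding v_def by (simp only: power_mult [symmetric] power_add [symmetric] mult_2)
    also have "p ^ (2 * (J * J)) = exp (- (2 * of_nat (J * J) * (of_nat m * z)))"
      unfolding p_def exp_of_nat_mult [symmetric] by (simp add: algebra_simps)
    also have "p ^ (J * J) = exp (- (of_nat (J * J) * (of_nat m * z)))"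
      unfolding p_def exp_of_nat_mult [symmetric] by (simp add: algebra_simps)
    also have "(1 + v) / (1 - v) = cth (of_nat J * (of_nat m * z))"
      by (simp add: cth_def v)
    finally have "(\<Sum>k\<le>J. of_nat (string_weight J k) * exp (-z) ^ (m * (J * (J + k)))) = hterm J (of_nat m * z)"
      by (simp only: hterm_def)
    thus "((\<lambda>y. case (j, y) of (j, k) \<Rightarrow> string_term m (exp (-z)) j k) has_sum hterm (Suc j) (of_nat m * z)) {..Suc j}"
      unfolding J_def prod.case by (metis (no_types, lifting) finite_atMost has_sum_finite)
  qed
qed

lemma eval_C_fps:
  assumes "1 \<le> m" "Re z > 0"
  shows "eval_fps (C_fps m) (exp (-z)) = exp (lambert z) * hsum (of_nat m * z)"
proof -
  have q: "norm (exp (-z)) < 1" using assms by simp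
  have q': "ereal (norm (exp (-z))) < fps_conv_radius (string_fps m)" "ereal (norm (exp (-z))) < fps_conv_radius num_fps"
    using q fps_conv_radius_string[OF assms(1)] fps_conv_radius_num by (auto intro: order.strict_trans2[of _ 1])
  have "eval_fps (string_fps m) (exp (-z)) = hsum (of_nat m * z)"
    using hterm_sums[OF assms(2,1)] by (simp add: hsum_def sums_iff)
  thus ?thesis
    unfolding C_fps_eq[OF assms(1)] eval_fps_mult[OF q'] eval_num_fps[OF q] lambert_def by simp
qed

lemma fps_conv_radius_C: "1 \<le> m \<Longrightarrow> fps_conv_radius (C_fps m) \<ge> 1"
  unfolding C_fps_eq using fps_conv_radius_mult[of "string_fps m" num_fps] fps_conv_radius_string[of m] fps_conv_radius_num
  by (auto intro: order_trans[rotated])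

subsection \<open>The regular part of the hyperbolic cotangent\<close>

definition kap :: "complex \<Rightarrow> complex" where
  "kap w = cth w - 2 / w"

text \<open>\<open>dexp w = 2 sinh (w/2)\<close>, so that \<open>(coth (w/2))' = - 2 / (dexp w)^2\<close>.\<close>

definition dexp :: "complex \<Rightarrow> complex" where
  "dexp w = exp (w / 2) - exp (- w / 2)"

lemma exp_minus_exp_neg_ge:
  fixes a :: real
  assumes "a \<ge> 0"
  shows "exp a - exp (-a) \<ge> 2 * a"
proof -
  have 1: "1 + a + a\<^sup>2 / 2 \<le> exp a" using assms by (rule exp_lower_Taylor_quadratic)
  \<comment> \<open>The product of the quadratic Taylor polynomials at a and -a is at least 1; this
    converts the lower bound for \<open>exp a\<close> into an upper bound for
    \<open>exp (-a)\<close>.\<close>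
  have "(1 - a + a\<^sup>2 / 2) * (1 + a + a\<^sup>2 / 2) = 1 + a ^ 4 / 4"
    by (simp add: field_simps power2_eq_square power4_eq_xxxx)
  hence le: "1 \<le> (1 - a + a\<^sup>2 / 2) * (1 + a + a\<^sup>2 / 2)" by simp
  have "1 - a + a\<^sup>2 / 2 = ((1 - a)\<^sup>2 + 1) / 2" by (simp add: power2_eq_square field_simps)
  moreover have "0 \<le> ((1 - a)\<^sup>2 + 1) / 2" by simp
  ultimately have "0 \<le> 1 - a + a\<^sup>2 / 2" by (simp only:)
  hence "(1 - a + a\<^sup>2 / 2) * (1 + a + a\<^sup>2 / 2) \<le> (1 - a + a\<^sup>2 / 2) * exp a"
    using 1 by (intro mult_left_mono)
  with le have "1 \<le> (1 - a + a\<^sup>2 / 2) * exp a" by linarith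
  hence "exp (-a) \<le> 1 - a + a\<^sup>2 / 2"
    by (simp add: exp_minus field_simps)
  with 1 show ?thesis by simp
qed

text \<open>The difference of the moduli of the two exponentials is 2 sinh(Re w / 2). In the cone,
  where Re w is at least |w|/2, this keeps \<open>dexp w\<close> away from 0 by a multiple of
  |w|.\<close>

lemma norm_dexp_ge:
  assumes "Re w \<ge> 0"
  shows "norm (dexp w) \<ge> Re w"
proof -
  have "Re w \<le> exp (Re w / 2) - exp (- (Re w / 2))"
    using exp_minus_exp_neg_ge[of "Re w / 2"] assms by simp
  also have "\<dots> = norm (exp (w / 2)) - norm (exp (- w / 2))" by simp
  also have "\<dots> \<le> norm (dexp w)" unfolding dexp_def by (rule norm_triangle_ineq2)
  finally show ?thesis .
qed

lemma dexp_sq: "(dexp w)\<^sup>2 = exp w + exp (-w) - 2"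
proof -
  have "(exp (w / 2))\<^sup>2 = exp w" "(exp (- w / 2))\<^sup>2 = exp (-w)" "exp (w/2) * exp (-w/2) = 1"
    by (simp_all add: exp_double [symmetric] flip: exp_add)
  thus ?thesis by (simp add: dexp_def power2_diff mult.assoc)
qed

lemma dexp_sq': "(dexp w)\<^sup>2 * exp (-w) = (1 - exp (-w))\<^sup>2"
proof -
  have "exp w * exp (-w) = 1" by (simp flip: exp_add)
  thus ?thesis unfolding dexp_sq by (simp add: power2_eq_square algebra_simps)
qed

lemma cth_eq_dexp:
  "cth w = (exp (w / 2) + exp (- w / 2)) / dexp w"
proof -
  have "exp (w/2) * exp (-w/2) = 1" "exp (-w/2) * exp (-w/2) = exp (-w)" by (simp_all flip: exp_add)
  hence "1 + exp (-w) = exp (- w / 2) * (exp (w / 2) + exp (- w / 2))" "1 - exp (-w) = exp (- w / 2) * dexp w"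
    by (simp_all add: dexp_def algebra_simps)
  thus ?thesis by (simp add: cth_def)
qed

lemma one_minus_exp_neq_0: "Re w > 0 \<Longrightarrow> 1 - exp (-w) \<noteq> 0"
  by (metis exp_eq_1 eq_iff_diff_eq_0 minus_complex.simps(1) neg_0_equal_iff_equal order_less_irrefl uminus_complex.simps(1) verit_minus_simplify(4))

lemma kap_has_field_derivative:
  assumes "Re w > 0"
  shows "(kap has_field_derivative (2 / w\<^sup>2 - 2 / (dexp w)\<^sup>2)) (at w)"
proof -
  have nz: "1 - exp (-w) \<noteq> 0" "w \<noteq> 0" using one_minus_exp_neq_0[OF assms] assms by auto
  have d: "dexp w \<noteq> 0" using norm_dexp_ge[of w] assms by auto
  have "2 / (dexp w)\<^sup>2 = 2 * exp (-w) / (1 - exp (-w))\<^sup>2"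
    unfolding dexp_sq' [symmetric] using d by simp
  moreover have "((\<lambda>w. (1 + exp (-w)) / (1 - exp (-w)) - 2 / w) has_field_derivative
      (2 / w\<^sup>2 - 2 * exp (-w) / (1 - exp (-w))\<^sup>2)) (at w)"
    using nz by (auto intro!: derivative_eq_intros simp: power2_eq_square) (simp add: divide_simps, algebra)
  ultimately show ?thesis by (simp add: kap_def [abs_def] cth_def)
qed

lemma exp_le_3: "t \<le> 1 \<Longrightarrow> exp t \<le> (3::real)"
  using exp_le order_trans[of "exp t" "exp 1" 3] by simp

lemma norm_exp_Taylor2:
  fixes w :: complex
  assumes "norm w \<le> 1"
  shows "norm (exp w - (1 + w + w\<^sup>2 / 2)) \<le> 2 * norm w ^ 3"
proof -
  have "norm (exp w - (\<Sum>i\<le>2. w ^ i / fact i)) \<le> exp (norm w) * norm w ^ Suc 2 / fact 2"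
    by (rule Taylor_exp_field)
  also have "\<dots> \<le> 3 * norm w ^ 3 / 2"
    using exp_le_3[OF assms] by (simp add: mult_right_mono divide_right_mono)
  also have "\<dots> \<le> 2 * norm w ^ 3" by simp
  finally show ?thesis by (simp add: numeral_2_eq_2)
qed

lemma norm_exp_Taylor3:
  fixes w :: complex
  assumes "norm w \<le> 1"
  shows "norm (exp w - (1 + w + w\<^sup>2 / 2 + w ^ 3 / 6)) \<le> norm w ^ 4 / 2"
proof -
  have "norm (exp w - (\<Sum>i\<le>3. w ^ i / fact i)) \<le> exp (norm w) * norm w ^ Suc 3 / fact 3"
    by (rule Taylor_exp_field)
  also have "\<dots> \<le> 3 * norm w ^ 4 / 6"
    using mult_right_mono[OF exp_le_3[OF assms], of "norm w ^ 4"] by (simp add: fact_numeral)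
  also have "(\<Sum>i\<le>3. w ^ i / fact i) = 1 + w + w\<^sup>2 / 2 + w ^ 3 / 6"
    by (simp add: eval_nat_numeral)
  finally show ?thesis by simp
qed

lemma cone_norm_le: "\<bar>Im w\<bar> \<le> Re w \<Longrightarrow> norm w \<le> 2 * Re w"
  using cmod_le[of w] by linarith

text \<open>For |w| \<le> 1 the odd powers cancel in exp(w) + exp(-w) - 2, so (dexp w)^2 - w^2 =
  O(w^4) and the double poles cancel. For larger r = |w| both fractions are estimated separately:
  2/r^2 + 8/r^2 = 40/(2 r)^2 is the origin of the 40. The shape 1/(1 + r)^2 is chosen to be summable
  over multiples of a point.\<close>

lemma norm_kap_deriv_le:
  assumes "Re w > 0" "\<bar>Im w\<bar> \<le> Re w"
  shows "norm (2 / w\<^sup>2 - 2 / (dexp w)\<^sup>2) \<le> 40 / (1 + norm w)\<^sup>2"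
proof -
  define r where "r = norm w"
  have r: "r > 0" using assms by (auto simp: r_def)
  have "r / 2 \<le> norm (dexp w)"
    using cone_norm_le[OF assms(2)] norm_dexp_ge[of w] assms by (simp add: r_def)
  hence "(r / 2)\<^sup>2 \<le> (norm (dexp w))\<^sup>2" using r by (intro power_mono) auto
  hence d: "r\<^sup>2 / 4 \<le> norm ((dexp w)\<^sup>2)" by (simp add: norm_power power_divide)
  have nz: "w \<noteq> 0" "dexp w \<noteq> 0" using r d by (auto simp: r_def)
  show ?thesis
  proof (cases "r \<le> 1")
    case True
    have "(dexp w)\<^sup>2 - w\<^sup>2 = (exp w - (1 + w + w\<^sup>2 / 2 + w ^ 3 / 6)) + (exp (-w) - (1 + (-w) + (-w)\<^sup>2 / 2 + (-w) ^ 3 / 6))"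
      by (simp add: dexp_sq)
    also have "norm \<dots> \<le> norm w ^ 4 / 2 + norm (-w) ^ 4 / 2"
      by (intro norm_triangle_mono norm_exp_Taylor3) (use True in \<open>auto simp: r_def\<close>)
    finally have num: "norm ((dexp w)\<^sup>2 - w\<^sup>2) \<le> r ^ 4" by (simp add: r_def)
    have "2 / w\<^sup>2 - 2 / (dexp w)\<^sup>2 = 2 * ((dexp w)\<^sup>2 - w\<^sup>2) / (w\<^sup>2 * (dexp w)\<^sup>2)"
      using nz by (simp add: field_simps)
    also have "norm \<dots> = 2 * norm ((dexp w)\<^sup>2 - w\<^sup>2) / (r\<^sup>2 * norm ((dexp w)\<^sup>2))"
      by (simp only: norm_divide norm_mult norm_power r_def norm_numeral)
    also have "\<dots> \<le> 2 * r ^ 4 / (r\<^sup>2 * (r\<^sup>2 / 4))"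
      using num d r by (intro frac_le mult_left_mono) auto
    also have "\<dots> = 8" using r by (simp add: field_simps power2_eq_square power4_eq_xxxx)
    also have "8 \<le> 40 / (1 + r)\<^sup>2"
    proof -
      have "(1 + r)\<^sup>2 \<le> 2\<^sup>2" using True r by (intro power_mono) auto
      thus ?thesis using r by (simp add: field_simps)
    qed
    finally show ?thesis by (simp add: r_def)
  next
    case False
    have "norm (2 / w\<^sup>2 - 2 / (dexp w)\<^sup>2) \<le> 2 / r\<^sup>2 + 2 / norm ((dexp w)\<^sup>2)"
      by (rule norm_triangle_le_diff) (simp add: norm_divide norm_power r_def)
    also have "\<dots> \<le> 2 / r\<^sup>2 + 2 / (r\<^sup>2 / 4)"
      using d r by (intro add_left_mono frac_le) auto
    also have "\<dots> = 40 / (2 * r)\<^sup>2" using r by (simp add: field_simps)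
    also have "\<dots> \<le> 40 / (1 + r)\<^sup>2"
      using False r by (intro divide_left_mono power_mono) auto
    finally show ?thesis by (simp add: r_def)
  qed
qed

lemma norm_kap_minus_linear_le:
  assumes "Re w > 0" "\<bar>Im w\<bar> \<le> Re w"
  shows "norm (kap w - w / 6) \<le> 20 * (norm w)\<^sup>2"
proof -
  define r where "r = norm w"
  have r: "r > 0" using assms by (auto simp: r_def)
  have rr: "r / 2 \<le> Re w" using cone_norm_le[OF assms(2)] by (simp add: r_def)
  hence d: "r / 2 \<le> norm (dexp w)"
    using norm_dexp_ge[of w] assms by simp
  have nz: "w \<noteq> 0" "dexp w \<noteq> 0" using r d by (auto simp: r_def)
  show ?thesis
  proof (cases "r \<le> 1")
    case True
    define A where "A = exp (w / 2) - (1 + w / 2 + (w / 2)\<^sup>2 / 2 + (w / 2) ^ 3 / 6)"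
    define B where "B = exp (- w / 2) - (1 + (- w / 2) + (- w / 2)\<^sup>2 / 2 + (- w / 2) ^ 3 / 6)"
    have AB: "norm A \<le> r ^ 4 / 32" "norm B \<le> r ^ 4 / 32"
      using norm_exp_Taylor3[of "w / 2"] norm_exp_Taylor3[of "- w / 2"] True
      by (simp_all add: A_def B_def r_def norm_divide power_divide)
    have e: "exp (w / 2) = 1 + w / 2 + w\<^sup>2 / 8 + w ^ 3 / 48 + A" "exp (- w / 2) = 1 - w / 2 + w\<^sup>2 / 8 - w ^ 3 / 48 + B"
      by (simp_all add: A_def B_def power_divide)
    have "kap w - w / 6 = (w * (exp (w/2) + exp (-w/2)) - 2 * dexp w - w\<^sup>2 / 6 * dexp w) / (w * dexp w)"
      unfolding kap_def cth_eq_dexp using nz by (simp add: field_simps power2_eq_square)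
    \<comment> \<open>The powers w and w^3 cancel exactly; this is where 1/6 comes from. The
      remainders in A - B are only known to be O(r^4), hence a quadratic bound after division by r *
      (r/2).\<close>
    also have "w * (exp (w/2) + exp (-w/2)) - 2 * dexp w - w\<^sup>2 / 6 * dexp w =
        w * (A + B) - 2 * (A - B) - w\<^sup>2 / 6 * (A - B) - w ^ 5 / 144"
      unfolding dexp_def e by (simp add: field_simps power2_eq_square power3_eq_cube eval_nat_numeral)
    also have "norm (\<dots> / (w * dexp w)) = norm (w * (A + B) - 2 * (A - B) - w\<^sup>2 / 6 * (A - B) - w ^ 5 / 144) / (r * norm (dexp w))"
      by (simp add: norm_divide norm_mult r_def)
    also have "\<dots> \<le> (r * (r ^ 4 / 32 + r ^ 4 / 32) + 2 * (r ^ 4 / 32 + r ^ 4 / 32) + r\<^sup>2 / 6 * (r ^ 4 / 32 + r ^ 4 / 32) + r ^ 5 / 144) / (r * (r / 2))"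
    proof (intro frac_le mult_left_mono d)
      have AB': "norm (A + B) \<le> r ^ 4 / 32 + r ^ 4 / 32" "norm (A - B) \<le> r ^ 4 / 32 + r ^ 4 / 32"
        using AB norm_triangle_ineq[of A B] norm_triangle_ineq4[of A B] by linarith+
      show "norm (w * (A + B) - 2 * (A - B) - w\<^sup>2 / 6 * (A - B) - w ^ 5 / 144) \<le>
        r * (r ^ 4 / 32 + r ^ 4 / 32) + 2 * (r ^ 4 / 32 + r ^ 4 / 32) + r\<^sup>2 / 6 * (r ^ 4 / 32 + r ^ 4 / 32) + r ^ 5 / 144"
      proof (intro order_trans[OF norm_triangle_ineq4] add_mono)
        show "norm (w * (A + B)) \<le> r * (r ^ 4 / 32 + r ^ 4 / 32)"
          unfolding norm_mult r_def[symmetric] using AB' r by (intro mult_left_mono) auto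
        show "norm (2 * (A - B)) \<le> 2 * (r ^ 4 / 32 + r ^ 4 / 32)"
          unfolding norm_mult norm_numeral using AB' r by (intro mult_left_mono) auto
        show "norm (w\<^sup>2 / 6 * (A - B)) \<le> r\<^sup>2 / 6 * (r ^ 4 / 32 + r ^ 4 / 32)"
          unfolding norm_mult norm_divide norm_power norm_numeral r_def[symmetric] using AB' r by (intro mult_left_mono) auto
        show "norm (w ^ 5 / 144) \<le> r ^ 5 / 144"
          by (simp add: norm_divide norm_power r_def)
      qed
    qed (use r in auto)
    also have "\<dots> = r\<^sup>2 * (r / 8 + 1/4 + r\<^sup>2 / 48 + r / 72)"
      using r by (simp add: field_simps eval_nat_numeral)
    also have "\<dots> \<le> r\<^sup>2 * 20"
    proof (intro mult_left_mono)
      have "r\<^sup>2 \<le> 1" using True r by (simp add: power_le_one)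
      thus "r / 8 + 1/4 + r\<^sup>2 / 48 + r / 72 \<le> 20" using True by linarith
    qed auto
    finally show ?thesis by (simp add: r_def mult.commute)
  next
    case False
    have "exp (- Re w) \<le> exp (- (1/2))" using rr False by simp
    also have "\<dots> \<le> 2 / (3::real)"
      using exp_ge_add_one_self[of "1/2::real"] by (simp add: exp_minus field_simps)
    finally have e: "exp (- Re w) \<le> 2/3" .
    have "1 - exp (- Re w) \<le> norm (1 - exp (-w))"
      using norm_triangle_ineq2[of 1 "exp (-w)"] by simp
    hence d1: "1 / 3 \<le> norm (1 - exp (-w))" using e by simp
    have "norm (1 + exp (-w)) \<le> 2"
      using norm_triangle_ineq[of 1 "exp (-w)"] e by simp
    hence "norm (cth w) \<le> 2 / (1 / 3)"
      unfolding cth_def norm_divide using d1 by (intro frac_le) auto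
    moreover have "norm (2 / w) \<le> 2" using False by (simp add: norm_divide r_def divide_le_eq)
    ultimately have "norm (kap w) \<le> 8"
      unfolding kap_def using norm_triangle_ineq4[of "cth w" "2 / w"] by simp
    hence "norm (kap w - w / 6) \<le> 8 + r / 6"
      using norm_triangle_ineq4[of "kap w" "w / 6"] by (simp add: norm_divide r_def)
    also have "\<dots> \<le> 20 * r\<^sup>2"
    proof -
      have "1 * r \<le> r * r" using False by (intro mult_right_mono) auto
      thus ?thesis using False unfolding power2_eq_square by linarith
    qed
    finally show ?thesis by (simp add: r_def)
  qed
qed

subsection \<open>The logarithm of the partition generating function\<close>

abbreviation inverse_square :: "real \<Rightarrow> nat \<Rightarrow> real" where
  "inverse_square x k \<equiv> 1 / (1 + real (Suc k) * x)\<^sup>2"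

text \<open>Each term lies below 1/((1 + k x)(1 + (k+1) x)), which is a difference of consecutive
  values of 1/(x (1 + k x)); the sum telescopes.\<close>

lemma sums_inverse_square_shift:
  fixes x :: real
  assumes "x > 0"
  shows "summable (\<lambda>k. inverse_square x k)" "(\<Sum>k. inverse_square x k) \<le> 1 / x"
proof -
  define f where "f k = 1 / x * (1 / (1 + real k * x))" for k
  have "f \<longlonglongrightarrow> 0" unfolding f_def using assms by real_asymp
  hence sums: "(\<lambda>k. f k - f (Suc k)) sums (f 0 - 0)" by (rule telescope_sums')
  have le: "inverse_square x k \<le> f k - f (Suc k)" for k
  proof -
    have "inverse_square x k \<le> 1 / ((1 + real k * x) * (1 + real (Suc k) * x))"
      unfolding power2_eq_square using assms by (intro divide_left_mono mult_right_mono) (auto intro!: add_pos_nonneg mult_pos_pos)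
    also have "\<dots> = f k - f (Suc k)"
    proof -
      have "1 + real k * x > 0" "1 + real (Suc k) * x > 0" using assms by (auto intro!: add_pos_nonneg)
      thus ?thesis using assms unfolding f_def by (simp add: divide_simps) (simp add: algebra_simps)
    qed
    finally show ?thesis .
  qed
  show "summable (\<lambda>k. inverse_square x k)"
    by (rule summable_comparison_test'[OF sums_summable[OF sums]]) (use le in auto)
  from suminf_le[OF le this sums_summable[OF sums]]
  show "(\<Sum>k. inverse_square x k) \<le> 1 / x"
    using sums by (simp add: sums_iff f_def)
qed

text \<open>log P without its leading singular part. On the positive axis it is ln(x/2 pi)/2 + O(x),
  see \<open>lerr_real_asymp\<close>.\<close>

definition lerr :: "complex \<Rightarrow> complex" where
  "lerr z = lambert z - of_real (pi\<^sup>2) / (6 * z)"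

lemma
  shows Re_lerr_real: "Re (lerr (of_real x)) = Re (lambert (of_real x)) - pi\<^sup>2 / (6 * x)"
    and Im_lerr_lambert_real: "Im (lerr (of_real x)) = Im (lambert (of_real x))"
proof -
  have "of_real (pi\<^sup>2) / (6 * of_real x) = (of_real (pi\<^sup>2 / (6 * x)) :: complex)" by simp
  thus "Re (lerr (of_real x)) = Re (lambert (of_real x)) - pi\<^sup>2 / (6 * x)"
    and "Im (lerr (of_real x)) = Im (lambert (of_real x))"
    unfolding lerr_def by (simp_all only: minus_complex.simps Re_complex_of_real Im_complex_of_real)
qed

text \<open>Write e^(-w)/(1 - e^(-w)) = (cth w - 1)/2 with w = k z. Subtracting the series for
  zeta(2) term by term removes the pole 2/w and leaves \<open>kap\<close>.\<close>

lemma lerr_sums: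
  assumes "Re z > 0"
  shows "(\<lambda>k. (kap (of_nat (Suc k) * z) - 1) / (2 * of_nat (Suc k))) sums lerr z"
proof -
  have "(\<lambda>k. of_real (1 / (real k + 1)\<^sup>2) / z) sums (of_real (pi\<^sup>2 / 6) / z)"
    using inverse_squares_sums by (intro sums_divide sums_of_real) (simp add: add.commute)
  from sums_diff[OF lambert_sums[OF assms] this]
  have "(\<lambda>k. lambert_term k z - of_real (1 / (real k + 1)\<^sup>2) / z)
      sums lerr z"
    by (simp add: lerr_def divide_divide_eq_left mult.commute)
  moreover have "lambert_term k z - of_real (1 / (real k + 1)\<^sup>2) / z =
     (kap (of_nat (Suc k) * z) - 1) / (2 * of_nat (Suc k))" for k
  proof -
    define n where "n = (of_nat (Suc k) :: complex)"
    have n: "n \<noteq> 0" unfolding n_def by (rule of_nat_neq_0)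
    have z: "z \<noteq> 0" using assms by auto
    have e: "1 - exp (- (n * z)) \<noteq> 0"
      by (rule one_minus_exp_neq_0) (use assms in \<open>simp add: n_def del: of_nat_Suc\<close>)
    have "(of_real (1 / (real k + 1)\<^sup>2) :: complex) = 1 / n\<^sup>2" by (simp add: n_def add.commute)
    moreover have "exp (- (n * z)) / (1 - exp (- (n * z))) / n - 1 / n\<^sup>2 / z = (kap (n * z) - 1) / (2 * n)"
    proof -
      define v where "v = exp (- (n * z))"
      show ?thesis using n z e unfolding kap_def cth_def v_def[symmetric]
        by (simp add: divide_simps power2_eq_square) (simp add: algebra_simps)
    qed
    ultimately show ?thesis by (simp only: n_def)
  qed
  ultimately show ?thesis by (simp only:)
qed

text \<open>Mean value bound on the vertical segment from w to the real axis: it stays inside the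
  cone, and the derivative bound can be taken to depend on Re w alone.\<close>

lemma norm_kap_diff_le:
  assumes "Re w > 0" "\<bar>Im w\<bar> \<le> Re w"
  shows "norm (kap w - kap (of_real (Re w))) \<le> 40 / (1 + Re w)\<^sup>2 * \<bar>Im w\<bar>"
proof -
  let ?S = "closed_segment (of_real (Re w)) w"
  have S: "Re v = Re w \<and> \<bar>Im v\<bar> \<le> Re v" if "v \<in> ?S" for v
  proof -
    from that obtain t where t: "0 \<le> t" "t \<le> 1" "v = (1 - t) *\<^sub>R of_real (Re w) + t *\<^sub>R w"
      by (auto simp: in_segment)
    have "Re v = Re w" "Im v = t * Im w" unfolding t(3) by (simp_all add: algebra_simps)
    moreover have "\<bar>t * Im w\<bar> \<le> 1 * \<bar>Im w\<bar>" unfolding abs_mult using t by (intro mult_right_mono) auto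
    ultimately show ?thesis using assms by auto
  qed
  have "norm (kap w - kap (of_real (Re w))) \<le> 40 / (1 + Re w)\<^sup>2 * norm (w - of_real (Re w))"
  proof (rule field_differentiable_bound[where S = ?S and f' = "\<lambda>w. 2 / w\<^sup>2 - 2 / (dexp w)\<^sup>2"])
    fix v assume v: "v \<in> ?S"
    hence v': "Re v > 0" "\<bar>Im v\<bar> \<le> Re v" "Re v = Re w" using S[OF v] assms by auto
    show "(kap has_field_derivative 2 / v\<^sup>2 - 2 / (dexp v)\<^sup>2) (at v within ?S)"
      using kap_has_field_derivative[OF v'(1)] by (rule has_field_derivative_at_within)
    have "norm (2 / v\<^sup>2 - 2 / (dexp v)\<^sup>2) \<le> 40 / (1 + norm v)\<^sup>2"
      using v' by (intro norm_kap_deriv_le)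
    also have "\<dots> \<le> 40 / (1 + Re w)\<^sup>2"
      using v' complex_Re_le_cmod[of v] by (intro divide_left_mono power_mono) (auto intro!: mult_pos_pos)
    finally show "norm (2 / v\<^sup>2 - 2 / (dexp v)\<^sup>2) \<le> 40 / (1 + Re w)\<^sup>2" .
  qed auto
  also have "w - of_real (Re w) = \<i> * of_real (Im w)" by (simp add: complex_eq_iff)
  finally show ?thesis by (simp add: norm_mult)
qed

text \<open>In the k-th term the factor k from the displacement k y cancels the denominator 2 k,
  which leaves 20 |y| / (1 + k x)^2; summation costs 1/x. This transports the asymptotics of log P
  from the real axis into the cone.\<close>

lemma norm_lerr_diff_le:
  assumes "Re z > 0" "\<bar>Im z\<bar> \<le> Re z"
  shows "norm (lerr z - lerr (of_real (Re z))) \<le> 20 * \<bar>Im z\<bar> / Re z"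
proof -
  define x where "x = Re z"
  have x: "x > 0" using assms by (simp add: x_def)
  define f where "f k = (kap (of_nat (Suc k) * z) - 1) / (2 * of_nat (Suc k)) -
      (kap (of_nat (Suc k) * of_real x) - 1) / (2 * of_nat (Suc k))" for k
  have sums: "f sums (lerr z - lerr (of_real x))"
    unfolding f_def using x assms by (intro sums_diff lerr_sums) auto
  have le: "norm (f k) \<le> 20 * \<bar>Im z\<bar> * inverse_square x k" for k
  proof -
    define n where "n = real (Suc k)"
    have n: "n > 0" by (simp add: n_def)
    have "f k = (kap (of_real n * z) - kap (of_real (n * x))) / of_real (2 * n)"
      by (simp add: f_def n_def diff_divide_distrib del: of_nat_Suc)
    hence "norm (f k) = norm (kap (of_real n * z) - kap (of_real (n * x))) / (2 * n)"
      using n by (simp add: norm_divide norm_mult)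
    also have "norm (kap (of_real n * z) - kap (of_real (n * x))) \<le> 40 / (1 + n * x)\<^sup>2 * \<bar>n * Im z\<bar>"
      using norm_kap_diff_le[of "of_real n * z"] assms n by (simp add: x_def abs_mult)
    finally have "norm (f k) \<le> 40 / (1 + n * x)\<^sup>2 * \<bar>n * Im z\<bar> / (2 * n)"
      using n by (simp add: divide_right_mono)
    also have "\<dots> = 20 * \<bar>Im z\<bar> * (1 / (1 + n * x)\<^sup>2)" using n by (simp add: abs_mult)
    finally show ?thesis by (simp only: n_def)
  qed
  have sm: "summable (\<lambda>k. 20 * \<bar>Im z\<bar> * inverse_square x k)"
    by (intro summable_mult sums_inverse_square_shift x)
  have "norm (suminf f) \<le> (\<Sum>k. 20 * \<bar>Im z\<bar> * inverse_square x k)"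
    by (rule norm_suminf_le[OF le sm])
  also have "\<dots> = 20 * \<bar>Im z\<bar> * (\<Sum>k. inverse_square x k)"
    by (intro suminf_mult sums_inverse_square_shift x)
  also have "\<dots> \<le> 20 * \<bar>Im z\<bar> * (1 / x)"
    by (intro mult_left_mono sums_inverse_square_shift x) auto
  finally show ?thesis using sums by (simp add: sums_iff x_def)
qed

text \<open>The quantity is 2 a with 0 \<le> a \<le> min(1, 1/u). The weaker power u^(-1/2) is taken
  because, at u = k x and after division by k, it is summable over k and still explicit in
  x.\<close>

lemma lerr_real_terms_le:
  fixes u :: real
  assumes "u > 0"
  shows "norm (kap (of_real u) - 1) \<le> 2 * u powr (-1/2)"
proof -
  define a where "a = 1 / u - exp (-u) / (1 - exp (-u))"
  have e: "0 < exp (-u)" "exp (-u) < 1" using assms by auto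
  have u1: "1 - u \<le> exp (-u)" "1 + u \<le> exp u" using exp_ge_add_one_self[of "-u"] exp_ge_add_one_self[of u] by auto
  have ee: "exp u * exp (-u) = 1" by (simp flip: exp_add)
  have "kap (of_real u) - 1 = of_real (- 2 * a)"
  proof -
    define v where "v = exp (-u)"
    have "(1 - of_real v :: complex) \<noteq> 0" using e unfolding v_def[symmetric] by (metis eq_iff_diff_eq_0 less_irrefl of_real_eq_1_iff)
    thus ?thesis using assms e unfolding a_def kap_def cth_def
      unfolding of_real_minus[symmetric] exp_of_real v_def[symmetric]
      by (simp add: divide_simps) (simp add: algebra_simps)
  qed
  hence eq: "norm (kap (of_real u) - 1) = 2 * \<bar>a\<bar>" by (simp add: abs_mult del: of_real_mult of_real_minus)
  have "0 \<le> a"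
  proof -
    have "exp (-u) * (1 + u) \<le> exp (-u) * exp u" using u1 e by (intro mult_left_mono) auto
    hence "exp (-u) * u \<le> 1 - exp (-u)" using ee by (simp add: algebra_simps)
    thus ?thesis using e assms by (simp add: a_def divide_simps mult.commute)
  qed
  have "a \<le> 1 / u" using e by (simp add: a_def)
  have "a \<le> 1"
  proof -
    have "1 - u \<le> exp (-u)" by (rule u1)
    thus ?thesis using e assms by (simp add: a_def divide_simps) (simp add: algebra_simps)
  qed
  have "a \<le> u powr (-1/2)"
  proof (cases "u \<le> 1")
    case True
    hence "1 powr (-1/2) \<le> u powr (-1/2)" using assms by (intro powr_mono2') auto
    thus ?thesis using \<open>a \<le> 1\<close> by simp
  next
    case False
    hence "u powr (-1) \<le> u powr (-1/2)" by (intro powr_mono) auto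
    thus ?thesis using \<open>a \<le> 1 / u\<close> assms by (simp add: powr_minus_divide)
  qed
  thus ?thesis using eq \<open>0 \<le> a\<close> by simp
qed

text \<open>A preliminary bound, used to see that x times the error tends to 0, which fixes the
  limit in \<open>x_tfun_limit\<close>.\<close>

lemma norm_lerr_real_le:
  "\<exists>C. \<forall>x>0. norm (lerr (of_real x)) \<le> C * x powr (-1/2)"
proof -
  define b where "b k = real (Suc k) powr (-3/2)" for k
  have sb: "summable b"
    unfolding b_def by (subst summable_Suc_iff[where f = "\<lambda>k. real k powr (-3/2)"]) (simp add: summable_real_powr_iff)
  have "norm (lerr (of_real x)) \<le> suminf b * x powr (-1/2)" if x: "x > 0" for x
  proof -
    have le: "norm ((kap (of_nat (Suc k) * of_real x) - 1) / (2 * of_nat (Suc k))) \<le> x powr (-1/2) * b k" for k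
    proof -
      define n where "n = real (Suc k)"
      have n: "n > 0" by (simp add: n_def)
      have "norm ((kap (of_nat (Suc k) * of_real x) - 1) / (2 * of_nat (Suc k))) = norm (kap (of_real (n * x)) - 1) / (2 * n)"
        by (simp add: n_def norm_divide norm_mult del: of_nat_Suc)
      also have "\<dots> \<le> 2 * (n * x) powr (-1/2) / (2 * n)"
        using n x by (intro divide_right_mono lerr_real_terms_le) auto
      also have "\<dots> = x powr (-1/2) * (n powr (-1/2) * n powr (-1))"
        using n x by (simp add: powr_mult powr_minus_divide)
      also have "n powr (-1/2) * n powr (-1) = b k"
        unfolding b_def n_def powr_add [symmetric] by simp
      finally show ?thesis .
    qed
    have "norm (lerr (of_real x)) = norm (\<Sum>k. (kap (of_nat (Suc k) * of_real x) - 1) / (2 * of_nat (Suc k)))"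
      using lerr_sums[of "of_real x"] x by (simp add: sums_iff)
    also have "\<dots> \<le> (\<Sum>k. x powr (-1/2) * b k)"
      by (rule norm_suminf_le[OF le summable_mult[OF sb]])
    also have "\<dots> = x powr (-1/2) * suminf b" by (rule suminf_mult[OF sb])
    finally show ?thesis by (simp add: mult.commute)
  qed
  thus ?thesis by blast
qed

text \<open>\<open>gfun u\<close> is \<open>- ln (1 - e^(-u)) - ln (1 + u^(-2)) / 2\<close>: the second logarithm removes the singularity at 0, and
  its sum over the multiples of \<open>x\<close> is known exactly from the product formula for \<open>sinh\<close>, which
  yields the constant \<open>- ln (2\<pi>) / 2\<close>.\<close>

definition gfun :: "real \<Rightarrow> real" where
  "gfun u = - ln (1 - exp (-u)) - ln (u\<^sup>2 + 1) / 2 + ln u"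

definition gfun' :: "real \<Rightarrow> real" where
  "gfun' u = - (exp (-u) / (1 - exp (-u))) - u / (u\<^sup>2 + 1) + 1 / u"

definition gfun'' :: "real \<Rightarrow> real" where
  "gfun'' u = exp (-u) / (1 - exp (-u))\<^sup>2 - (1 - u\<^sup>2) / (u\<^sup>2 + 1)\<^sup>2 - 1 / u\<^sup>2"

lemma gfun_deriv:
  assumes "u > 0"
  shows "(gfun has_field_derivative gfun' u) (at u)"
proof -
  have "1 - exp (-u) > 0" "u\<^sup>2 + 1 > 0" using assms by (auto intro: add_nonneg_pos)
  thus ?thesis
    unfolding gfun_def [abs_def] gfun'_def using assms
    by (auto intro!: derivative_eq_intros simp: divide_simps)
qed

lemma gfun'_deriv:
  assumes "u > 0"
  shows "(gfun' has_field_derivative gfun'' u) (at u)"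
proof -
  have nz: "1 - exp (-u) \<noteq> 0" "u\<^sup>2 + 1 \<noteq> 0" using assms by (auto simp: add_nonneg_eq_0_iff)
  have 1: "((\<lambda>u. exp (-u) / (1 - exp (-u))) has_field_derivative - (exp (-u) / (1 - exp (-u))\<^sup>2)) (at u)"
  proof -
    have "((\<lambda>u. exp (-u) / (1 - exp (-u))) has_field_derivative
        ((- exp (-u)) * (1 - exp (-u)) - exp (-u) * exp (-u)) / ((1 - exp (-u)) * (1 - exp (-u)))) (at u)"
      by (rule DERIV_divide) (use nz in \<open>auto intro!: derivative_eq_intros\<close>)
    also have "(- exp (-u)) * (1 - exp (-u)) - exp (-u) * exp (-u) = - exp (-u)"
      by (simp add: right_diff_distrib)
    finally show ?thesis by (simp add: power2_eq_square)
  qed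
  have 2: "((\<lambda>u. u / (u\<^sup>2 + 1)) has_field_derivative (1 - u\<^sup>2) / (u\<^sup>2 + 1)\<^sup>2) (at u)"
    using nz by (auto intro!: derivative_eq_intros simp: power2_eq_square)
  have 3: "((\<lambda>u. 1 / u) has_field_derivative - (1 / u\<^sup>2)) (at u)"
    using assms by (auto intro!: derivative_eq_intros simp: power2_eq_square)
  show ?thesis
    unfolding gfun''_def gfun'_def [abs_def]
    using DERIV_add[OF DERIV_diff[OF DERIV_minus[OF 1] 2] 3] by simp
qed

text \<open>The exponential term together with -1/u^2 is -1/2 times the derivative of
  \<open>kap\<close> at a real point, hence at most 20/(1 + u)^2; the rational term adds 2/(1 +
  u)^2.\<close>

lemma gfun''_bound:
  assumes "u > 0"
  shows "\<bar>gfun'' u\<bar> \<le> 22 / (1 + u)\<^sup>2"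
proof -
  define E where "E = exp (-u) / (1 - exp (-u))\<^sup>2"
  have "exp (- of_real u) / (1 - exp (- of_real u))\<^sup>2 = 1 / (dexp (of_real u))\<^sup>2"
    unfolding dexp_sq' [symmetric] by simp
  hence "of_real E = 1 / (dexp (of_real u))\<^sup>2"
    by (simp add: E_def exp_of_real [symmetric])
  hence "2 / (dexp (of_real u))\<^sup>2 = 2 * of_real E" by simp
  hence "2 / (of_real u)\<^sup>2 - 2 / (dexp (of_real u))\<^sup>2 = of_real (2 * (1 / u\<^sup>2 - E))"
    by (simp add: right_diff_distrib)
  hence "norm (2 / (of_real u)\<^sup>2 - 2 / (dexp (of_real u))\<^sup>2) = norm (of_real (2 * (1 / u\<^sup>2 - exp (-u) / (1 - exp (-u))\<^sup>2)) :: complex)"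
    by (simp only: E_def)
  also have "\<dots> = 2 * \<bar>1 / u\<^sup>2 - exp (-u) / (1 - exp (-u))\<^sup>2\<bar>"
    by (simp only: norm_of_real abs_mult abs_numeral)
  finally have 1: "\<bar>1 / u\<^sup>2 - exp (-u) / (1 - exp (-u))\<^sup>2\<bar> \<le> 20 / (1 + u)\<^sup>2"
    using norm_kap_deriv_le[of "of_real u"] assms by simp
  have pos: "u\<^sup>2 + 1 > 0" using add_pos_pos[of "u\<^sup>2" 1] assms by simp
  have "\<bar>(1 - u\<^sup>2) / (u\<^sup>2 + 1)\<^sup>2\<bar> \<le> (u\<^sup>2 + 1) / (u\<^sup>2 + 1)\<^sup>2"
    unfolding abs_divide using pos by (intro frac_le) (auto simp: abs_if)
  also have "\<dots> = 1 / (u\<^sup>2 + 1)" using pos by (simp add: power2_eq_square)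
  also have "\<dots> \<le> 2 / (1 + u)\<^sup>2"
  proof -
    have "(1 + u)\<^sup>2 + (1 - u)\<^sup>2 = 2 * (u\<^sup>2 + 1)" by (simp add: power2_eq_square algebra_simps)
    moreover have "(1 - u)\<^sup>2 \<ge> 0" by simp
    ultimately have "(1 + u)\<^sup>2 \<le> 2 * (u\<^sup>2 + 1)" by linarith
    moreover have "(1 + u)\<^sup>2 > 0" "u\<^sup>2 + 1 > 0" using assms by (auto intro: add_nonneg_pos)
    ultimately show ?thesis by (simp add: divide_simps)
  qed
  finally have 2: "\<bar>(1 - u\<^sup>2) / (u\<^sup>2 + 1)\<^sup>2\<bar> \<le> 2 / (1 + u)\<^sup>2" .
  have "22 / (1 + u)\<^sup>2 = 20 / (1 + u)\<^sup>2 + 2 / (1 + u)\<^sup>2" by (simp add: add_divide_distrib [symmetric])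
  thus ?thesis using 1 2 unfolding gfun''_def by linarith
qed

text \<open>Expansion about the midpoint a + h: the linear terms of the two ends cancel, and each
  end costs 22 h^2 / (1 + a)^2.\<close>

lemma gfun_second_difference:
  assumes "a > 0" "h > 0"
  shows "\<bar>2 * gfun (a + h) - gfun a - gfun (a + 2 * h)\<bar> \<le> 44 / (1 + a)\<^sup>2 * h\<^sup>2"
proof -
  define D where "D i = (if i = 0 then gfun else if i = 1 then gfun' else gfun'')" for i :: nat
  have T: "norm (D 0 z - (\<Sum>i\<le>1. D i (a + h) * (z - (a + h)) ^ i / fact i)) \<le> 22 / (1 + a)\<^sup>2 * norm (z - (a + h)) ^ Suc 1 / fact 1"
    if "z \<in> {a..a+2*h}" for z
  proof (rule field_Taylor[where S = "{a..a+2*h}"])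
    fix i :: nat and x :: real assume x: "x \<in> {a..a+2*h}" and i: "i \<le> 1"
    have "x > 0" using x assms by auto
    hence "(D i has_field_derivative D (Suc i) x) (at x)"
      using i by (cases i) (auto simp: D_def intro: gfun_deriv gfun'_deriv)
    thus "(D i has_field_derivative D (Suc i) x) (at x within {a..a+2*h})" by (rule has_field_derivative_at_within)
  next
    fix x assume x: "x \<in> {a..a+2*h}"
    have "norm (D (Suc 1) x) \<le> 22 / (1 + x)\<^sup>2" using x assms gfun''_bound[of x] by (simp add: D_def)
    also have "\<dots> \<le> 22 / (1 + a)\<^sup>2" using x assms by (intro divide_left_mono power_mono) auto
    finally show "norm (D (Suc 1) x) \<le> 22 / (1 + a)\<^sup>2" .
  qed (use that assms in auto)
  have "\<bar>gfun a - (gfun (a + h) - gfun' (a + h) * h)\<bar> \<le> 22 / (1 + a)\<^sup>2 * h\<^sup>2"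
    using T[of a] assms by (simp add: D_def power2_eq_square)
  moreover have "\<bar>gfun (a + 2 * h) - (gfun (a + h) + gfun' (a + h) * h)\<bar> \<le> 22 / (1 + a)\<^sup>2 * h\<^sup>2"
    using T[of "a + 2 * h"] assms by (simp add: D_def power2_eq_square)
  ultimately show ?thesis by (simp add: abs_if split: if_splits)
qed

text \<open>The logarithm of (x/pi) sinh(pi/x).\<close>

definition lnsinh :: "real \<Rightarrow> real" where
  "lnsinh x = ln (x / (2 * pi) * (exp (pi / x) - exp (- pi / x)))"

text \<open>Euler's product for the sine at the imaginary point i/x, followed by logarithms of the
  partial products.\<close>

lemma sums_lnsinh:
  assumes "x > 0"
  shows "(\<lambda>k. ln (1 + 1 / (real (Suc k) * x)\<^sup>2)) sums lnsinh x"
proof -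
  define P where "P n = (\<Prod>k=1..n. 1 + 1 / (real k * x)\<^sup>2)" for n
  define S where "S = x / (2 * pi) * (exp (pi / x) - exp (- pi / x))"
  define z where "z = \<i> / of_real x"
  have z2: "z\<^sup>2 = - of_real (1 / x\<^sup>2)" by (simp add: z_def power_divide)
  have "(\<lambda>n. of_real pi * z * (\<Prod>k=1..n. 1 - z\<^sup>2 / (of_nat k)\<^sup>2)) \<longlonglongrightarrow> sin (of_real pi * z)"
    by (rule sin_product_formula_complex)
  also have "(\<lambda>n. of_real pi * z * (\<Prod>k=1..n. 1 - z\<^sup>2 / (of_nat k)\<^sup>2)) = (\<lambda>n. \<i> * of_real (pi / x * P n))"
    unfolding z2 P_def by (simp add: z_def power_mult_distrib mult_ac)
  also have "sin (of_real pi * z) = \<i> * of_real ((exp (pi / x) - exp (- pi / x)) / 2)"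
  proof -
    have "sin (of_real pi * z) = - \<i> * (exp (\<i> * (of_real pi * z)) - exp (- (\<i> * (of_real pi * z)))) / 2"
      by (simp add: sin_exp_eq divide_simps)
    also have "\<i> * (of_real pi * z) = of_real (- pi / x)" by (simp add: z_def complex_eq_iff)
    finally show ?thesis by (simp add: exp_of_real [symmetric] right_diff_distrib)
  qed
  finally have "(\<lambda>n. Im (\<i> * of_real (pi / x * P n))) \<longlonglongrightarrow> Im (\<i> * of_real ((exp (pi / x) - exp (- pi / x)) / 2))"
    by (rule tendsto_Im)
  hence "(\<lambda>n. x / pi * (pi / x * P n)) \<longlonglongrightarrow> x / pi * ((exp (pi / x) - exp (- pi / x)) / 2)"
    by (intro tendsto_mult tendsto_const) simp
  hence "P \<longlonglongrightarrow> S" using assms by (simp add: S_def mult.commute)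
  moreover have "S > 0" using assms unfolding S_def by (intro mult_pos_pos) auto
  ultimately have "(\<lambda>n. ln (P n)) \<longlonglongrightarrow> ln S" by (intro tendsto_ln) auto
  moreover have "ln (P n) = (\<Sum>k<n. ln (1 + 1 / (real (Suc k) * x)\<^sup>2))" for n
  proof -
    have "ln (P n) = (\<Sum>k=1..n. ln (1 + 1 / (real k * x)\<^sup>2))"
    proof -
      have "0 < 1 + 1 / (real k * x)\<^sup>2" for k by (intro add_pos_nonneg) auto
      hence "1 + 1 / (real k * x)\<^sup>2 \<noteq> 0" for k by (metis less_irrefl)
      thus ?thesis unfolding P_def by (subst ln_prod) auto
    qed
    also have "\<dots> = (\<Sum>k<n. ln (1 + 1 / (real (Suc k) * x)\<^sup>2))"
      by (rule sum.reindex_bij_witness[where i = Suc and j = "\<lambda>k. k - 1"]) auto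
    finally show ?thesis .
  qed
  ultimately show ?thesis by (simp add: sums_def lnsinh_def S_def)
qed

definition tfun :: "real \<Rightarrow> real" where
  "tfun x = Re (lambert (of_real x)) - lnsinh x / 2"

lemma tfun_sums:
  assumes "x > 0"
  shows "(\<lambda>k. gfun (real (Suc k) * x)) sums tfun x"
proof -
  have "gfun u = - ln (1 - exp (-u)) - ln (1 + 1 / u\<^sup>2) / 2" if "u > 0" for u
  proof -
    have "1 + 1 / u\<^sup>2 = (u\<^sup>2 + 1) / u\<^sup>2" using that by (simp add: add_divide_distrib)
    hence "ln (1 + 1 / u\<^sup>2) = ln (u\<^sup>2 + 1) - 2 * ln u"
      using that add_pos_pos[of "u\<^sup>2" 1] by (simp add: ln_div ln_realpow)
    thus ?thesis by (simp add: gfun_def diff_divide_distrib)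
  qed
  hence "gfun (real (Suc k) * x) = - ln (1 - exp (-(real (Suc k) * x))) - ln (1 + 1 / (real (Suc k) * x)\<^sup>2) / 2" for k
    using assms by simp
  thus ?thesis unfolding tfun_def
    by (simp only:) (intro sums_diff sums_divide lambert_real_sums sums_lnsinh assms)
qed

text \<open>Pairing consecutive terms turns \<open>2 T(2x) - T(x)\<close> into a sum of second differences of \<open>gfun\<close>.
  Hence \<open>x T(x)\<close> changes only by \<open>O(x^2)\<close> when \<open>x\<close> is doubled, and its limit at 0 determines \<open>T\<close> up to \<open>O(x)\<close>.\<close>

lemma tfun_doubling:
  assumes "x > 0"
  shows "\<bar>2 * tfun (2 * x) - tfun x\<bar> \<le> 22 * x + \<bar>gfun x\<bar> / 2"
proof -
  define a where "a k = gfun (real (2 * k + 1) * x)" for k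
  define b where "b k = gfun (real (2 * k + 2) * x)" for k
  have "(\<lambda>n. sum (\<lambda>k. gfun (real (Suc k) * x)) {n * 2..<n * 2 + 2}) sums tfun x"
    using tfun_sums[OF assms] by (rule sums_group) simp
  also have "(\<lambda>n. sum (\<lambda>k. gfun (real (Suc k) * x)) {n * 2..<n * 2 + 2}) = (\<lambda>n. a n + b n)"
  proof
    fix n :: nat
    have "{n * 2..<n * 2 + 2} = {2 * n, 2 * n + 1}" by auto
    thus "sum (\<lambda>k. gfun (real (Suc k) * x)) {n * 2..<n * 2 + 2} = a n + b n"
      by (simp add: a_def b_def algebra_simps)
  qed
  finally have ab: "(\<lambda>n. a n + b n) sums tfun x" .
  have b: "b sums tfun (2 * x)"
  proof -
    have "b = (\<lambda>k. gfun (real (Suc k) * (2 * x)))"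
      unfolding b_def by (simp add: fun_eq_iff algebra_simps)
    moreover have "2 * x > 0" using assms by simp
    ultimately show ?thesis using tfun_sums[of "2 * x"] by (simp only:)
  qed
  from sums_diff[OF sums_mult[OF b, of 2] ab]
  have D: "(\<lambda>n. b n - a n) sums (2 * tfun (2 * x) - tfun x)" by simp
  have "a sums (tfun x - tfun (2 * x))" using sums_diff[OF ab b] by simp
  hence "a \<longlonglongrightarrow> 0" by (simp add: sums_iff summable_LIMSEQ_zero)
  hence tel: "(\<lambda>n. a (Suc n) - a n) sums (0 - a 0)" by (rule telescope_sums)
  \<comment> \<open>Subtracting half of the telescoping series turns b n - a n into half a second
    difference centred at the even multiple of x. The boundary term is a 0 / 2, the source of |gfun
    x| / 2 in the bound.\<close>
  define e where "e n = (2 * b n - a n - a (Suc n)) / 2" for n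
  have e_sums: "e sums (2 * tfun (2 * x) - tfun x - (0 - a 0) / 2)"
  proof -
    have "e = (\<lambda>n. b n - a n - (a (Suc n) - a n) / 2)"
      by (simp add: e_def fun_eq_iff field_simps)
    thus ?thesis using sums_diff[OF D sums_divide[OF tel, of 2]] by (simp only:)
  qed
  have le: "norm (e n) \<le> 22 * x\<^sup>2 * inverse_square x n" for n
  proof -
    define c where "c = real (2 * n + 1) * x"
    have "2 * b n - a n - a (Suc n) = 2 * gfun (c + x) - gfun c - gfun (c + 2 * x)"
      by (simp add: a_def b_def c_def algebra_simps)
    also have "\<bar>\<dots>\<bar> \<le> 44 / (1 + c)\<^sup>2 * x\<^sup>2"
      using assms by (intro gfun_second_difference) (auto simp: c_def)
    also have "\<dots> \<le> 44 / (1 + real (Suc n) * x)\<^sup>2 * x\<^sup>2"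
    proof -
      have "0 < real (Suc n) * x" using assms by simp
      moreover have "real (Suc n) * x \<le> c" unfolding c_def using assms by (intro mult_right_mono) auto
      ultimately show ?thesis by (intro mult_right_mono divide_left_mono power_mono) auto
    qed
    finally show ?thesis by (simp add: e_def)
  qed
  have sm: "summable (\<lambda>n. 22 * x\<^sup>2 * inverse_square x n)"
    by (intro summable_mult sums_inverse_square_shift assms)
  have "norm (suminf e) \<le> (\<Sum>n. 22 * x\<^sup>2 * inverse_square x n)"
    by (rule norm_suminf_le[OF le sm])
  also have "\<dots> = 22 * x\<^sup>2 * (\<Sum>n. inverse_square x n)"
    by (intro suminf_mult sums_inverse_square_shift assms)
  also have "\<dots> \<le> 22 * x\<^sup>2 * (1 / x)"
    by (intro mult_left_mono sums_inverse_square_shift assms) auto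
  also have "\<dots> = 22 * x" using assms by (simp add: power2_eq_square)
  finally have "\<bar>2 * tfun (2 * x) - tfun x - (0 - a 0) / 2\<bar> \<le> 22 * x"
    using e_sums by (simp add: sums_iff)
  moreover have "a 0 = gfun x" by (simp add: a_def)
  ultimately have "\<bar>2 * tfun (2 * x) - tfun x + gfun x / 2\<bar> \<le> 22 * x" by simp
  thus ?thesis using abs_triangle_ineq4[of "2 * tfun (2 * x) - tfun x + gfun x / 2" "gfun x / 2"] by simp
qed

text \<open>pi^2/6 comes from log P and pi/2 from half of \<open>lnsinh x\<close>, which grows like
  pi/x.\<close>

lemma x_tfun_limit: "((\<lambda>x. x * tfun x) \<longlongrightarrow> pi\<^sup>2 / 6 - pi / 2) (at_right 0)"
proof -
  obtain C where C: "\<And>x. x > 0 \<Longrightarrow> norm (lerr (of_real x)) \<le> C * x powr (-1/2)"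
    using norm_lerr_real_le by blast
  have "((\<lambda>x. x * Re (lerr (of_real x))) \<longlongrightarrow> 0) (at_right 0)"
  proof (rule Lim_null_comparison)
    show "((\<lambda>x. x * (C * x powr (-1/2))) \<longlongrightarrow> 0) (at_right 0)" by real_asymp
    have "norm (x * Re (lerr (of_real x))) \<le> x * (C * x powr (-1/2))" if "x > 0" for x
      using that C[of x] abs_Re_le_cmod[of "lerr (of_real x)"] by (auto simp: abs_mult intro!: mult_left_mono)
    thus "\<forall>\<^sub>F x in at_right 0. norm (x * Re (lerr (of_real x))) \<le> x * (C * x powr (-1/2))"
      by (intro eventually_at_right_less[THEN eventually_mono])
  qed
  moreover have "((\<lambda>x. x * (lnsinh x / 2)) \<longlongrightarrow> pi / 2) (at_right 0)"
    unfolding lnsinh_def by real_asymp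
  ultimately have "((\<lambda>x. x * Re (lerr (of_real x)) + pi\<^sup>2 / 6 - x * (lnsinh x / 2)) \<longlongrightarrow> 0 + pi\<^sup>2 / 6 - pi / 2) (at_right 0)"
    by (intro tendsto_intros)
  also have "?this \<longleftrightarrow> ?thesis"
    unfolding add_0
  proof (rule filterlim_cong[OF refl refl])
    have "x * Re (lerr (of_real x)) + pi\<^sup>2 / 6 - x * (lnsinh x / 2) = x * tfun x" if "x > 0" for x
      using that by (simp add: tfun_def Re_lerr_real field_simps)
    thus "\<forall>\<^sub>F x in at_right 0. x * Re (lerr (of_real x)) + pi\<^sup>2 / 6 - x * (lnsinh x / 2) = x * tfun x"
      by (intro eventually_at_right_less[THEN eventually_mono])
  qed
  finally show ?thesis .
qed

text \<open>Halving x repeatedly moves x T(x) by geometrically decreasing steps of total size at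
  most 23 x^2, and the sequence converges to the limit of \<open>x_tfun_limit\<close>. Division by x
  gives the claim.\<close>

lemma tfun_asymp: "\<exists>x0>0. \<forall>x. 0 < x \<and> x < x0 \<longrightarrow> \<bar>tfun x - (pi\<^sup>2 / 6 - pi / 2) / x\<bar> \<le> 23 * x"
proof -
  define l where "l = pi\<^sup>2 / 6 - pi / 2"
  \<comment> \<open>\<open>gfun x\<close> behaves like x/2 at 0. The bound 2 x turns 22 x + |gfun x|
    / 2 into 23 x.\<close>
  have "eventually (\<lambda>x. \<bar>gfun x\<bar> \<le> 2 * x) (at_right 0)"
    unfolding gfun_def by real_asymp
  then obtain x0 where x0: "x0 > 0" "\<And>x. 0 < x \<Longrightarrow> x < x0 \<Longrightarrow> \<bar>gfun x\<bar> \<le> 2 * x"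
    by (auto simp: eventually_at_right_field)
  have "\<bar>tfun x - l / x\<bar> \<le> 23 * x" if x: "0 < x" "x < x0" for x
  proof -
    define R where "R n = (x / 2 ^ n) * tfun (x / 2 ^ n)" for n
    have step: "\<bar>R n - R (Suc n)\<bar> \<le> 23 * x\<^sup>2 / 2 ^ Suc n" for n
    proof -
      define y where "y = x / 2 ^ Suc n"
      have "x / 2 ^ Suc n \<le> x / 1"
        using x one_le_power[of "2::real" "Suc n"] by (intro divide_left_mono) (auto simp del: power_Suc)
      hence y: "0 < y" "y \<le> x" using x by (auto simp: y_def)
      have "x / 2 ^ n = 2 * y" by (simp add: y_def)
      hence "R n = 2 * y * tfun (2 * y)" by (simp only: R_def)
      moreover have "R (Suc n) = y * tfun y" by (simp only: R_def y_def)
      ultimately have "R n - R (Suc n) = y * (2 * tfun (2 * y) - tfun y)"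
        by (simp add: algebra_simps)
      hence "\<bar>R n - R (Suc n)\<bar> = y * \<bar>2 * tfun (2 * y) - tfun y\<bar>" using y by (simp add: abs_mult)
      also have "\<dots> \<le> y * (23 * y)"
        using tfun_doubling[OF y(1)] x0(2)[of y] x y by (intro mult_left_mono) auto
      also have "\<dots> \<le> y * (23 * x)" using y by (intro mult_left_mono) auto
      also have "\<dots> = 23 * x\<^sup>2 / 2 ^ Suc n" by (simp add: y_def power2_eq_square)
      finally show ?thesis .
    qed
    have bound: "\<bar>R 0 - R n\<bar> \<le> 23 * x\<^sup>2 * (1 - 1 / 2 ^ n)" for n
    proof (induction n)
      case (Suc n)
      have "\<bar>R 0 - R (Suc n)\<bar> \<le> 23 * x\<^sup>2 * (1 - 1 / 2 ^ n) + 23 * x\<^sup>2 / 2 ^ Suc n"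
        using Suc step[of n] by linarith
      also have "\<dots> = 23 * x\<^sup>2 * (1 - 1 / 2 ^ Suc n)" by (simp add: field_simps)
      finally show ?case .
    qed simp
    have "\<bar>R 0 - R n\<bar> \<le> 23 * x\<^sup>2" for n
      by (rule order_trans[OF bound]) (auto intro!: mult_left_le)
    moreover have "(\<lambda>n. \<bar>R 0 - R n\<bar>) \<longlonglongrightarrow> \<bar>R 0 - l\<bar>"
    proof -
      have "filterlim (\<lambda>n. x / 2 ^ n) (at_right 0) sequentially"
        using x by real_asymp
      from filterlim_compose[OF x_tfun_limit this] have "R \<longlonglongrightarrow> l"
        unfolding R_def l_def .
      thus ?thesis by (intro tendsto_intros)
    qed
    ultimately have "\<bar>R 0 - l\<bar> \<le> 23 * x\<^sup>2" by (intro LIMSEQ_le_const2) auto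
    moreover have "R 0 - l = x * (tfun x - l / x)" using x by (simp add: R_def field_simps)
    ultimately have "x * \<bar>tfun x - l / x\<bar> \<le> x * (23 * x)"
      using x by (simp add: abs_mult power2_eq_square)
    thus ?thesis using x by simp
  qed
  thus ?thesis using x0(1) unfolding l_def by blast
qed

text \<open>Up to an exponentially small term, half of \<open>lnsinh x\<close> is pi/(2 x) + ln(x/2
  pi)/2. Adding it back to \<open>tfun x\<close> cancels the pi/2 in the coefficient of 1/x and
  leaves the logarithm, that is, the factor (x/2 pi)^(1/2) of P.\<close>

lemma lerr_real_asymp:
  "\<exists>x0>0. \<forall>x. 0 < x \<and> x < x0 \<longrightarrow> \<bar>Re (lerr (of_real x)) - ln (x / (2 * pi)) / 2\<bar> \<le> 24 * x"
proof -
  obtain x0 where x0: "x0 > 0" "\<And>x. 0 < x \<Longrightarrow> x < x0 \<Longrightarrow> \<bar>tfun x - (pi\<^sup>2 / 6 - pi / 2) / x\<bar> \<le> 23 * x"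
    using tfun_asymp by blast
  have eq: "lnsinh x / 2 - pi / (2 * x) - ln (x / (2 * pi)) / 2 = ln (1 - exp (- 2 * pi / x)) / 2" if "x > 0" for x
  proof -
    have "exp (- pi / x) = exp (pi / x) * exp (- 2 * pi / x)"
      using that by (simp add: exp_add [symmetric] diff_divide_distrib [symmetric])
    hence "x / (2 * pi) * (exp (pi / x) - exp (- pi / x)) = x / (2 * pi) * exp (pi / x) * (1 - exp (- 2 * pi / x))"
      by (simp only: right_diff_distrib mult.assoc mult_1_right)
    moreover have "exp (- 2 * pi / x) < 1" using that by simp
    ultimately have "lnsinh x = ln (x / (2 * pi) * exp (pi / x)) + ln (1 - exp (- 2 * pi / x))"
      unfolding lnsinh_def using that by (simp only:) (intro ln_mult_pos; simp)
    also have "ln (x / (2 * pi) * exp (pi / x)) = ln (x / (2 * pi)) + pi / x"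
      using that by (subst ln_mult_pos) simp_all
    finally have "lnsinh x = ln (x / (2 * pi)) + pi / x + ln (1 - exp (- 2 * pi / x))" .
    thus ?thesis by (simp add: add_divide_distrib)
  qed
  have "eventually (\<lambda>x. \<bar>ln (1 - exp (- 2 * pi / x)) / 2\<bar> \<le> x) (at_right (0::real))"
    by real_asymp
  hence "eventually (\<lambda>x. \<bar>lnsinh x / 2 - pi / (2 * x) - ln (x / (2 * pi)) / 2\<bar> \<le> x) (at_right 0)"
    using eventually_at_right_less[of 0] by eventually_elim (simp add: eq)
  then obtain x1 where x1: "x1 > 0" "\<And>x. 0 < x \<Longrightarrow> x < x1 \<Longrightarrow> \<bar>lnsinh x / 2 - pi / (2 * x) - ln (x / (2 * pi)) / 2\<bar> \<le> x"
    by (auto simp: eventually_at_right_field)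
  have "\<bar>Re (lerr (of_real x)) - ln (x / (2 * pi)) / 2\<bar> \<le> 24 * x" if "0 < x" "x < min x0 x1" for x
  proof -
    have "Re (lerr (of_real x)) - ln (x / (2 * pi)) / 2 =
        (tfun x - (pi\<^sup>2 / 6 - pi / 2) / x) + (lnsinh x / 2 - pi / (2 * x) - ln (x / (2 * pi)) / 2)"
      by (simp add: tfun_def Re_lerr_real diff_divide_distrib)
    thus ?thesis using x0(2)[of x] x1(2)[of x] that by linarith
  qed
  thus ?thesis using x0(1) x1(1) by (intro exI[of _ "min x0 x1"]) auto
qed

subsection \<open>The string generating function near 0\<close>

lemma power_div_fact_le_exp:
  fixes u :: real
  assumes "u \<ge> 0"
  shows "u ^ n / fact n \<le> exp u"
proof -
  have "(\<Sum>k\<in>{n}. u ^ k /\<^sub>R fact k) \<le> (\<Sum>k. u ^ k /\<^sub>R fact k)"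
    using assms by (intro sum_le_suminf summable_exp_generic) auto
  thus ?thesis by (simp add: exp_def divide_inverse mult.commute)
qed

lemma power_times_exp_neg_sq_le:
  fixes t :: real
  assumes "t \<ge> 0" "k \<le> 8"
  shows "t ^ k * exp (- (t\<^sup>2)) \<le> 24"
proof -
  have "t ^ k \<le> 24 * exp (t\<^sup>2)"
  proof (cases "t \<le> 1")
    case True
    hence "t ^ k \<le> 1" using assms by (simp add: power_le_one)
    also have "1 \<le> 24 * exp (t\<^sup>2)" using one_le_exp_iff[of "t\<^sup>2"] zero_le_power2[of t] by linarith
    finally show ?thesis .
  next
    case False
    hence "t ^ k \<le> t ^ 8" using assms by (intro power_increasing) auto
    also have "t ^ 8 = 24 * ((t\<^sup>2) ^ 4 / fact 4)" by (simp add: fact_numeral flip: power_mult)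
    also have "\<dots> \<le> 24 * exp (t\<^sup>2)" by (intro mult_left_mono power_div_fact_le_exp) auto
    finally show ?thesis .
  qed
  thus ?thesis by (simp add: exp_minus field_simps)
qed

text \<open>\<open>wder z i\<close> is the \<open>i\<close>-th derivative of \<open>- exp (- z s^2) / (2 z)\<close>, which integrates \<open>s exp (- z s^2)\<close>.\<close>

definition wpoly :: "complex \<Rightarrow> nat \<Rightarrow> complex \<Rightarrow> complex" where
  "wpoly z i s = (if i = 0 then - 1 / (2 * z) else if i = 1 then s else if i = 2 then 1 - 2 * z * s\<^sup>2
     else if i = 3 then - 6 * z * s + 4 * z\<^sup>2 * s ^ 3
     else if i = 4 then - 6 * z + 24 * z\<^sup>2 * s\<^sup>2 - 8 * z ^ 3 * s ^ 4
     else 60 * z\<^sup>2 * s - 80 * z ^ 3 * s ^ 3 + 16 * z ^ 4 * s ^ 5)"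

definition wder :: "complex \<Rightarrow> nat \<Rightarrow> complex \<Rightarrow> complex" where
  "wder z i s = wpoly z i s * exp (- z * s\<^sup>2)"

lemma wder_deriv:
  assumes "z \<noteq> 0" "i \<le> 4"
  shows "(wder z i has_field_derivative wder z (Suc i) s) (at s within S)"
proof -
  have E: "((\<lambda>s. exp (- z * s\<^sup>2)) has_field_derivative (- 2 * z * s) * exp (- z * s\<^sup>2)) (at s within S)"
    by (auto intro!: derivative_eq_intros)
  \<comment> \<open>By the product rule the polynomial factor p is followed by p' - 2 z s p, so each
    case reduces to this polynomial identity.\<close>
  have *: ?thesis
    if "(wpoly z i has_field_derivative p') (at s within S)" "p' + wpoly z i s * (- 2 * z * s) = wpoly z (Suc i) s" for p'
    using DERIV_mult[OF that(1) E] unfolding wder_def [abs_def] that(2)[symmetric] by (simp add: algebra_simps)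
  have "i = 0 \<or> i = 1 \<or> i = 2 \<or> i = 3 \<or> i = 4" using assms by auto
  then consider "i = 0" | "i = 1" | "i = 2" | "i = 3" | "i = 4" by blast
  thus ?thesis
  proof cases
    case 1
    show ?thesis
      by (rule *[of 0]) (use assms 1 in \<open>auto simp: wpoly_def [abs_def]\<close>)
  next
    case 2
    show ?thesis
      by (rule *[of 1]) (use 2 in \<open>auto simp: wpoly_def [abs_def] power2_eq_square\<close>)
  next
    case 3
    show ?thesis
      by (rule *[of "- 4 * z * s"])
         (use 3 in \<open>auto simp: wpoly_def [abs_def] power2_eq_square power3_eq_cube algebra_simps intro!: derivative_eq_intros\<close>)
  next
    case 4
    show ?thesis
      by (rule *[of "- 6 * z + 12 * z\<^sup>2 * s\<^sup>2"])
         (use 4 in \<open>auto simp: wpoly_def [abs_def] power2_eq_square power3_eq_cube power4_eq_xxxx algebra_simps intro!: derivative_eq_intros\<close>)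
  next
    case 5
    show ?thesis
      by (rule *[of "48 * z\<^sup>2 * s - 32 * z ^ 3 * s ^ 3"])
         (use 5 in \<open>auto simp: wpoly_def [abs_def] eval_nat_numeral algebra_simps intro!: derivative_eq_intros\<close>)
  qed
qed

text \<open>With t = s (Re z)^(1/2), every monomial of the polynomial factor is at most a constant
  times ((Re z)^(1/2) / s^2) t^k with k = 3, 5 or 7, and exp(-t^2) absorbs t^k. Trading powers of s
  for 1/s^2 makes the error summable over the integers and keeps the small factor.\<close>

lemma wder5_bound:
  fixes s :: real
  assumes "Re z > 0" "\<bar>Im z\<bar> \<le> Re z" "s > 0"
  shows "norm (wder z 5 (of_real s)) \<le> 30000 * sqrt (Re z) / s\<^sup>2"
proof -
  define x where "x = Re z"
  define t where "t = s * sqrt x"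
  have x: "x > 0" using assms by (simp add: x_def)
  have z: "norm z \<le> 2 * x" using cone_norm_le[OF assms(2)] by (simp add: x_def)
  have t: "t > 0" "t\<^sup>2 = x * s\<^sup>2" using x assms by (auto simp: t_def power_mult_distrib)
  have e: "norm (exp (- z * (of_real s)\<^sup>2)) = exp (- (t\<^sup>2))"
    by (simp add: t x_def flip: of_real_power)
  have zp: "norm (z ^ k) \<le> (2 * x) ^ k" for k
    unfolding norm_power using z by (intro power_mono) auto
  have "norm (60 * z\<^sup>2 * of_real s - 80 * z ^ 3 * of_real s ^ 3 + 16 * z ^ 4 * of_real s ^ 5) \<le>
      60 * (2 * x)\<^sup>2 * s + 80 * (2 * x) ^ 3 * s ^ 3 + 16 * (2 * x) ^ 4 * s ^ 5"
  proof (intro order_trans[OF norm_triangle_ineq] order_trans[OF norm_triangle_ineq4] add_mono)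
    show "norm (60 * z\<^sup>2 * of_real s) \<le> 60 * (2 * x)\<^sup>2 * s"
      unfolding norm_mult using assms zp[of 2] by (intro mult_mono) auto
    show "norm (80 * z ^ 3 * of_real s ^ 3) \<le> 80 * (2 * x) ^ 3 * s ^ 3"
      unfolding norm_mult using assms zp[of 3] x by (intro mult_mono) (auto simp: norm_power)
    show "norm (16 * z ^ 4 * of_real s ^ 5) \<le> 16 * (2 * x) ^ 4 * s ^ 5"
      unfolding norm_mult using assms zp[of 4] x by (intro mult_mono) (auto simp: norm_power)
  qed
  hence "norm (wder z 5 (of_real s)) \<le> (60 * (2 * x)\<^sup>2 * s + 80 * (2 * x) ^ 3 * s ^ 3 + 16 * (2 * x) ^ 4 * s ^ 5) * exp (- (t\<^sup>2))"
    unfolding wder_def norm_mult e by (simp add: mult_right_mono wpoly_def)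
  also have "60 * (2 * x)\<^sup>2 * s + 80 * (2 * x) ^ 3 * s ^ 3 + 16 * (2 * x) ^ 4 * s ^ 5 =
      (sqrt x / s\<^sup>2) * (240 * t ^ 3 + 640 * t ^ 5 + 256 * t ^ 7)"
  proof -
    define r where "r = sqrt x"
    have "x = r\<^sup>2" "r > 0" using x by (auto simp: r_def)
    thus ?thesis using assms(3) unfolding t_def r_def[symmetric]
      by (simp add: field_simps eval_nat_numeral)
  qed
  also have "\<dots> * exp (- (t\<^sup>2)) = (sqrt x / s\<^sup>2) * (240 * (t ^ 3 * exp (- (t\<^sup>2))) + 640 * (t ^ 5 * exp (- (t\<^sup>2))) + 256 * (t ^ 7 * exp (- (t\<^sup>2))))"
    by (simp only: distrib_right mult.assoc)
  also have "\<dots> \<le> (sqrt x / s\<^sup>2) * (240 * 24 + 640 * 24 + 256 * 24)"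
    using t x by (intro mult_left_mono add_mono power_times_exp_neg_sq_le) auto
  also have "\<dots> \<le> (sqrt x / s\<^sup>2) * 30000" using x by (intro mult_left_mono) auto
  finally show ?thesis by (simp add: x_def mult.commute)
qed

text \<open>These terms form the z-derivative of \<open>uterm\<close>, and they also carry the part
  of \<open>kterm\<close> that comes from kap w ~ w/6.\<close>

definition vterm :: "nat \<Rightarrow> complex \<Rightarrow> complex" where
  "vterm j z = of_nat j * exp (- (of_nat (j * j) * z))"

text \<open>Midpoint rule with its first correction: \<open>wmid z (j + 1/2) - wmid z (j - 1/2)\<close> agrees with the summand
  \<open>vterm j z\<close> up to a fourth derivative.\<close>

definition wmid :: "complex \<Rightarrow> real \<Rightarrow> complex" where
  "wmid z s = wder z 0 (of_real s) - wder z 2 (of_real s) / 24"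

lemma wder_1: "wder z 1 (of_nat j) = vterm j z"
  by (simp add: wder_def wpoly_def vterm_def power2_eq_square mult.commute)

text \<open>The condition i + n = 4 makes the remainder a fifth derivative of
  \<open>wder z 0\<close> in every use. Points within 1/2 of s are at least s/2, which multiplies
  the constant of \<open>wder5_bound\<close> by 4.\<close>

lemma wder_Taylor:
  assumes "Re z > 0" "\<bar>Im z\<bar> \<le> Re z" "s \<ge> 1" "i + n = 4" "\<bar>h\<bar> \<le> 1/2"
  shows "norm (wder z i (of_real (s + h)) - (\<Sum>k\<le>n. wder z (i + k) (of_real s) * of_real h ^ k / fact k)) \<le>
    120000 * sqrt (Re z) / s\<^sup>2 * (1/2) ^ Suc n / fact n"
proof -
  define S where "S = (of_real ` {s - 1/2 .. s + 1/2} :: complex set)"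
  have "norm (wder z (i + 0) (of_real (s + h)) - (\<Sum>k\<le>n. wder z (i + k) (of_real s) * (of_real (s + h) - of_real s) ^ k / fact k)) \<le>
    120000 * sqrt (Re z) / s\<^sup>2 * norm (of_real (s + h) - of_real s :: complex) ^ Suc n / fact n"
  proof (rule field_Taylor[where S = S and f = "\<lambda>k. wder z (i + k)"])
    show "convex S" unfolding S_def
      by (intro convex_linear_image bounded_linear.linear[OF bounded_linear_of_real]) simp
    show "of_real (s + h) \<in> S" using assms(5) unfolding S_def by (intro imageI) (auto simp: abs_if split: if_splits)
    show "of_real s \<in> S" unfolding S_def by (intro imageI) auto
    have z: "z \<noteq> 0" using assms by auto
    show "(wder z (i + k) has_field_derivative wder z (i + Suc k) x) (at x within S)" if "k \<le> n" for k x
      using wder_deriv[OF z, of "i + k"] that assms(4) by simp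
    fix y assume "y \<in> S"
    then obtain r where r: "y = of_real r" "s - 1/2 \<le> r" by (auto simp: S_def)
    have "i + Suc n = 5" using assms(4) by simp
    hence "norm (wder z (i + Suc n) y) \<le> 30000 * sqrt (Re z) / r\<^sup>2"
      unfolding r(1) using assms(3) r(2) wder5_bound[OF assms(1,2), of r] by simp
    also have "\<dots> \<le> 30000 * sqrt (Re z) / (s / 2)\<^sup>2"
      using r assms by (intro divide_left_mono power_mono mult_pos_pos zero_less_power) auto
    also have "\<dots> = 120000 * sqrt (Re z) / s\<^sup>2" by (simp add: power_divide)
    finally show "norm (wder z (i + Suc n) y) \<le> 120000 * sqrt (Re z) / s\<^sup>2" .
  qed
  also have "\<dots> \<le> 120000 * sqrt (Re z) / s\<^sup>2 * (1/2) ^ Suc n / fact n"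
  proof -
    have "norm (of_real (s + h) - of_real s :: complex) = \<bar>h\<bar>" by (simp flip: of_real_diff)
    thus ?thesis using assms by (intro divide_right_mono mult_left_mono power_mono) auto
  qed
  finally show ?thesis by simp
qed

lemma wmid_step:
  assumes "Re z > 0" "\<bar>Im z\<bar> \<le> Re z" "j \<ge> 1"
  shows "norm (wmid z (real j + 1/2) - wmid z (real j - 1/2) - vterm j z) \<le> 120000 * sqrt (Re z) / (real j)\<^sup>2"
proof -
  define s where "s = real j"
  define B where "B = 120000 * sqrt (Re z) / s\<^sup>2"
  have s: "s \<ge> 1" using assms by (simp add: s_def)
  have B: "B \<ge> 0" using assms by (simp add: B_def)
  define d where "d k = wder z k (of_real s)" for k
  have 4: "norm (wder z 0 (of_real (s + h)) - (d 0 + d 1 * of_real h + d 2 * of_real h ^ 2 / 2 + d 3 * of_real h ^ 3 / 6 + d 4 * of_real h ^ 4 / 24)) \<le> B / 32 / 24"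
    if "\<bar>h\<bar> \<le> 1/2" for h
    using wder_Taylor[OF assms(1,2) s, of 0 4 h] that by (simp add: d_def B_def fact_numeral eval_nat_numeral)
  have 2: "norm (wder z 2 (of_real (s + h)) - (d 2 + d 3 * of_real h + d 4 * of_real h ^ 2 / 2)) \<le> B / 8 / 2"
    if "\<bar>h\<bar> \<le> 1/2" for h
    using wder_Taylor[OF assms(1,2) s, of 2 2 h] that by (simp add: d_def B_def eval_nat_numeral)
  define a1 where "a1 = wder z 0 (of_real (s + 1/2)) - (d 0 + d 1 / 2 + d 2 / 8 + d 3 / 48 + d 4 / 384)"
  define a2 where "a2 = wder z 0 (of_real (s - 1/2)) - (d 0 - d 1 / 2 + d 2 / 8 - d 3 / 48 + d 4 / 384)"
  define b1 where "b1 = wder z 2 (of_real (s + 1/2)) - (d 2 + d 3 / 2 + d 4 / 8)"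
  define b2 where "b2 = wder z 2 (of_real (s - 1/2)) - (d 2 - d 3 / 2 + d 4 / 8)"
  have a: "norm a1 \<le> B / 32 / 24" "norm a2 \<le> B / 32 / 24"
    using 4[of "1/2"] 4[of "-1/2"] by (simp_all add: a1_def a2_def power_divide)
  have b: "norm b1 \<le> B / 8 / 2" "norm b2 \<le> B / 8 / 2"
    using 2[of "1/2"] 2[of "-1/2"] by (simp_all add: b1_def b2_def power_divide)
  have "vterm j z = d 1" using wder_1[of z j] by (simp add: d_def s_def)
  \<comment> \<open>The increment of \<open>wder z 0\<close> contributes d 1 + d 3 / 24 and that of
    the correction -d 3 / 24. The even derivatives cancel by symmetry, so only Taylor remainders are
    left.\<close>
  hence "wmid z (s + 1/2) - wmid z (s - 1/2) - vterm j z = (a1 - a2) - (b1 - b2) / 24"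
    by (simp add: wmid_def a1_def a2_def b1_def b2_def field_simps)
  also have "norm \<dots> \<le> (norm a1 + norm a2) + (norm b1 + norm b2) / 24"
  proof (rule order_trans[OF norm_triangle_ineq4] , rule add_mono[OF norm_triangle_ineq4])
    show "norm ((b1 - b2) / 24) \<le> (norm b1 + norm b2) / 24"
      using norm_triangle_ineq4[of b1 b2] by (simp add: norm_divide)
  qed
  also have "\<dots> \<le> (B / 32 / 24 + B / 32 / 24) + (B / 8 / 2 + B / 8 / 2) / 24"
    using a b by (intro add_mono divide_right_mono) auto
  also have "\<dots> \<le> B" using B by simp
  finally show ?thesis by (simp add: B_def s_def)
qed

lemma wmid_tendsto_0:
  assumes "Re z > 0"
  shows "(\<lambda>n. wmid z (real n + 1/2)) \<longlonglongrightarrow> 0"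
proof (rule Lim_null_comparison)
  define x where "x = Re z"
  define c where "c = norm z"
  have x: "x > 0" using assms by (simp add: x_def)
  show "(\<lambda>n. (1 / (2 * c) + (1 + 2 * c * (real n + 1/2)\<^sup>2) / 24) * exp (- x * (real n + 1/2)\<^sup>2)) \<longlonglongrightarrow> 0"
    using x by real_asymp
  have "norm (wmid z s) \<le> (1 / (2 * c) + (1 + 2 * c * s\<^sup>2) / 24) * exp (- x * s\<^sup>2)" for s
  proof -
    have e: "norm (exp (- z * (of_real s)\<^sup>2)) = exp (- x * s\<^sup>2)"
      by (simp add: x_def flip: of_real_power)
    have "norm (wder z 0 (of_real s)) = 1 / (2 * c) * exp (- x * s\<^sup>2)"
      unfolding wder_def norm_mult e by (simp add: wpoly_def norm_divide norm_mult c_def)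
    moreover have "norm (wder z 2 (of_real s)) \<le> (1 + 2 * c * s\<^sup>2) * exp (- x * s\<^sup>2)"
    proof -
      have "norm (1 - 2 * z * (of_real s)\<^sup>2) \<le> 1 + 2 * c * s\<^sup>2"
        using norm_triangle_ineq4[of 1 "2 * z * (of_real s)\<^sup>2"] by (simp add: norm_mult norm_power c_def)
      thus ?thesis unfolding wder_def norm_mult e by (simp add: wpoly_def mult_right_mono)
    qed
    moreover have "norm (wmid z s) \<le> norm (wder z 0 (of_real s)) + norm (wder z 2 (of_real s)) / 24"
      using norm_triangle_ineq4[of "wder z 0 (of_real s)" "wder z 2 (of_real s) / 24"]
      by (simp add: wmid_def norm_divide)
    ultimately have "norm (wmid z s) \<le> 1 / (2 * c) * exp (- x * s\<^sup>2) + (1 + 2 * c * s\<^sup>2) * exp (- x * s\<^sup>2) / 24"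
      by linarith
    thus ?thesis by (simp add: ring_distribs)
  qed
  thus "\<forall>\<^sub>F n in sequentially. norm (wmid z (real n + 1/2)) \<le>
      (1 / (2 * c) + (1 + 2 * c * (real n + 1/2)\<^sup>2) / 24) * exp (- x * (real n + 1/2)\<^sup>2)"
    by (intro always_eventually allI)
qed

text \<open>The boundary value is (1/(2 z) + (1 - z/2)/24) exp(-z/4); its constant term -1/8 + 1/24
  is the -1/12.\<close>

lemma wmid_half:
  assumes "z \<noteq> 0" "norm z \<le> 1"
  shows "norm (- wmid z (1/2) - (1 / (2 * z) - 1 / 12)) \<le> norm z"
proof -
  define r where "r = norm z"
  define R where "R = exp (- (z / 4)) - (1 - z / 4 + z\<^sup>2 / 32)"
  have r: "0 < r" "r \<le> 1" using assms by (auto simp: r_def)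
  have R: "norm R \<le> r ^ 3 / 32"
    using norm_exp_Taylor2[of "- (z / 4)"] assms by (simp add: R_def r_def norm_divide power_divide)
  have e: "exp (- (z / 4)) = 1 - z / 4 + z\<^sup>2 / 32 + R" by (simp add: R_def)
  have w: "- wmid z (1/2) = (1 / (2 * z) + (1 - z / 2) / 24) * exp (- (z / 4))"
    by (simp add: wmid_def wder_def wpoly_def power_divide left_diff_distrib distrib_right)
  have eq: "- wmid z (1/2) - (1 / (2 * z) - 1 / 12) = - z / 64 + 5 * z\<^sup>2 / 768 - z ^ 3 / 1536 + R / (2 * z) + (1 - z / 2) * R / 24"
    unfolding w e using assms(1) by (simp add: field_simps power2_eq_square power3_eq_cube)
  have "norm (- wmid z (1/2) - (1 / (2 * z) - 1 / 12)) \<le> r / 64 + 5 * r\<^sup>2 / 768 + r ^ 3 / 1536 + (r ^ 3 / 32) / (2 * r) + (1 + r / 2) * (r ^ 3 / 32) / 24"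
    unfolding eq
  proof (intro order_trans[OF norm_triangle_ineq] order_trans[OF norm_triangle_ineq4] add_mono)
    show "norm (R / (2 * z)) \<le> r ^ 3 / 32 / (2 * r)"
      unfolding norm_divide norm_mult norm_numeral r_def [symmetric] using R r by (intro divide_right_mono) auto
    have "norm (1 - z / 2) \<le> 1 + r / 2"
      using norm_triangle_ineq4[of 1 "z / 2"] by (simp add: norm_divide r_def)
    thus "norm ((1 - z / 2) * R / 24) \<le> (1 + r / 2) * (r ^ 3 / 32) / 24"
      unfolding norm_divide norm_mult norm_numeral using R r by (intro divide_right_mono mult_mono) auto
    show "norm (- z / 64) \<le> r / 64" by (simp add: norm_divide r_def)
    show "norm (5 * z\<^sup>2 / 768) \<le> 5 * r\<^sup>2 / 768" by (simp add: norm_divide norm_mult norm_power r_def)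
    show "norm (z ^ 3 / 1536) \<le> r ^ 3 / 1536" by (simp add: norm_divide norm_power r_def)
  qed
  also have "\<dots> \<le> r"
  proof -
    have "r * r \<le> r * 1" using r by (intro mult_left_mono) auto
    hence r2: "r\<^sup>2 \<le> r" by (simp add: power2_eq_square)
    have "r\<^sup>2 * r \<le> r * 1" using r r2 by (intro mult_mono) auto
    hence r3: "r ^ 3 \<le> r" by (simp add: power3_eq_cube power2_eq_square)
    have "(1 + r / 2) * (r ^ 3 / 32) / 24 \<le> 2 * (r / 32) / 24"
      using r r3 by (intro divide_right_mono mult_mono) auto
    moreover have "(r ^ 3 / 32) / (2 * r) = r\<^sup>2 / 64" using r by (simp add: power3_eq_cube power2_eq_square)
    ultimately show ?thesis using r2 r3 r(1) by linarith
  qed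
  finally show ?thesis by (simp add: r_def)
qed

lemma inverse_squares_summable: "summable (\<lambda>j. 1 / (real (Suc j))\<^sup>2)"
  using inverse_squares_sums by (simp add: sums_iff add.commute)

definition vsum :: "complex \<Rightarrow> complex" where
  "vsum z = (\<Sum>j. vterm (Suc j) z)"

text \<open>The increments of \<open>wmid\<close> telescope, so the series equals the boundary value
  at 1/2 up to the errors of \<open>wmid_step\<close>. These add up to a multiple of (Re z)^(1/2),
  since the sum of 1/j^2 is below 2.\<close>

lemma
  assumes "Re z > 0" "\<bar>Im z\<bar> \<le> Re z"
  shows vterm_sums: "(\<lambda>j. vterm (Suc j) z) sums vsum z"
    and vsum_asymp: "norm z \<le> 1 \<Longrightarrow> norm (vsum z - (1 / (2 * z) - 1 / 12)) \<le> 250000 * sqrt (norm z)"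
proof -
  define f where "f n = wmid z (real n + 1/2)" for n
  define e where "e n = f (Suc n) - f n - vterm (Suc n) z" for n
  have f: "(\<lambda>n. f (Suc n) - f n) sums (0 - f 0)"
    unfolding f_def by (rule telescope_sums[OF wmid_tendsto_0[OF assms(1)]])
  have le: "norm (e n) \<le> 120000 * sqrt (Re z) * (1 / (real (Suc n))\<^sup>2)" for n
    using wmid_step[OF assms(1,2), of "Suc n"] by (simp add: e_def f_def add_ac)
  have sm: "summable (\<lambda>n. 120000 * sqrt (Re z) * (1 / (real (Suc n))\<^sup>2))"
    by (intro summable_mult inverse_squares_summable)
  have se: "summable e" by (rule summable_comparison_test'[OF sm]) (use le in auto)
  have "(\<lambda>n. (f (Suc n) - f n) - e n) sums (0 - f 0 - suminf e)"
    by (intro sums_diff f summable_sums se)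
  hence vs: "(\<lambda>j. vterm (Suc j) z) sums (- f 0 - suminf e)" by (simp add: e_def)
  hence V: "vsum z = - f 0 - suminf e" by (simp add: vsum_def sums_iff)
  show "(\<lambda>j. vterm (Suc j) z) sums vsum z" using vs V by simp
  assume z1: "norm z \<le> 1"
  have "norm (suminf e) \<le> (\<Sum>n. 120000 * sqrt (Re z) * (1 / (real (Suc n))\<^sup>2))"
    by (rule norm_suminf_le[OF le sm])
  also have "\<dots> = 120000 * sqrt (Re z) * (\<Sum>n. 1 / (real (Suc n))\<^sup>2)"
    by (intro suminf_mult inverse_squares_summable)
  also have "(\<Sum>n. 1 / (real (Suc n))\<^sup>2) = pi\<^sup>2 / 6"
    using inverse_squares_sums by (simp add: sums_iff add.commute)
  also have "120000 * sqrt (Re z) * (pi\<^sup>2 / 6) \<le> 120000 * sqrt (norm z) * 2"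
  proof (intro mult_mono)
    have "pi\<^sup>2 \<le> (3.2)\<^sup>2" using pi_less_4 pi_approx by (intro power_mono) auto
    thus "pi\<^sup>2 / 6 \<le> 2" by (simp add: power2_eq_square)
  qed (use complex_Re_le_cmod[of z] assms(1) in auto)
  finally have E: "norm (suminf e) \<le> 240000 * sqrt (norm z)" by simp
  have "norm (- f 0 - (1 / (2 * z) - 1 / 12)) \<le> norm z"
  proof -
    have "z \<noteq> 0" using assms(1) by auto
    thus ?thesis using wmid_half[of z] z1 by (simp add: f_def)
  qed
  also have "\<dots> = sqrt (norm z) * sqrt (norm z)" by simp
  also have "\<dots> \<le> sqrt (norm z) * 1" using z1 by (intro mult_left_mono) auto
  finally have F: "norm (- f 0 - (1 / (2 * z) - 1 / 12)) \<le> sqrt (norm z)" by simp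
  have "vsum z - (1 / (2 * z) - 1 / 12) = (- f 0 - (1 / (2 * z) - 1 / 12)) - suminf e"
    unfolding V by simp
  also have "norm \<dots> \<le> sqrt (norm z) + 240000 * sqrt (norm z)"
    using norm_triangle_ineq4[of "- f 0 - (1 / (2 * z) - 1 / 12)" "suminf e"] E F by linarith
  also have "\<dots> \<le> 250000 * sqrt (norm z)" by simp
  finally show "norm (vsum z - (1 / (2 * z) - 1 / 12)) \<le> 250000 * sqrt (norm z)" .
qed

section \<open>The contribution of the pole of coth to the string series\<close>

definition uterm :: "nat \<Rightarrow> complex \<Rightarrow> complex" where
  "uterm j z = ediff j z / of_nat j"

definition usum :: "complex \<Rightarrow> complex" where
  "usum z = (\<Sum>j. uterm (Suc j) z)"

lemma norm_exp_square_le: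
  assumes "Re z \<ge> r" "r > 0"
  shows "norm (exp (- (of_nat (Suc n * Suc n) * z))) \<le> exp (-r) ^ Suc n"
proof -
  have "real (Suc n) * r \<le> real (Suc n * Suc n) * Re z"
    using assms by (intro mult_mono) (auto simp del: of_nat_Suc)
  thus ?thesis
    by (simp add: exp_of_nat_mult [symmetric] del: of_nat_Suc of_nat_mult mult_Suc mult_Suc_right power_Suc)
qed

lemma norm_exp_diff_square_le:
  assumes "Re z \<ge> r" "r > 0"
  shows "norm (ediff (Suc n) z) \<le> 2 * exp (-r) ^ Suc n"
proof -
  have "norm (exp (- (of_nat (Suc n * Suc n) * (2 * z)))) \<le> exp (-r) ^ Suc n"
    using assms by (intro norm_exp_square_le) auto
  hence "norm (exp (- (2 * of_nat (Suc n * Suc n) * z))) \<le> exp (-r) ^ Suc n"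
    by (simp only: mult.left_commute mult.assoc)
  with norm_exp_square_le[OF assms, of n] show ?thesis
    using norm_triangle_ineq4[of "exp (- (of_nat (Suc n * Suc n) * z))" "exp (- (2 * of_nat (Suc n * Suc n) * z))"]
    by linarith
qed

lemma uterm_deriv:
  assumes "j > 0"
  shows "(uterm j has_field_derivative (- vterm j z + 2 * vterm j (2 * z))) (at z)"
  unfolding uterm_def [abs_def] vterm_def using assms
  by (auto intro!: derivative_eq_intros simp: field_simps)

text \<open>On a ball of radius Re z / 2 the terms have a geometric majorant, which allows termwise
  differentiation. The cone is assumed for the derivative because \<open>vterm_sums\<close>
  identifies the two resulting series there.\<close>

lemma
  assumes "Re z > 0"
  shows uterm_sums: "(\<lambda>j. uterm (Suc j) z) sums usum z"
    and usum_deriv: "\<bar>Im z\<bar> \<le> Re z \<Longrightarrow> (usum has_field_derivative (- vsum z + 2 * vsum (2 * z))) (at z)"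
proof -
  define S where "S = {z. Re z > 0}"
  have "\<exists>g g'. \<forall>z\<in>S. ((\<lambda>n. uterm (Suc n) z) sums g z) \<and> ((\<lambda>n. - vterm (Suc n) z + 2 * vterm (Suc n) (2 * z)) sums g' z) \<and>
      (g has_field_derivative g' z) (at z)"
  proof (rule series_and_derivative_comparison_complex)
    show "open S" unfolding S_def by (rule open_halfspace_Re_gt)
    show "(uterm (Suc n) has_field_derivative - vterm (Suc n) x + 2 * vterm (Suc n) (2 * x)) (at x)" for n x
      by (rule uterm_deriv) simp
    fix x assume "x \<in> S"
    hence x: "Re x > 0" by (simp add: S_def)
    define r where "r = Re x / 2"
    have r: "r > 0" using x by (simp add: r_def)
    define h where "h n = (of_real (2 * exp (-r) ^ Suc n) :: complex)" for n
    have "summable h"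
      unfolding h_def summable_complex_of_real using r by (intro summable_mult) (simp add: summable_geometric)
    moreover have "range h \<subseteq> \<real>\<^sub>\<ge>\<^sub>0" unfolding h_def by (auto simp del: of_real_mult of_real_power power_Suc)
    moreover have "norm (uterm (Suc n) y) \<le> norm (h n)" if "y \<in> ball x r" for n y
    proof -
      have "\<bar>Re (x - y)\<bar> \<le> norm (x - y)" by (rule abs_Re_le_cmod)
      also have "\<dots> < r" using that by (simp add: dist_norm)
      finally have "Re x - Re y < r" using abs_ge_self[of "Re (x - y)"] by simp
      hence y: "Re y \<ge> r" unfolding r_def by linarith
      have "norm (uterm (Suc n) y) \<le> 2 * exp (-r) ^ Suc n / real (Suc n)"
        unfolding uterm_def norm_divide norm_of_nat using norm_exp_diff_square_le[OF y r, of n] by (intro divide_right_mono) auto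
      also have "\<dots> \<le> 2 * exp (-r) ^ Suc n / 1" by (intro divide_left_mono) auto
      finally show ?thesis unfolding h_def norm_of_real by simp
    qed
    ultimately show "\<exists>d h. 0 < d \<and> summable h \<and> range h \<subseteq> \<real>\<^sub>\<ge>\<^sub>0 \<and> (\<forall>\<^sub>F n in sequentially. \<forall>y\<in>ball x d \<inter> S. norm (uterm (Suc n) y) \<le> cmod (h n))"
      using r by (intro exI[of _ r] exI[of _ h]) auto
  qed
  then obtain g g' where g: "\<And>z. z \<in> S \<Longrightarrow> (\<lambda>n. uterm (Suc n) z) sums g z"
    "\<And>z. z \<in> S \<Longrightarrow> (\<lambda>n. - vterm (Suc n) z + 2 * vterm (Suc n) (2 * z)) sums g' z"
    "\<And>z. z \<in> S \<Longrightarrow> (g has_field_derivative g' z) (at z)" by blast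
  have zS: "z \<in> S" using assms by (simp add: S_def)
  have eq: "usum w = g w" if "w \<in> S" for w using g(1)[OF that] by (simp add: usum_def sums_iff)
  show "(\<lambda>j. uterm (Suc j) z) sums usum z" using g(1)[OF zS] eq[OF zS] by simp
  assume "\<bar>Im z\<bar> \<le> Re z"
  hence "(\<lambda>n. - vterm (Suc n) z + 2 * vterm (Suc n) (2 * z)) sums (- vsum z + 2 * vsum (2 * z))"
    using assms by (intro sums_add sums_minus sums_mult vterm_sums) auto
  with g(2)[OF zS] have "g' z = - vsum z + 2 * vsum (2 * z)" by (rule sums_unique2)
  with g(3)[OF zS] have "(g has_field_derivative - vsum z + 2 * vsum (2 * z)) (at z)" by simp
  thus "(usum has_field_derivative (- vsum z + 2 * vsum (2 * z))) (at z)"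
    by (rule has_field_derivative_transform_within_open[of _ _ _ S]) (use zS eq open_halfspace_Re_gt in \<open>auto simp: S_def\<close>)
qed

text \<open>In -vsum w + 2 vsum (2 w) the poles -1/(2 w) and 2/(4 w) cancel and the constants leave
  1/12 - 2/12 = -1/12. Integrating along the segment from z to m z gives the difference of values
  directly. The bound on |z| keeps |2 w| \<le> 1 on the whole segment, and 750000 = 3 *
  250000.\<close>

lemma usum_diff_asymp:
  fixes m :: real
  assumes z: "Re z > 0" "\<bar>Im z\<bar> \<le> Re z" and m: "m \<ge> 1" "norm z \<le> 1 / (2 * m)"
  shows "norm (usum (of_real m * z) - usum z + of_real (m - 1) * z / 12) \<le> 750000 * sqrt (2 * m * norm z) * ((m - 1) * norm z)"
proof -
  let ?S = "closed_segment z (of_real m * z)"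
  let ?f = "\<lambda>w. usum w + w / 12"
  have "norm (?f (of_real m * z) - ?f z) \<le> 750000 * sqrt (2 * m * norm z) * norm (of_real m * z - z)"
  proof (rule field_differentiable_bound[where S = ?S and f' = "\<lambda>w. (- vsum w + 2 * vsum (2 * w)) + 1 / 12"])
    fix w assume "w \<in> ?S"
    then obtain t where t: "0 \<le> t" "t \<le> 1" "w = (1 - t) *\<^sub>R z + t *\<^sub>R (of_real m * z)"
      by (auto simp: in_segment)
    define c where "c = 1 + t * (m - 1)"
    have c: "1 \<le> c" "c \<le> m"
      using t m mult_right_mono[of t 1 "m - 1"] by (auto simp: c_def)
    have w: "w = of_real c * z" unfolding t(3) c_def by (simp add: scaleR_conv_of_real algebra_simps)
    have w': "Re w > 0" "\<bar>Im w\<bar> \<le> Re w" using z c by (auto simp: w abs_mult mult_left_mono)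
    have "norm w = c * norm z" using c by (simp add: w norm_mult)
    also have "\<dots> \<le> m * norm z" using c by (intro mult_right_mono) auto
    finally have nw: "norm w \<le> m * norm z" .
    moreover have "m * norm z \<le> 1 / 2" using m by (simp add: field_simps)
    ultimately have nw': "norm w \<le> 1" "norm (2 * w) \<le> 1" by (simp_all add: norm_mult)
    show "(?f has_field_derivative (- vsum w + 2 * vsum (2 * w)) + 1 / 12) (at w within ?S)"
      by (intro DERIV_add has_field_derivative_at_within[OF usum_deriv] w') (auto intro!: derivative_eq_intros)
    define a where "a = vsum w - (1 / (2 * w) - 1 / 12)"
    define b where "b = vsum (2 * w) - (1 / (2 * (2 * w)) - 1 / 12)"
    have "w \<noteq> 0" using w'(1) by auto
    hence "(- vsum w + 2 * vsum (2 * w)) + 1 / 12 = 2 * b - a"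
      by (simp add: a_def b_def field_simps)
    also have "norm \<dots> \<le> 2 * norm b + norm a"
      using norm_triangle_ineq4[of "2 * b" a] by (simp add: norm_mult)
    also have "norm a \<le> 250000 * sqrt (norm w)"
      unfolding a_def using w' nw' by (intro vsum_asymp) auto
    also have "norm b \<le> 250000 * sqrt (norm (2 * w))"
      unfolding b_def using w' nw' by (intro vsum_asymp) auto
    also have "sqrt (norm w) \<le> sqrt (2 * m * norm z)"
      using nw norm_ge_zero[of w] by (intro real_sqrt_le_mono) linarith
    also have "sqrt (norm (2 * w)) \<le> sqrt (2 * m * norm z)"
      using nw by (intro real_sqrt_le_mono) (simp add: norm_mult)
    finally show "norm ((- vsum w + 2 * vsum (2 * w)) + 1 / 12) \<le> 750000 * sqrt (2 * m * norm z)" by simp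
  qed auto
  also have "norm (of_real m * z - z) = (m - 1) * norm z"
  proof -
    have "of_real m * z - z = of_real (m - 1) * z" by (simp add: algebra_simps)
    thus ?thesis using m by (simp add: norm_mult del: of_real_diff)
  qed
  also have "?f (of_real m * z) - ?f z = usum (of_real m * z) - usum z + of_real (m - 1) * z / 12"
    by (simp add: field_simps)
  finally show ?thesis .
qed

section \<open>The contribution of the regular part, and the combined expansion\<close>

definition kterm :: "nat \<Rightarrow> complex \<Rightarrow> complex" where
  "kterm j z = ediff j z * kap (of_nat j * z)"

definition ksum :: "complex \<Rightarrow> complex" where
  "ksum z = (\<Sum>j. kterm (Suc j) z)"

lemma hterm_split:
  assumes "z \<noteq> 0" "j > 0"
  shows "hterm j z = 2 / z * uterm j z + kterm j z"
proof -
  have "2 / z * (e / of_nat j) = e * (2 / (of_nat j * z))" for e :: complex by (simp add: mult.commute)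
  thus ?thesis unfolding hterm_def uterm_def kterm_def kap_def by (simp only: right_diff_distrib) simp
qed

text \<open>Converts a Gaussian term into a summand to which
  \<open>sums_inverse_square_shift\<close> applies; 96 = 2 * 24 + 2 * 24.\<close>

lemma sq_exp_neg_sq_le:
  fixes t :: real
  assumes "t \<ge> 0"
  shows "t\<^sup>2 * exp (- (t\<^sup>2)) \<le> 96 / (1 + t)\<^sup>2"
proof -
  have "(1 + t)\<^sup>2 + (1 - t)\<^sup>2 = 2 + 2 * t\<^sup>2" by (simp add: power2_eq_square algebra_simps)
  hence le: "(1 + t)\<^sup>2 \<le> 2 + 2 * t\<^sup>2" using zero_le_power2[of "1 - t"] by linarith
  have "(1 + t)\<^sup>2 * (t\<^sup>2 * exp (- (t\<^sup>2))) \<le> (2 + 2 * t\<^sup>2) * (t\<^sup>2 * exp (- (t\<^sup>2)))"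
    using le by (intro mult_right_mono) auto
  also have "\<dots> = 2 * (t ^ 2 * exp (- (t\<^sup>2))) + 2 * (t ^ 4 * exp (- (t\<^sup>2)))"
    by (simp add: distrib_right mult.assoc flip: power_add)
  also have "\<dots> \<le> 2 * 24 + 2 * 24"
    by (intro add_mono mult_left_mono power_times_exp_neg_sq_le assms) auto
  finally have "(1 + t)\<^sup>2 * (t\<^sup>2 * exp (- (t\<^sup>2))) \<le> 96" by simp
  moreover have "(1 + t)\<^sup>2 > 0" using assms by simp
  ultimately show ?thesis by (simp add: pos_le_divide_eq mult.commute)
qed

text \<open>Replacing kap w by w/6 gives (z/6)(vsum z - vsum (2 z)), where the poles leave (z/6) *
  1/(4 z) = 1/24. The quadratic remainder at w = j z is bounded by a multiple of x/(1 + j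
  x^(1/2))^2, whose sum is of order x^(1/2).\<close>

lemma
  assumes z: "Re z > 0" "\<bar>Im z\<bar> \<le> Re z"
  shows kterm_sums: "(\<lambda>j. kterm (Suc j) z) sums ksum z"
    and ksum_asymp: "norm z \<le> 1 / 2 \<Longrightarrow> norm (ksum z - 1 / 24) \<le> 200000 * sqrt (norm z)"
proof -
  define x where "x = Re z"
  have x: "x > 0" using z by (simp add: x_def)
  have nz: "norm z \<le> 2 * x" using cone_norm_le[OF z(2)] by (simp add: x_def)
  define e where "e n = ediff (Suc n) z * (kap (of_nat (Suc n) * z) - of_nat (Suc n) * z / 6)" for n
  have split: "kterm (Suc n) z = z / 6 * (vterm (Suc n) z - vterm (Suc n) (2 * z)) + e n" for n
  proof -
    have "vterm (Suc n) (2 * z) = of_nat (Suc n) * exp (- (2 * of_nat (Suc n * Suc n) * z))"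
      by (simp only: vterm_def mult.assoc mult.left_commute)
    moreover have "(a - b) * k = z / 6 * (n * a - n * b) + (a - b) * (k - n * z / 6)" for a b k n :: complex
      by (simp add: field_simps)
    ultimately show ?thesis unfolding kterm_def e_def vterm_def[of _ z] by (simp only:)
  qed
  have le: "norm (e n) \<le> 15360 * x * inverse_square (sqrt x) n" for n
  proof -
    define j where "j = real (Suc n)"
    define t where "t = j * sqrt x"
    have j: "j > 0" by (simp add: j_def)
    have t: "t \<ge> 0" "t\<^sup>2 = j\<^sup>2 * x" using x j by (auto simp: t_def power_mult_distrib)
    have e1: "norm (exp (- (of_nat (Suc n * Suc n) * z))) = exp (- (t\<^sup>2))"
      unfolding t j_def norm_exp_eq_Re by (simp add: x_def power2_eq_square del: of_nat_Suc mult_Suc mult_Suc_right)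
    have "norm (exp (- (2 * of_nat (Suc n * Suc n) * z))) = exp (- (2 * t\<^sup>2))"
      unfolding t j_def norm_exp_eq_Re by (simp add: x_def power2_eq_square del: of_nat_Suc mult_Suc mult_Suc_right)
    also have "\<dots> \<le> exp (- (t\<^sup>2))" by simp
    finally have "norm (ediff (Suc n) z) \<le> 2 * exp (- (t\<^sup>2))"
      using e1 norm_triangle_ineq4[of "exp (- (of_nat (Suc n * Suc n) * z))" "exp (- (2 * of_nat (Suc n * Suc n) * z))"] by linarith
    moreover have "norm (kap (of_nat (Suc n) * z) - of_nat (Suc n) * z / 6) \<le> 20 * (norm (of_nat (Suc n) * z))\<^sup>2"
      using z by (intro norm_kap_minus_linear_le) (auto simp: abs_mult mult_left_mono simp del: of_nat_Suc)
    moreover have "20 * (norm (of_nat (Suc n) * z))\<^sup>2 \<le> 20 * (j * (2 * x))\<^sup>2"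
      unfolding norm_mult norm_of_nat j_def using nz by (intro mult_left_mono power_mono mult_left_mono) auto
    ultimately have "norm (e n) \<le> (2 * exp (- (t\<^sup>2))) * (20 * (j * (2 * x))\<^sup>2)"
      unfolding e_def norm_mult by (intro mult_mono) auto
    also have "\<dots> = 160 * x * (t\<^sup>2 * exp (- (t\<^sup>2)))"
      unfolding t(2) by (simp add: power2_eq_square)
    also have "\<dots> \<le> 160 * x * (96 / (1 + t)\<^sup>2)"
      using x t by (intro mult_left_mono sq_exp_neg_sq_le) auto
    finally show ?thesis by (simp add: t_def j_def)
  qed
  have sq: "sqrt x > 0" using x by simp
  have sm: "summable (\<lambda>n. 15360 * x * inverse_square (sqrt x) n)"
    by (intro summable_mult sums_inverse_square_shift sq)
  have se: "summable e" by (rule summable_comparison_test'[OF sm]) (use le in auto)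
  have ks: "(\<lambda>n. kterm (Suc n) z) sums (z / 6 * (vsum z - vsum (2 * z)) + suminf e)"
    unfolding split using z by (intro sums_add sums_mult sums_diff vterm_sums summable_sums se) auto
  hence K: "ksum z = z / 6 * (vsum z - vsum (2 * z)) + suminf e" by (simp add: ksum_def sums_iff)
  show "(\<lambda>j. kterm (Suc j) z) sums ksum z" using ks K by simp
  assume z1: "norm z \<le> 1 / 2"
  have "norm (suminf e) \<le> (\<Sum>n. 15360 * x * inverse_square (sqrt x) n)"
    by (rule norm_suminf_le[OF le sm])
  also have "\<dots> = 15360 * x * (\<Sum>n. inverse_square (sqrt x) n)"
    by (intro suminf_mult sums_inverse_square_shift sq)
  also have "\<dots> \<le> 15360 * x * (1 / sqrt x)"
    using x by (intro mult_left_mono sums_inverse_square_shift sq) auto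
  also have "\<dots> = 15360 * sqrt x" using arg_cong[OF real_div_sqrt[of x], of "(*) 15360"] x by simp
  also have "\<dots> \<le> 15360 * sqrt (norm z)" using complex_Re_le_cmod[of z] by (simp add: x_def)
  finally have E: "norm (suminf e) \<le> 15360 * sqrt (norm z)" .
  define a where "a = vsum z - (1 / (2 * z) - 1 / 12)"
  define b where "b = vsum (2 * z) - (1 / (2 * (2 * z)) - 1 / 12)"
  have a: "norm a \<le> 250000 * sqrt (norm z)"
    unfolding a_def using z z1 by (intro vsum_asymp) auto
  have "norm b \<le> 250000 * sqrt (norm (2 * z))"
    unfolding b_def using z z1 by (intro vsum_asymp) (auto simp: norm_mult)
  also have "sqrt (norm (2 * z)) \<le> 2 * sqrt (norm z)"
    using sqrt2_less_2 by (simp add: norm_mult real_sqrt_mult mult_right_mono)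
  finally have b: "norm b \<le> 500000 * sqrt (norm z)" by simp
  have "z \<noteq> 0" using z by auto
  hence "ksum z - 1 / 24 = z / 6 * (a - b) + suminf e"
    unfolding K a_def b_def by (simp add: field_simps)
  also have "norm \<dots> \<le> norm z / 6 * (norm a + norm b) + norm (suminf e)"
  proof (rule order_trans[OF norm_triangle_ineq], rule add_right_mono)
    show "norm (z / 6 * (a - b)) \<le> norm z / 6 * (norm a + norm b)"
      unfolding norm_mult using norm_triangle_ineq4[of a b] by (simp add: norm_divide mult_left_mono)
  qed
  also have "norm z / 6 * (norm a + norm b) \<le> (1 / 2) / 6 * (750000 * sqrt (norm z))"
    using a b z1 by (intro mult_mono divide_right_mono) auto
  finally show "norm (ksum z - 1 / 24) \<le> 200000 * sqrt (norm z)"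
    using E real_sqrt_ge_zero[OF norm_ge_zero[of z]] by linarith
qed

text \<open>Since m * 2/(m z) = 2/z, the pole parts combine to (2/z)(usum z - usum (m z)), which
  tends to (m - 1)/6; the regular parts tend to (1 - m)/24. The sum is (m - 1)/8. This is why the
  weight m in front of the second series is the right one.\<close>

lemma hsum_diff_asymp:
  assumes m: "m \<ge> (1::nat)"
  shows "\<exists>B. \<forall>z. Re z > 0 \<and> \<bar>Im z\<bar> \<le> Re z \<and> norm z \<le> 1 / (2 * real m) \<longrightarrow>
    norm (hsum z - of_nat m * hsum (of_nat m * z) - of_real ((real m - 1) / 8)) \<le> B * sqrt (norm z)"
proof (intro exI allI impI)
  fix z :: complex
  assume "Re z > 0 \<and> \<bar>Im z\<bar> \<le> Re z \<and> norm z \<le> 1 / (2 * real m)"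
  hence z: "Re z > 0" "\<bar>Im z\<bar> \<le> Re z" "norm z \<le> 1 / (2 * real m)" by auto
  define M where "M = real m"
  have M: "M \<ge> 1" "of_nat m = (of_real M :: complex)" using m by (auto simp: M_def)
  define w where "w = of_real M * z"
  have "M * norm z \<le> 1 / 2" using z(3) M by (simp add: M_def[symmetric] field_simps)
  moreover have "1 * norm z \<le> M * norm z" using M by (intro mult_right_mono) auto
  ultimately have nz: "norm z \<le> 1 / 2" and nw: "norm w \<le> 1 / 2" using M by (auto simp: w_def norm_mult)
  have w: "Re w > 0" "\<bar>Im w\<bar> \<le> Re w" using z M by (auto simp: w_def abs_mult mult_left_mono)
  have z0: "z \<noteq> 0" "w \<noteq> 0" using z w by auto
  have hs: "hsum v = 2 / v * usum v + ksum v" if "Re v > 0" "\<bar>Im v\<bar> \<le> Re v" for v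
  proof -
    have "v \<noteq> 0" using that by auto
    have "(\<lambda>j. 2 / v * uterm (Suc j) v + kterm (Suc j) v) sums (2 / v * usum v + ksum v)"
      using that by (intro sums_add sums_mult uterm_sums kterm_sums)
    also have "(\<lambda>j. 2 / v * uterm (Suc j) v + kterm (Suc j) v) = (\<lambda>j. hterm (Suc j) v)"
      using hterm_split[OF \<open>v \<noteq> 0\<close>] by simp
    finally show ?thesis by (simp add: hsum_def sums_iff)
  qed
  define a where "a = usum w - usum z + of_real (M - 1) * z / 12"
  define A where "A = 2 / z * a"
  define B where "B = ksum z - 1 / 24"
  define D where "D = of_real M * (ksum w - 1 / 24)"
  have eq: "hsum z - of_nat m * hsum (of_nat m * z) - of_real ((real m - 1) / 8) =
      - A + B - D"
  proof -
    define U where "U = 2 / z * (usum w - usum z)"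
    have "of_real M * (2 / w) = 2 / z" using M z0 by (simp add: w_def)
    hence "of_real M * (2 / w * usum w) = 2 / z * usum w" by (simp only: mult.assoc [symmetric])
    hence X: "hsum z - of_real M * hsum w = - U + ksum z - of_real M * ksum w"
      unfolding hs[OF z(1,2)] hs[OF w] U_def by (simp add: right_diff_distrib distrib_left)
    have Y: "A = U + of_real (M - 1) / 6"
      using z0 by (simp add: A_def U_def a_def distrib_left)
    show ?thesis unfolding M(2) M_def[symmetric] w_def[symmetric] B_def D_def X Y
      by (simp add: field_simps)
  qed
  have "norm (- A + B - D) \<le> norm A + norm B + norm D"
    using norm_triangle_ineq4[of "- A + B" D] norm_triangle_ineq[of "- A" B] by simp
  moreover have "norm A \<le> 1500000 * sqrt (2 * M) * (M - 1) * sqrt (norm z)"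
  proof -
    have "norm a \<le> 750000 * sqrt (2 * M * norm z) * ((M - 1) * norm z)"
      unfolding a_def w_def using z M by (intro usum_diff_asymp) (auto simp: M_def)
    hence "norm A \<le> 2 / norm z * (750000 * sqrt (2 * M * norm z) * ((M - 1) * norm z))"
      unfolding A_def norm_mult norm_divide norm_numeral by (intro mult_left_mono) auto
    also have "\<dots> = 1500000 * sqrt (2 * M) * (M - 1) * sqrt (norm z)"
      using z0 by (simp add: real_sqrt_mult)
    finally show ?thesis .
  qed
  moreover have "norm B \<le> 200000 * sqrt (norm z)"
    unfolding B_def using z nz by (intro ksum_asymp)
  moreover have "norm D \<le> 200000 * M * sqrt M * sqrt (norm z)"
  proof -
    have "norm D = M * norm (ksum w - 1 / 24)" using M unfolding D_def by (simp add: norm_mult)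
    also have "\<dots> \<le> M * (200000 * sqrt (norm w))"
      using w nw M by (intro mult_left_mono ksum_asymp) auto
    also have "\<dots> = 200000 * M * sqrt M * sqrt (norm z)"
      using M by (simp add: w_def norm_mult real_sqrt_mult)
    finally show ?thesis .
  qed
  ultimately show "norm (hsum z - of_nat m * hsum (of_nat m * z) - of_real ((real m - 1) / 8)) \<le>
    (1500000 * sqrt (2 * real m) * (real m - 1) + 200000 + 200000 * real m * sqrt (real m)) * sqrt (norm z)"
    unfolding eq M_def by (simp only: distrib_right)
qed

text \<open>Valid in the whole half-plane, hence also outside the cone. It grows only like (Re
  z)^(-2) at 0, which the exponential saving of the minor arcs absorbs.\<close>

lemma norm_hsum_le:
  assumes "Re z > 0"
  shows "norm (hsum z) \<le> 4 / (1 - exp (- Re z))\<^sup>2"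
proof -
  define r where "r = exp (- Re z)"
  have r: "0 < r" "r < 1" using assms by (auto simp: r_def)
  have le: "norm (hterm (Suc n) z) \<le> 4 / (1 - r) * r ^ n" for n
  proof -
    define v where "v = exp (- (of_nat (Suc n) * z))"
    have "norm v = r ^ Suc n" by (simp add: v_def r_def exp_of_nat_mult [symmetric] del: of_nat_Suc power_Suc)
    also have "\<dots> \<le> r" using r by (simp add: mult_left_le power_le_one)
    finally have v: "norm v \<le> r" .
    have "norm (1 + v) \<le> 2" using norm_triangle_ineq[of 1 v] v r by simp
    moreover have "1 - r \<le> norm (1 - v)" using norm_triangle_ineq2[of 1 v] v by simp
    ultimately have c: "norm (cth (of_nat (Suc n) * z)) \<le> 2 / (1 - r)"
      unfolding cth_def v_def[symmetric] norm_divide using r by (intro frac_le) auto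
    have "norm (hterm (Suc n) z) \<le> (2 * r ^ Suc n) * (2 / (1 - r))"
      unfolding hterm_def norm_mult using norm_exp_diff_square_le[of "Re z" z n] assms c r
      by (intro mult_mono) (auto simp: r_def)
    also have "\<dots> \<le> (2 * r ^ n) * (2 / (1 - r))"
      using r by (intro mult_right_mono) (auto simp: mult_left_le_one_le)
    finally show ?thesis by simp
  qed
  have sums: "(\<lambda>n. 4 / (1 - r) * r ^ n) sums (4 / (1 - r) * (1 / (1 - r)))"
    using r by (intro sums_mult geometric_sums) auto
  have "norm (hsum z) \<le> (\<Sum>n. 4 / (1 - r) * r ^ n)"
    unfolding hsum_def by (rule norm_suminf_le[OF le sums_summable[OF sums]])
  also have "\<dots> = 4 / (1 - r)\<^sup>2" using sums by (simp add: sums_iff power2_eq_square)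
  finally show ?thesis by (simp add: r_def)
qed

subsection \<open>Coefficient integrals, major and minor arcs\<close>

lemma has_integral_cis:
  fixes k :: int
  shows "((\<lambda>y. exp (\<i> * of_int k * of_real y)) has_integral (if k = 0 then 2 * of_real pi else 0)) {-pi..pi}"
proof (cases "k = 0")
  case True
  thus ?thesis using has_integral_const_real[of "1 :: complex" "-pi" pi] by (simp add: scaleR_conv_of_real)
next
  case False
  define F where "F y = exp (\<i> * of_int k * of_real y) / (\<i> * of_int k)" for y :: real
  have "((\<lambda>y. exp (\<i> * of_int k * of_real y)) has_integral (F pi - F (-pi))) {-pi..pi}"
  proof (rule fundamental_theorem_of_calculus)
    fix y :: real
    have "((\<lambda>y. exp (\<i> * of_int k * y) / (\<i> * of_int k)) has_field_derivative exp (\<i> * of_int k * of_real y)) (at (of_real y))"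
      using False by (auto intro!: derivative_eq_intros)
    from has_vector_derivative_real_field[OF this]
    show "(F has_vector_derivative exp (\<i> * of_int k * of_real y)) (at y within {-pi..pi})"
      unfolding F_def by (rule has_vector_derivative_at_within)
  qed auto
  also have "F pi - F (-pi) = 0"
  proof -
    have "exp (\<i> * of_int k * of_real pi) = exp (\<i> * of_int k * of_real (-pi) + of_int (2 * k) * (of_real pi * \<i>))"
      by (simp add: algebra_simps)
    also have "\<dots> = exp (\<i> * of_int k * of_real (-pi))"
      by (subst exp_eq) (auto intro!: exI[of _ k] simp: algebra_simps)
    finally show ?thesis by (simp add: F_def)
  qed
  finally show ?thesis using False by simp
qed

text \<open>The power series converges uniformly on the line Re z = x, so it may be integrated
  termwise, and orthogonality keeps only the term of index \<open>N\<close>.\<close>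

lemma fps_nth_has_integral:
  fixes F :: "complex fps"
  assumes rad: "fps_conv_radius F \<ge> 1" and x: "x > 0"
  shows "((\<lambda>y. eval_fps F (exp (- Complex x y)) * exp (of_nat N * Complex x y)) has_integral (2 * of_real pi * fps_nth F N)) {-pi..pi}"
proof -
  define t where "t k y = fps_nth F k * exp (- Complex x y) ^ k * exp (of_nat N * Complex x y)" for k y
  define f where "f n y = (\<Sum>k<n. t k y)" for n y
  have t_int: "(t k has_integral (if k = N then 2 * of_real pi * fps_nth F N else 0)) {-pi..pi}" for k
  proof -
    have "t k = (\<lambda>y. (fps_nth F k * exp (of_real ((real N - real k) * x))) * exp (\<i> * of_int (int N - int k) * of_real y))"
      unfolding t_def exp_of_nat_mult [symmetric] mult.assoc exp_add [symmetric]
      by (simp add: Complex_eq algebra_simps)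
    moreover have "((\<lambda>y. (fps_nth F k * exp (of_real ((real N - real k) * x))) * exp (\<i> * of_int (int N - int k) * of_real y)) has_integral
        (fps_nth F k * exp (of_real ((real N - real k) * x))) * (if int N - int k = 0 then 2 * of_real pi else 0)) {-pi..pi}"
      by (intro has_integral_mult_right has_integral_cis)
    ultimately show ?thesis by (cases "k = N") (simp_all add: mult.commute)
  qed
  have f_int: "(f n has_integral (\<Sum>k<n. if k = N then 2 * of_real pi * fps_nth F N else 0)) {-pi..pi}" for n
    unfolding f_def by (intro has_integral_sum t_int) auto
  have q: "norm (exp (- of_real x) :: complex) < fps_conv_radius F"
    using rad x by (intro order.strict_trans2[OF _ rad]) auto
  have lim: "uniform_limit {-pi..pi} f (\<lambda>y. \<Sum>k. t k y) sequentially"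
    unfolding f_def
  proof (rule Weierstrass_m_test)
    show "norm (t k y) \<le> norm (fps_nth F k * exp (- of_real x) ^ k) * exp (real N * x)" for k y
      by (simp add: t_def norm_mult norm_power)
    have "summable (\<lambda>k. norm (fps_nth F k * exp (- of_real x) ^ k))"
      using q unfolding fps_conv_radius_def by (rule abs_summable_in_conv_radius)
    thus "summable (\<lambda>k. norm (fps_nth F k * exp (- of_real x) ^ k) * exp (real N * x))"
      by (rule summable_mult2)
  qed
  have sum_t: "(\<Sum>k. t k y) = eval_fps F (exp (- Complex x y)) * exp (of_nat N * Complex x y)" for y
  proof -
    have "norm (exp (- Complex x y)) < fps_conv_radius F"
      using rad x by (intro order.strict_trans2[OF _ rad]) auto
    hence "summable (\<lambda>k. fps_nth F k * exp (- Complex x y) ^ k)"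
      unfolding fps_conv_radius_def by (rule summable_in_conv_radius)
    thus ?thesis unfolding t_def eval_fps_def by (rule suminf_mult2 [symmetric])
  qed
  obtain I J where IJ: "\<And>n. (f n has_integral I n) {-pi..pi}" "((\<lambda>y. \<Sum>k. t k y) has_integral J) {-pi..pi}" "I \<longlonglongrightarrow> J"
  proof (rule uniform_limit_integral[OF lim])
    show "continuous_on {-pi..pi} (f n)" for n
      unfolding f_def t_def Complex_eq by (intro continuous_intros)
  qed auto
  have I: "I n = (\<Sum>k<n. if k = N then 2 * of_real pi * fps_nth F N else 0)" for n
    using IJ(1) f_int by (rule has_integral_unique)
  have "eventually (\<lambda>n. I n = 2 * of_real pi * fps_nth F N) sequentially"
    using eventually_gt_at_top[of N] by eventually_elim (simp add: I)
  hence "I \<longlonglongrightarrow> 2 * of_real pi * fps_nth F N" by (rule tendsto_eventually)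
  hence "J = 2 * of_real pi * fps_nth F N" using IJ(3) LIMSEQ_unique by blast
  thus ?thesis using IJ(2) unfolding sum_t by simp
qed

lemma Im_lerr_real:
  assumes "x > 0"
  shows "Im (lerr (of_real x)) = 0"
proof -
  have "(\<lambda>k. Im (lambert_term k (of_real x))) sums Im (lambert (of_real x))"
    using assms by (intro sums_Im lambert_sums) auto
  moreover have "lambert_term k (of_real x) =
      (of_real (exp (- (real (Suc k) * x)) / (1 - exp (- (real (Suc k) * x))) / real (Suc k)) :: complex)" for k
    by (simp only: of_real_divide of_real_diff of_real_1 exp_of_real [symmetric] of_real_minus of_real_mult of_real_of_nat_eq)
  ultimately have "(\<lambda>k. 0) sums Im (lambert (of_real x))" by (simp only: Im_complex_of_real)
  thus ?thesis unfolding Im_lerr_lambert_real using sums_unique2[OF sums_zero] by metis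
qed

section \<open>Size of the partition generating function on the two arcs\<close>

lemma norm_exp_minus_one_le:
  fixes w :: complex
  shows "norm (exp w - 1) \<le> norm w * exp (norm w)"
  using Taylor_exp_field[of w 0] by (simp add: mult.commute)

abbreviation peak :: "complex \<Rightarrow> complex" where
  "peak z \<equiv> exp (of_real (pi\<^sup>2) / (6 * z))"

lemma sqrt_div_2pi_le: "x > 0 \<Longrightarrow> sqrt (x / (2 * pi)) \<le> sqrt x"
  using divide_left_mono[of 1 "2 * pi" x] pi_gt3 by simp

text \<open>Going first to the real axis and then to the known real asymptotics, the exponent is
  wrong by at most d = 24 x + 20 |y|/x \<le> 44, whence the relative error d exp(44). The square
  root is taken at x and not at x + i y; the term |y|/x pays for that as well.\<close>

lemma exp_lambert_major:
  "\<exists>B x0. B \<ge> 0 \<and> x0 > 0 \<and> (\<forall>x y. 0 < x \<and> x < x0 \<and> \<bar>y\<bar> \<le> x \<longrightarrow>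
     norm (exp (lambert (Complex x y)) - of_real (sqrt (x / (2 * pi))) * peak (Complex x y))
      \<le> B * sqrt x * norm (peak (Complex x y)) * (x + \<bar>y\<bar> / x))"
proof -
  obtain x0 where x0: "x0 > 0" "\<And>x. 0 < x \<Longrightarrow> x < x0 \<Longrightarrow> \<bar>Re (lerr (of_real x)) - ln (x / (2 * pi)) / 2\<bar> \<le> 24 * x"
    using lerr_real_asymp by blast
  have "norm (exp (lambert (Complex x y)) - of_real (sqrt (x / (2 * pi))) * peak (Complex x y))
      \<le> (24 * exp 44) * sqrt x * norm (peak (Complex x y)) * (x + \<bar>y\<bar> / x)"
    if x: "0 < x" "x < min x0 1" and y: "\<bar>y\<bar> \<le> x" for x y
  proof -
    define z where "z = Complex x y"
    define d where "d = lerr z - of_real (ln (x / (2 * pi)) / 2)"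
    have "lerr (of_real x) = of_real (Re (lerr (of_real x)))"
      using Im_lerr_real[OF x(1)] by (simp add: complex_eq_iff)
    hence "norm (lerr (of_real x) - of_real (ln (x / (2 * pi)) / 2)) \<le> 24 * x"
      using x0(2)[of x] x by (metis of_real_diff norm_of_real min_less_iff_conj)
    moreover have "norm (lerr z - lerr (of_real x)) \<le> 20 * \<bar>y\<bar> / x"
      using norm_lerr_diff_le[of z] x y by (simp add: z_def)
    ultimately have "norm d \<le> 24 * x + 20 * (\<bar>y\<bar> / x)"
      using norm_triangle_ineq[of "lerr z - lerr (of_real x)" "lerr (of_real x) - of_real (ln (x / (2 * pi)) / 2)"]
      by (simp add: d_def)
    moreover have yx: "0 \<le> \<bar>y\<bar> / x" "\<bar>y\<bar> / x \<le> 1" using x y by (auto simp: divide_le_eq)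
    moreover have "x < 1" using x by simp
    moreover have "24 * x + 20 * v \<le> 24 * (x + v)" "24 * x + 20 * v \<le> 44" if "0 \<le> v" "v \<le> 1" "x < 1" for v
      using that by simp_all
    ultimately have d: "norm d \<le> 24 * (x + \<bar>y\<bar> / x)" "norm d \<le> 44" by (blast intro: order_trans)+
    have "exp (lambert z) = peak z * (exp (of_real (ln (x / (2 * pi)) / 2)) * exp d)"
      by (simp add: exp_add [symmetric] d_def lerr_def)
    also have "exp (of_real (ln (x / (2 * pi)) / 2)) = (of_real (sqrt (x / (2 * pi))) :: complex)"
    proof -
      have "exp (ln (x / (2 * pi)) / 2) = sqrt (x / (2 * pi))"
        using x by (simp add: ln_sqrt [symmetric])
      thus ?thesis by (metis exp_of_real)
    qed
    finally have "exp (lambert z) - of_real (sqrt (x / (2 * pi))) * peak z =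
        of_real (sqrt (x / (2 * pi))) * peak z * (exp d - 1)"
      by (simp add: algebra_simps)
    also have "norm \<dots> = sqrt (x / (2 * pi)) * norm (peak z) * norm (exp d - 1)"
      using x by (simp only: norm_mult norm_of_real) simp
    also have "\<dots> \<le> sqrt x * norm (peak z) * (24 * (x + \<bar>y\<bar> / x) * exp 44)"
    proof (intro mult_mono)
      show "sqrt (x / (2 * pi)) \<le> sqrt x" using x(1) by (rule sqrt_div_2pi_le)
      have "norm d * exp (norm d) \<le> 24 * (x + \<bar>y\<bar> / x) * exp 44"
        using d x yx by (intro mult_mono) auto
      thus "norm (exp d - 1) \<le> 24 * (x + \<bar>y\<bar> / x) * exp 44"
        using norm_exp_minus_one_le[of d] by linarith
    qed (use x in auto)
    finally show ?thesis by (simp only: z_def mult_ac)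
  qed
  thus ?thesis using x0(1) by (intro exI[of _ "24 * exp 44"] exI[of _ "min x0 1"]) auto
qed

text \<open>All terms but the first are compared by the triangle inequality. The saving for non-real
  z comes from the first term alone, where |1 - exp(-z)| exceeds 1 - exp(-Re z).\<close>

lemma Re_lambert_gap:
  assumes "Re z > 0"
  shows "Re (lambert z) \<le> Re (lambert (of_real (Re z))) - (exp (- Re z) / (1 - exp (- Re z)) - exp (- Re z) / norm (1 - exp (- z)))"
proof -
  define x where "x = Re z"
  define T where "T z k = lambert_term k z" for z :: complex and k
  define r where "r k = exp (- (real (Suc k) * x)) / (1 - exp (- (real (Suc k) * x))) / real (Suc k)" for k
  have x: "x > 0" using assms by (simp add: x_def)
  have "T (of_real x) = (\<lambda>k. of_real (r k))"
    unfolding T_def r_def by (simp only: of_real_divide of_real_diff of_real_1 exp_of_real [symmetric] of_real_minus of_real_mult of_real_of_nat_eq)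
  moreover have "(T (of_real x)) sums lambert (of_real x)"
    unfolding T_def using x by (intro lambert_sums) auto
  ultimately have "(\<lambda>k. of_real (r k)) sums lambert (of_real x)" by simp
  hence rs: "r sums Re (lambert (of_real x))" using sums_Re by fastforce
  have le: "norm (T z k) \<le> r k" for k
  proof -
    have n: "norm (exp (- (of_nat (Suc k) * z))) = exp (- (real (Suc k) * x))"
      by (simp add: x_def)
    have "0 < real (Suc k) * x" using x by simp
    hence "exp (- (real (Suc k) * x)) < 1" by simp
    moreover have "1 - exp (- (real (Suc k) * x)) \<le> norm (1 - exp (- (of_nat (Suc k) * z)))"
      using norm_triangle_ineq2[of 1 "exp (- (of_nat (Suc k) * z))"] n by (simp del: of_nat_Suc)
    ultimately show ?thesis unfolding T_def r_def norm_divide norm_of_nat n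
      by (intro divide_right_mono frac_le order_refl) (simp_all del: of_nat_Suc)
  qed
  have Ts: "T z sums lambert z" unfolding T_def using assms by (rule lambert_sums)
  have "(\<lambda>k. T z (Suc k)) sums (lambert z - T z 0)" using Ts by (subst sums_Suc_iff) simp
  moreover have rs': "(\<lambda>k. r (Suc k)) sums (Re (lambert (of_real x)) - r 0)" using rs by (subst sums_Suc_iff) simp
  moreover have "norm (\<Sum>k. T z (Suc k)) \<le> (\<Sum>k. r (Suc k))"
    using le sums_summable[OF rs'] by (intro norm_suminf_le) auto
  ultimately have "norm (lambert z - T z 0) \<le> Re (lambert (of_real x)) - r 0" by (simp add: sums_iff)
  hence "Re (lambert z) - Re (T z 0) \<le> Re (lambert (of_real x)) - r 0"
    using complex_Re_le_cmod[of "lambert z - T z 0"] by simp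
  moreover have "Re (T z 0) \<le> norm (T z 0)" by (rule complex_Re_le_cmod)
  moreover have "norm (T z 0) = exp (- x) / norm (1 - exp (- z))" by (simp add: T_def norm_divide x_def)
  moreover have "r 0 = exp (- x) / (1 - exp (- x))" by (simp add: r_def)
  ultimately show ?thesis by (simp add: x_def)
qed

text \<open>The squared modulus is (1 - e)^2 + 2 e (1 - cos y) with e = exp(-x), and outside the
  cone cos y \<le> cos x. The last hypothesis, true for small x because the two sides behave like
  x^2/2 and x^2, makes this at least 3/2 (1 - e)^2, more than (6/5)^2 (1 - e)^2.\<close>

lemma norm_one_minus_exp_ge:
  assumes "0 < x" "x \<le> \<bar>y\<bar>" "\<bar>y\<bar> \<le> pi" "(1 - exp (-x))\<^sup>2 / 2 \<le> 2 * exp (-x) * (1 - cos x)"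
  shows "6 / 5 * (1 - exp (-x)) \<le> norm (1 - exp (- Complex x y))"
proof (rule power2_le_imp_le)
  have "cos \<bar>y\<bar> \<le> cos x" using assms by (intro cos_monotone_0_pi_le) auto
  hence c: "cos y \<le> cos x" by (simp add: abs_if split: if_splits)
  have "(1 - e * c)\<^sup>2 + (e * s)\<^sup>2 = (1 - e)\<^sup>2 + 2 * e * (1 - c)" if "s\<^sup>2 + c\<^sup>2 = 1" for e c s :: real
  proof -
    have "(1 - e * c)\<^sup>2 + (e * s)\<^sup>2 = 1 - 2 * e * c + e\<^sup>2 * (s\<^sup>2 + c\<^sup>2)"
      by (simp add: power2_eq_square algebra_simps)
    thus ?thesis unfolding that by (simp add: power2_eq_square algebra_simps)
  qed
  hence "(norm (1 - exp (- Complex x y)))\<^sup>2 = (1 - exp (-x))\<^sup>2 + 2 * exp (-x) * (1 - cos y)"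
    by (simp add: cmod_power2 Re_exp Im_exp)
  moreover have "2 * exp (-x) * (1 - cos x) \<le> 2 * exp (-x) * (1 - cos y)"
    using c by (intro mult_left_mono) auto
  moreover have "(6 / 5 * (1 - exp (-x)))\<^sup>2 = 36 / 25 * (1 - exp (-x))\<^sup>2"
    by (simp only: power_mult_distrib) (simp add: power2_eq_square)
  ultimately show "(6 / 5 * (1 - exp (-x)))\<^sup>2 \<le> (norm (1 - exp (- Complex x y)))\<^sup>2"
    using assms(4) zero_le_power2[of "1 - exp (-x)"] by linarith
qed simp

text \<open>The factor 6/5 saves one sixth of e/(1 - e), with e = exp(-x). That quotient is at least
  6/(10 x) for small x, which gives the saving 1/(10 x) in the exponent. The factor of size x^(1/2)
  on the real axis is simply bounded by 1.\<close>

lemma exp_lambert_minor: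
  "\<exists>B x0. B \<ge> 0 \<and> x0 > 0 \<and> (\<forall>x y. 0 < x \<and> x < x0 \<and> x \<le> \<bar>y\<bar> \<and> \<bar>y\<bar> \<le> pi \<longrightarrow>
     norm (exp (lambert (Complex x y))) \<le> B * exp (pi\<^sup>2 / (6 * x)) * exp (- 1 / (10 * x)))"
proof -
  obtain x0 where x0: "x0 > 0" "\<And>x. 0 < x \<Longrightarrow> x < x0 \<Longrightarrow> \<bar>Re (lerr (of_real x)) - ln (x / (2 * pi)) / 2\<bar> \<le> 24 * x"
    using lerr_real_asymp by blast
  have "eventually (\<lambda>x. (1 - exp (-x))\<^sup>2 / 2 \<le> 2 * exp (-x) * (1 - cos x) \<and> 6 / (10 * x) \<le> exp (-x) / (1 - exp (-x))) (at_right (0::real))"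
    by (intro eventually_conj; real_asymp)
  then obtain x1 :: real where x1: "x1 > 0" "\<And>x. 0 < x \<Longrightarrow> x < x1 \<Longrightarrow>
      (1 - exp (-x))\<^sup>2 / 2 \<le> 2 * exp (-x) * (1 - cos x)" "\<And>x. 0 < x \<Longrightarrow> x < x1 \<Longrightarrow> 6 / (10 * x) \<le> exp (-x) / (1 - exp (-x))"
    unfolding eventually_at_right_field by blast
  have "norm (exp (lambert (Complex x y))) \<le> exp 24 * exp (pi\<^sup>2 / (6 * x)) * exp (- 1 / (10 * x))"
    if x: "0 < x" "x < min (min x0 x1) 1" and y: "x \<le> \<bar>y\<bar>" "\<bar>y\<bar> \<le> pi" for x y
  proof -
    define z where "z = Complex x y"
    define e where "e = exp (-x)"
    have "Re (lerr (of_real x)) = Re (lambert (of_real x)) - pi\<^sup>2 / (6 * x)" by (rule Re_lerr_real)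
    moreover have "ln (x / (2 * pi)) \<le> 0" using x pi_gt3 by (subst ln_le_zero_iff) auto
    ultimately have 1: "Re (lambert (of_real x)) \<le> pi\<^sup>2 / (6 * x) + 24"
      using x0(2)[of x] x by linarith
    have e: "0 < e" "0 < 1 - e" using x by (auto simp: e_def)
    have "6 / 5 * (1 - e) \<le> norm (1 - exp (- z))"
      unfolding z_def e_def using x y x1 by (intro norm_one_minus_exp_ge) auto
    hence "e / norm (1 - exp (- z)) \<le> e / (6 / 5 * (1 - e))"
      using e by (intro frac_le) auto
    also have "\<dots> = 5 / 6 * (e / (1 - e))" by simp
    finally have "e / norm (1 - exp (- z)) \<le> 5 / 6 * (e / (1 - e))" .
    moreover have "a / 6 \<le> a - w" if "w \<le> 5 / 6 * a" for a w :: real using that by simp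
    ultimately have "e / (1 - e) / 6 \<le> e / (1 - e) - e / norm (1 - exp (- z))" by blast
    moreover have "6 / (10 * x) \<le> e / (1 - e)" using x1(3)[of x] x by (simp add: e_def)
    hence "6 / (10 * x) / 6 \<le> e / (1 - e) / 6" by (rule divide_right_mono) simp
    moreover have "6 / (10 * x) / 6 = 1 / (10 * x)" by simp
    ultimately have "Re (lambert z) \<le> Re (lambert (of_real x)) - 1 / (10 * x)"
      using Re_lambert_gap[of z] x by (simp add: z_def e_def)
    with 1 have "Re (lambert z) \<le> 24 + pi\<^sup>2 / (6 * x) + (- 1 / (10 * x))" by simp
    hence "exp (Re (lambert z)) \<le> exp (24 + pi\<^sup>2 / (6 * x) + (- 1 / (10 * x)))" by simp
    thus ?thesis by (simp only: exp_add norm_exp_eq_Re z_def)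
  qed
  thus ?thesis using x0(1) x1(1) by (intro exI[of _ "exp 24"] exI[of _ "min (min x0 x1) 1"]) auto
qed

subsection \<open>Saddle point estimate\<close>

lemma has_integral_gaussian:
  assumes "b > 0"
  shows "((\<lambda>y. exp (- b * y\<^sup>2)) has_integral sqrt (pi / b)) UNIV"
proof -
  define \<sigma> where "\<sigma> = 1 / sqrt (2 * b)"
  have s: "\<sigma>\<^sup>2 = 1 / (2 * b)" "\<sigma> > 0" using assms by (auto simp: \<sigma>_def power_divide)
  have "integrable lborel (normal_density 0 \<sigma>)" using s(2) by simp
  from has_integral_integral_lborel[OF this] have "(normal_density 0 \<sigma> has_integral 1) UNIV"
    using s(2) by simp
  hence "((\<lambda>y. sqrt (pi / b) * normal_density 0 \<sigma> y) has_integral sqrt (pi / b) * 1) UNIV"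
    by (rule has_integral_mult_right)
  moreover have "sqrt (pi / b) * normal_density 0 \<sigma> y = exp (- b * y\<^sup>2)" for y
    using assms by (simp add: normal_density_def s)
  ultimately show ?thesis by simp
qed

lemma norm_exp_diff_le:
  fixes a b :: complex
  assumes "Re a \<le> M" "Re b \<le> M"
  shows "norm (exp a - exp b) \<le> exp M * norm (a - b)"
proof (rule field_differentiable_bound[where S = "closed_segment a b" and f' = exp])
  fix w assume "w \<in> closed_segment a b"
  moreover have "convex {w. Re w \<le> M}" by (rule convex_halfspace_Re_le)
  hence "closed_segment a b \<subseteq> {w. Re w \<le> M}"
    using assms by (intro closed_segment_subset) auto
  ultimately show "norm (exp w) \<le> exp M" by auto
qed (auto intro: DERIV_subset[OF DERIV_exp])

text \<open>The geometric series gives s = 2 - v^2 + i v^3/(1 + i v) exactly. For the real part,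
  half of the quadratic decay is given away so that the bound holds for all |v| \<le> 1.\<close>

lemma saddle_expansion:
  fixes v :: real
  assumes "\<bar>v\<bar> \<le> 1"
  defines "s \<equiv> 1 / Complex 1 v + Complex 1 v"
  shows "Re s \<le> 2 - v\<^sup>2 / 2" "norm (s - of_real (2 - v\<^sup>2)) \<le> \<bar>v\<bar> ^ 3"
proof -
  have v2: "v\<^sup>2 \<le> 1" using assms(1) by (simp add: abs_square_le_1)
  have pos: "1 + v\<^sup>2 > 0" by (rule add_pos_nonneg) auto
  have "Re s = 1 / (1 + v\<^sup>2) + 1" by (simp add: s_def Re_divide)
  moreover have "1 / (1 + v\<^sup>2) \<le> 1 - v\<^sup>2 / 2"
  proof -
    have "(1 - v\<^sup>2 / 2) * (1 + v\<^sup>2) = 1 + v\<^sup>2 * (1 - v\<^sup>2) / 2"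
      by (simp add: field_simps)
    moreover have "v\<^sup>2 * (1 - v\<^sup>2) \<ge> 0" using v2 by (intro mult_nonneg_nonneg) auto
    ultimately have "1 \<le> (1 - v\<^sup>2 / 2) * (1 + v\<^sup>2)" by simp
    thus ?thesis using pos by (simp add: divide_le_eq)
  qed
  ultimately show "Re s \<le> 2 - v\<^sup>2 / 2" by simp
  have nz: "Complex 1 v \<noteq> 0" by (simp add: complex_eq_iff)
  have "(s - of_real (2 - v\<^sup>2)) * Complex 1 v = \<i> * of_real (v ^ 3)"
  proof -
    have "(s - of_real (2 - v\<^sup>2)) * Complex 1 v = 1 + (Complex 1 v - of_real (2 - v\<^sup>2)) * Complex 1 v"
      using nz by (simp add: s_def algebra_simps)
    also have "\<dots> = \<i> * of_real (v ^ 3)"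
      by (simp add: complex_eq_iff power2_eq_square power3_eq_cube algebra_simps)
    finally show ?thesis .
  qed
  hence "norm (s - of_real (2 - v\<^sup>2)) * norm (Complex 1 v) = \<bar>v\<bar> ^ 3"
    by (metis norm_mult norm_ii norm_of_real power_abs mult_1)
  moreover have "norm (Complex 1 v) \<ge> 1" using complex_Re_le_cmod[of "Complex 1 v"] by simp
  hence "norm (s - of_real (2 - v\<^sup>2)) * 1 \<le> norm (s - of_real (2 - v\<^sup>2)) * norm (Complex 1 v)"
    by (intro mult_left_mono) auto
  ultimately show "norm (s - of_real (2 - v\<^sup>2)) \<le> \<bar>v\<bar> ^ 3" by simp
qed

text \<open>Half of the Gaussian decay is spent on the power of s.\<close>

lemma power_times_gaussian_le:
  fixes s :: real
  assumes "s \<ge> 0" "k \<le> 8"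
  shows "s ^ k * exp (- (s\<^sup>2) / 2) \<le> 24 * 2 ^ k * exp (- (s\<^sup>2) / 4)"
proof -
  have "(s / 2) ^ k * exp (- ((s / 2)\<^sup>2)) \<le> 24"
    using assms by (intro power_times_exp_neg_sq_le) auto
  hence "s ^ k * exp (- (s\<^sup>2) / 4) \<le> 24 * 2 ^ k" by (simp add: power_divide field_simps)
  hence "s ^ k * exp (- (s\<^sup>2) / 4) * exp (- (s\<^sup>2) / 4) \<le> 24 * 2 ^ k * exp (- (s\<^sup>2) / 4)"
    by (intro mult_right_mono) auto
  thus ?thesis by (simp add: mult.assoc flip: exp_add)
qed

text \<open>The analytic input of the saddle point argument for an arbitrary F. The error allowed in
  \<open>major\<close> has the size |y|/x has under the Gaussian, and the bound in
  \<open>minor\<close> is what the final error x^(5/2) exp(2 A) leaves after the factor exp(N x) =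
  exp(A).\<close>

locale circle_method =
  fixes F :: "complex \<Rightarrow> complex" and D :: "nat \<Rightarrow> complex" and K B x0 :: real
  assumes coeff: "\<And>N x. x > 0 \<Longrightarrow>
      ((\<lambda>y. F (Complex x y) * exp (of_nat N * Complex x y)) has_integral (2 * of_real pi * D N)) {-pi..pi}"
    and x0: "0 < x0" "x0 \<le> 1" and K: "K \<ge> 0" and B: "B \<ge> 0"
    and major: "\<And>x y. 0 < x \<Longrightarrow> x < x0 \<Longrightarrow> \<bar>y\<bar> \<le> x \<Longrightarrow>
      norm (F (Complex x y) - of_real (K * sqrt x) * peak (Complex x y))
       \<le> B * sqrt x * norm (peak (Complex x y)) * (sqrt x + \<bar>y\<bar> / x)"
    and minor: "\<And>x y. 0 < x \<Longrightarrow> x < x0 \<Longrightarrow> x \<le> \<bar>y\<bar> \<Longrightarrow> \<bar>y\<bar> \<le> pi \<Longrightarrow>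
      norm (F (Complex x y)) \<le> B * (x\<^sup>2 * sqrt x) * exp (pi\<^sup>2 / (6 * x))"
begin

context
  fixes x A :: real and N :: nat
  assumes x: "0 < x" "x < x0" and A: "A = pi\<^sup>2 / (6 * x)" and N: "real N = A / x"
begin

text \<open>The relation N = A/x says that x is the saddle point of pi^2/(6 z) + N z. Extension by 0
  to the real line lets the integrand be compared with a complete Gaussian, so that tails are
  covered by one pointwise bound.\<close>

definition integrand :: "real \<Rightarrow> complex" where
  "integrand y = (if y \<in> {-pi..pi} then F (Complex x y) * exp (of_nat N * Complex x y) else 0)"

definition main :: "real \<Rightarrow> complex" where
  "main y = of_real (K * sqrt x * exp (2 * A) * exp (- (A / x\<^sup>2) * y\<^sup>2))"

text \<open>A quarter of the exponent of \<open>main\<close> survives: one half is lost in the bound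
  for the real part at the saddle, and half of the rest absorbs powers of the rescaled
  variable.\<close>

abbreviation envelope :: "real \<Rightarrow> real" where
  "envelope y \<equiv> 3000 * (B + K) * x * exp (2 * A) * exp (- (A / x\<^sup>2 / 4) * y\<^sup>2)"

definition bound :: "real \<Rightarrow> real" where
  "bound y = envelope y +
     (if y \<in> {-pi..pi} then B * (x\<^sup>2 * sqrt x) * exp (2 * A) else 0)"

lemma A_pos: "A > 0" and inverse_sqrt_A: "1 / sqrt A \<le> sqrt x"
proof -
  have pi2: "pi\<^sup>2 \<ge> 6" using power_mono[of 3 pi 2] pi_gt3 by simp
  show "A > 0" using x by (simp add: A)
  have "1 / A = 6 / pi\<^sup>2 * x" by (simp add: A)
  also have "\<dots> \<le> 1 * x" using pi2 x by (intro mult_right_mono) auto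
  finally have "sqrt (1 / A) \<le> sqrt x" by simp
  thus "1 / sqrt A \<le> sqrt x" by (simp add: real_sqrt_divide)
qed

text \<open>With v = y/x and s = A^(1/2) |v| the exponent is 2 A - s^2 up to A |v|^3. Since A^(-1/2)
  \<le> x^(1/2), both error sources carry a factor x^(1/2): |v| \<le> x^(1/2) s and A |v|^3 \<le>
  x^(1/2) s^3. Together with the x^(1/2) in front this is the factor x of the envelope.\<close>

lemma major_bound:
  assumes y: "\<bar>y\<bar> \<le> x"
  shows "norm (integrand y - main y) \<le> envelope y"
proof -
  define v where "v = y / x"
  define s where "s = sqrt A * \<bar>v\<bar>"
  define z where "z = Complex x y"
  define S where "S = 1 / Complex 1 v + Complex 1 v"
  define E where "E = peak z"
  define Q where "Q = exp (of_nat N * z)"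
  have v: "\<bar>v\<bar> \<le> 1" using x y by (simp add: v_def divide_le_eq)
  have s: "s \<ge> 0" "s\<^sup>2 = A * v\<^sup>2" using A_pos by (auto simp: s_def power_mult_distrib)
  have vs: "\<bar>v\<bar> \<le> sqrt x * s"
  proof -
    have "\<bar>v\<bar> = 1 / sqrt A * s" using A_pos by (simp add: s_def)
    also have "\<dots> \<le> sqrt x * s" using s inverse_sqrt_A by (intro mult_right_mono)
    finally show ?thesis .
  qed
  have v3: "A * \<bar>v\<bar> ^ 3 \<le> sqrt x * s ^ 3"
  proof -
    have "A * \<bar>v\<bar> ^ 3 = A * v\<^sup>2 * \<bar>v\<bar>" by (simp add: power3_eq_cube power2_eq_square)
    also have "\<dots> = s\<^sup>2 * \<bar>v\<bar>" by (simp only: s)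
    also have "\<dots> \<le> s\<^sup>2 * (sqrt x * s)" using vs by (intro mult_left_mono) auto
    finally show ?thesis by (simp add: power3_eq_cube power2_eq_square mult_ac)
  qed
  have yv: "y\<^sup>2 / x\<^sup>2 = v\<^sup>2" by (simp add: v_def power_divide)
  have z: "z = of_real x * Complex 1 v" using x by (simp add: z_def v_def complex_eq_iff)
  have "of_real (pi\<^sup>2) / (6 * z) + of_nat N * z = of_real A * S"
  proof -
    have "of_nat N = (of_real (A / x) :: complex)" using N by (metis of_real_of_nat_eq)
    hence "of_nat N * z = of_real A * Complex 1 v" using x by (simp add: z)
    moreover have "of_real (pi\<^sup>2) / (6 * z) = of_real A * (1 / Complex 1 v)"
      using x by (simp add: z A)
    ultimately show ?thesis by (simp only: S_def distrib_left)
  qed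
  hence EQ: "E * Q = exp (of_real A * S)" by (simp add: E_def Q_def flip: exp_add)
  have "A * Re S \<le> A * (2 - v\<^sup>2 / 2)"
    using saddle_expansion(1)[OF v] A_pos by (intro mult_left_mono) (auto simp: S_def)
  hence ReS: "Re (of_real A * S) \<le> 2 * A - s\<^sup>2 / 2" by (simp add: s algebra_simps)
  hence nEQ: "norm (E * Q) \<le> exp (2 * A - s\<^sup>2 / 2)" unfolding EQ norm_exp_eq_Re by simp
  have "norm (E * Q - exp (of_real (2 * A - s\<^sup>2))) \<le> exp (2 * A - s\<^sup>2 / 2) * norm (of_real A * S - of_real (2 * A - s\<^sup>2))"
    unfolding EQ using ReS by (intro norm_exp_diff_le) auto
  also have "of_real A * S - of_real (2 * A - s\<^sup>2) = of_real A * (S - of_real (2 - v\<^sup>2))"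
    by (simp add: s algebra_simps)
  also have "norm \<dots> \<le> A * \<bar>v\<bar> ^ 3"
    using saddle_expansion(2)[OF v] A_pos unfolding norm_mult by (simp add: S_def mult_left_mono)
  finally have diff: "norm (E * Q - exp (of_real (2 * A - s\<^sup>2))) \<le> exp (2 * A - s\<^sup>2 / 2) * (sqrt x * s ^ 3)"
    using v3 by (auto intro: order_trans mult_left_mono)
  have ypi: "y \<in> {-pi..pi}" using y x x0 pi_gt3 by auto
  have main_eq: "main y = of_real (K * sqrt x) * exp (of_real (2 * A - s\<^sup>2))"
  proof -
    have "- (A / x\<^sup>2) * y\<^sup>2 = - s\<^sup>2" using yv by (simp add: s flip: yv)
    hence "exp (2 * A) * exp (- (A / x\<^sup>2) * y\<^sup>2) = exp (2 * A - s\<^sup>2)" by (simp flip: exp_add)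
    hence "K * sqrt x * exp (2 * A) * exp (- (A / x\<^sup>2) * y\<^sup>2) = K * sqrt x * exp (2 * A - s\<^sup>2)"
      by (simp only: mult.assoc)
    thus ?thesis unfolding main_def by (simp only: of_real_mult exp_of_real)
  qed
  have "integrand y - main y = (F z - of_real (K * sqrt x) * E) * Q + of_real (K * sqrt x) * (E * Q - exp (of_real (2 * A - s\<^sup>2)))"
    unfolding main_eq integrand_def using ypi by (simp add: z_def Q_def algebra_simps)
  also have "norm \<dots> \<le> (B * sqrt x * norm E * (sqrt x + \<bar>v\<bar>)) * norm Q + K * sqrt x * (exp (2 * A - s\<^sup>2 / 2) * (sqrt x * s ^ 3))"
  proof (rule order_trans[OF norm_triangle_ineq], rule add_mono)
    have "norm (F z - of_real (K * sqrt x) * E) \<le> B * sqrt x * norm E * (sqrt x + \<bar>v\<bar>)"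
      using major[OF x y] x by (simp add: E_def z_def v_def)
    thus "norm ((F z - of_real (K * sqrt x) * E) * Q) \<le> (B * sqrt x * norm E * (sqrt x + \<bar>v\<bar>)) * norm Q"
      unfolding norm_mult by (intro mult_right_mono) auto
    show "norm (of_real (K * sqrt x) * (E * Q - exp (of_real (2 * A - s\<^sup>2)))) \<le> K * sqrt x * (exp (2 * A - s\<^sup>2 / 2) * (sqrt x * s ^ 3))"
      unfolding norm_mult norm_of_real using diff K x by (simp add: mult_left_mono)
  qed
  also have "(B * sqrt x * norm E * (sqrt x + \<bar>v\<bar>)) * norm Q = B * sqrt x * (sqrt x + \<bar>v\<bar>) * norm (E * Q)"
    by (simp add: norm_mult)
  also have "B * sqrt x * (sqrt x + \<bar>v\<bar>) * norm (E * Q) \<le> B * sqrt x * (sqrt x * (1 + s)) * exp (2 * A - s\<^sup>2 / 2)"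
    using B x vs nEQ by (intro mult_mono) (auto simp: distrib_left)
  also have "B * sqrt x * (sqrt x * (1 + s)) * exp (2 * A - s\<^sup>2 / 2) + K * sqrt x * (exp (2 * A - s\<^sup>2 / 2) * (sqrt x * s ^ 3)) =
      (sqrt x * sqrt x) * exp (2 * A) * (B * (s ^ 0 * exp (- (s\<^sup>2) / 2) + s ^ 1 * exp (- (s\<^sup>2) / 2)) + K * (s ^ 3 * exp (- (s\<^sup>2) / 2)))"
  proof -
    have "exp (2 * A - s\<^sup>2 / 2) = exp (2 * A) * exp (- (s\<^sup>2) / 2)" by (simp flip: exp_add)
    thus ?thesis by (simp only:) (simp add: algebra_simps)
  qed
  also have "\<dots> \<le> (sqrt x * sqrt x) * exp (2 * A) * (B * (24 * 2 ^ 0 * exp (- (s\<^sup>2) / 4) + 24 * 2 ^ 1 * exp (- (s\<^sup>2) / 4)) + K * (24 * 2 ^ 3 * exp (- (s\<^sup>2) / 4)))"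
    using B K x s by (intro mult_left_mono add_mono power_times_gaussian_le) auto
  also have "\<dots> = x * exp (2 * A) * exp (- (s\<^sup>2) / 4) * (72 * B + 192 * K)"
    using x by (simp add: algebra_simps)
  also have "\<dots> \<le> x * exp (2 * A) * exp (- (s\<^sup>2) / 4) * (3000 * (B + K))"
    using B K x by (intro mult_left_mono) auto
  also have "- (s\<^sup>2) / 4 = - (A / x\<^sup>2 / 4) * y\<^sup>2" by (simp add: s flip: yv)
  finally show ?thesis by (simp add: mult_ac)
qed

text \<open>The integrand is controlled by the assumption \<open>minor\<close>. The Gaussian has
  exponent -w with w \<ge> A here; exp(-A/2) is at most 48 x^(1/2), which supplies the missing
  factor, and exp(-w/4) is kept for integration.\<close>

lemma minor_bound:
  assumes y: "\<bar>y\<bar> \<ge> x"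
  shows "norm (integrand y) \<le> (if y \<in> {-pi..pi} then B * (x\<^sup>2 * sqrt x) * exp (2 * A) else 0)"
    and "norm (main y) \<le> envelope y"
proof -
  have "norm (F (Complex x y) * exp (of_nat N * Complex x y)) \<le> B * (x\<^sup>2 * sqrt x) * exp (2 * A)" if "\<bar>y\<bar> \<le> pi"
  proof -
    have "norm (exp (of_nat N * Complex x y)) = exp A" using x N by simp
    moreover have "norm (F (Complex x y)) \<le> B * (x\<^sup>2 * sqrt x) * exp A"
      using minor[OF x y that] by (simp add: A)
    ultimately have "norm (F (Complex x y) * exp (of_nat N * Complex x y)) \<le> B * (x\<^sup>2 * sqrt x) * exp A * exp A"
      by (simp add: norm_mult mult_right_mono)
    moreover have "exp A * exp A = exp (2 * A)" by (simp flip: exp_add)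
    ultimately show ?thesis by (simp only: mult.assoc)
  qed
  thus "norm (integrand y) \<le> (if y \<in> {-pi..pi} then B * (x\<^sup>2 * sqrt x) * exp (2 * A) else 0)"
    by (auto simp: integrand_def abs_le_iff)
  define w where "w = A / x\<^sup>2 * y\<^sup>2"
  have "x\<^sup>2 \<le> y\<^sup>2" using y x abs_le_square_iff[of x y] by simp
  hence "1 \<le> y\<^sup>2 / x\<^sup>2" using x by simp
  hence "A * 1 \<le> A * (y\<^sup>2 / x\<^sup>2)" using A_pos by (intro mult_left_mono) auto
  hence w: "A \<le> w" by (simp add: w_def)
  define t where "t = sqrt (A / 2)"
  have t: "t > 0" "t\<^sup>2 = A / 2" using A_pos by (auto simp: t_def)
  have "t * exp (- (t\<^sup>2)) \<le> 24" using power_times_exp_neg_sq_le[of t 1] t(1) by simp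
  hence "exp (- (t\<^sup>2)) \<le> 24 / t" using t(1) by (simp add: le_divide_eq mult.commute)
  also have "24 / t = 24 * sqrt 2 * (1 / sqrt A)" by (simp add: t_def real_sqrt_divide)
  also have "\<dots> \<le> 24 * 2 * sqrt x"
    using inverse_sqrt_A A_pos sqrt2_less_2 by (intro mult_mono) auto
  finally have e: "exp (- (A / 2)) \<le> 48 * sqrt x" by (simp add: t)
  have "exp (- w) \<le> exp (- (A / 2)) * exp (- w / 4)" using w A_pos by (simp flip: exp_add)
  also have "\<dots> \<le> 48 * sqrt x * exp (- w / 4)" using e by (intro mult_right_mono) auto
  finally have ew: "exp (- w) \<le> 48 * sqrt x * exp (- w / 4)" .
  have "norm (main y) = K * sqrt x * exp (2 * A) * exp (- w)"
    unfolding main_def norm_of_real using K x by (simp add: w_def abs_mult)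
  also have "\<dots> \<le> K * sqrt x * exp (2 * A) * (48 * sqrt x * exp (- w / 4))"
    using ew K x by (intro mult_left_mono) auto
  also have "\<dots> = (48 * K) * (sqrt x * sqrt x) * exp (2 * A) * exp (- w / 4)" by (simp add: mult_ac)
  also have "\<dots> \<le> (3000 * (B + K)) * (sqrt x * sqrt x) * exp (2 * A) * exp (- w / 4)"
    using B K x by (intro mult_right_mono) auto
  finally show "norm (main y) \<le> envelope y"
    using x by (simp add: w_def)
qed

lemma pointwise_bound: "norm (integrand y - main y) \<le> bound y"
proof (cases "\<bar>y\<bar> \<le> x")
  case True
  have "0 \<le> B * (x\<^sup>2 * sqrt x) * exp (2 * A)" using B x by simp
  thus ?thesis using major_bound[OF True] unfolding bound_def by auto
next
  case False
  thus ?thesis using minor_bound[of y] norm_triangle_ineq4[of "integrand y" "main y"] unfolding bound_def by linarith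
qed

text \<open>Integrating the pointwise bound over the line: the envelope has width of order x/A^(1/2)
  \<le> x^(3/2), which together with its factor x gives x^(5/2). The 7 bounds 2 pi.\<close>

lemma coefficient_bound:
  "norm (2 * of_real pi * D N - of_real (K * sqrt x * exp (2 * A) * sqrt (pi / (A / x\<^sup>2)))) \<le>
     (12000 * (B + K) + 7 * B) * (x\<^sup>2 * sqrt x) * exp (2 * A)"
proof -
  have a: "A / x\<^sup>2 > 0" using A_pos x by simp
  have 1: "(integrand has_integral (2 * of_real pi * D N)) UNIV"
    unfolding integrand_def using coeff[OF x(1), of N] by (simp only: has_integral_restrict_UNIV)
  have 2: "(main has_integral of_real (K * sqrt x * exp (2 * A) * sqrt (pi / (A / x\<^sup>2)))) UNIV"
    unfolding main_def by (intro has_integral_of_real has_integral_mult_right has_integral_gaussian a)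
  define I where "I = 3000 * (B + K) * x * exp (2 * A) * sqrt (pi / (A / x\<^sup>2 / 4)) + 2 * pi * (B * (x\<^sup>2 * sqrt x) * exp (2 * A))"
  have 3: "(bound has_integral I) UNIV"
    unfolding bound_def I_def
  proof (intro has_integral_add has_integral_mult_right has_integral_gaussian)
    show "((\<lambda>y. if y \<in> {-pi..pi} then B * (x\<^sup>2 * sqrt x) * exp (2 * A) else 0) has_integral 2 * pi * (B * (x\<^sup>2 * sqrt x) * exp (2 * A))) UNIV"
      using has_integral_const_real[of "B * (x\<^sup>2 * sqrt x) * exp (2 * A)" "-pi" pi]
      by (simp only: has_integral_restrict_UNIV) simp
  qed (use a in auto)
  have "norm (integral UNIV (\<lambda>y. integrand y - main y)) \<le> integral UNIV bound"
    by (rule Henstock_Kurzweil_Integration.integral_norm_bound_integral)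
       (use 1 2 3 pointwise_bound in \<open>auto intro: has_integral_integrable integrable_diff\<close>)
  hence "norm (2 * of_real pi * D N - of_real (K * sqrt x * exp (2 * A) * sqrt (pi / (A / x\<^sup>2)))) \<le> I"
    using integral_unique[OF has_integral_diff[OF 1 2]] integral_unique[OF 3] by simp
  also have "I \<le> (12000 * (B + K) + 7 * B) * (x\<^sup>2 * sqrt x) * exp (2 * A)"
  proof -
    have "pi / (A / x\<^sup>2 / 4) = 4 * pi * x\<^sup>2 * (1 / A)" by simp
    hence "sqrt (pi / (A / x\<^sup>2 / 4)) = 2 * sqrt pi * x * (1 / sqrt A)"
      using x by (simp only: real_sqrt_mult real_sqrt_divide) simp
    also have "\<dots> \<le> 2 * 2 * x * sqrt x"
      using inverse_sqrt_A x A_pos pi_less_4 real_sqrt_le_mono[of pi 4] by (intro mult_mono) auto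
    finally have "3000 * (B + K) * x * exp (2 * A) * sqrt (pi / (A / x\<^sup>2 / 4)) \<le> 3000 * (B + K) * x * exp (2 * A) * (2 * 2 * x * sqrt x)"
      using B K x by (intro mult_left_mono) auto
    moreover have "2 * pi * (B * (x\<^sup>2 * sqrt x) * exp (2 * A)) \<le> 7 * (B * (x\<^sup>2 * sqrt x) * exp (2 * A))"
      using B x pi_approx by (intro mult_right_mono) auto
    ultimately show ?thesis unfolding I_def by (simp add: algebra_simps power2_eq_square)
  qed
  finally show ?thesis .
qed

end

end

text \<open>The saddle condition N = pi^2/(6 x^2) gives x = pi/(6 N)^(1/2) and 2 A = pi (2
  N/3)^(1/2); then x^(5/2) is a constant times N^(-5/4).\<close>

lemma (in circle_method) coefficient_asymp:
  "\<exists>M. eventually (\<lambda>N. norm (D N - of_real (K * sqrt (6 * pi) / (12 * real N) * exp (pi * sqrt (2 * real N / 3))))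
      \<le> M * (real N powr (-5/4) * exp (pi * sqrt (2 * real N / 3)))) sequentially"
    (is "\<exists>M. eventually (\<lambda>N. ?d N \<le> M * ?e N) _")
proof -
  define c where "c = pi / sqrt 6"
  define M where "M = 12000 * (B + K) + 7 * B"
  have M: "M \<ge> 0" using B K by (simp add: M_def)
  have "eventually (\<lambda>N. c / sqrt (real N) < x0) sequentially"
    using x0 by real_asymp
  hence "eventually (\<lambda>N. ?d N \<le> M * c powr (5/2) * ?e N) sequentially"
    using eventually_gt_at_top[of 0]
  proof eventually_elim
    case (elim N)
    define n where "n = real N"
    define x where "x = c / sqrt n"
    define A where "A = pi\<^sup>2 / (6 * x)"
    have n: "n > 0" using elim by (simp add: n_def)
    have c: "c > 0" "c\<^sup>2 = pi\<^sup>2 / 6" by (auto simp: c_def power_divide)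
    have x: "0 < x" "x < x0" using n c elim by (auto simp: x_def n_def)
    have "x\<^sup>2 = c\<^sup>2 / n" using n by (simp add: x_def power_divide)
    hence x2: "x\<^sup>2 = pi\<^sup>2 / (6 * n)" unfolding c(2) by simp
    have Ax: "real N = A / x" using x2 n x by (simp add: A_def n_def[symmetric] field_simps power2_eq_square)
    have A2: "2 * A = pi * sqrt (2 * n / 3)"
    proof -
      have "A = n * x" using Ax x by (simp add: n_def)
      also have "\<dots> = pi * (n / sqrt n) / sqrt 6" by (simp add: x_def c_def mult.commute)
      also have "n / sqrt n = sqrt n" using n by (simp add: real_div_sqrt)
      finally have "2 * A = pi * (2 / sqrt 6 * sqrt n)" by simp
      also have "2 / sqrt 6 * sqrt n = sqrt (2 * n / 3)"
      proof -
        have "2 = sqrt 4" by simp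
        hence "2 / sqrt 6 * sqrt n = sqrt (4 / 6 * n)" by (simp only: real_sqrt_mult real_sqrt_divide)
        thus ?thesis by simp
      qed
      finally show ?thesis .
    qed
    have m: "K * sqrt x * exp (2 * A) * sqrt (pi / (A / x\<^sup>2)) = 2 * pi * (K * sqrt (6 * pi) / (12 * n) * exp (2 * A))"
    proof -
      have "A / x\<^sup>2 = n / x" using Ax by (simp add: n_def power2_eq_square)
      hence "sqrt x * sqrt (pi / (A / x\<^sup>2)) = sqrt (x * (pi * x / n))" by (simp add: real_sqrt_mult [symmetric])
      also have "x * (pi * x / n) = pi ^ 3 / 6 / n\<^sup>2"
        using x2 n by (simp add: power2_eq_square power3_eq_cube field_simps)
      also have "sqrt (pi ^ 3 / 6 / n\<^sup>2) = 2 * pi * (sqrt (6 * pi) / (12 * n))"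
      proof (rule real_sqrt_unique)
        show "(2 * pi * (sqrt (6 * pi) / (12 * n)))\<^sup>2 = pi ^ 3 / 6 / n\<^sup>2"
          by (simp add: power_mult_distrib power_divide power3_eq_cube) (simp add: power2_eq_square)
      qed (use n in auto)
      finally have "K * (sqrt x * sqrt (pi / (A / x\<^sup>2))) * exp (2 * A) = K * (2 * pi * (sqrt (6 * pi) / (12 * n))) * exp (2 * A)" by simp
      thus ?thesis by (simp add: mult_ac)
    qed
    define T where "T = K * sqrt (6 * pi) / (12 * n) * exp (2 * A)"
    have "norm (2 * of_real pi * D N - of_real (2 * pi * T)) \<le> M * (x\<^sup>2 * sqrt x) * exp (2 * A)"
      using coefficient_bound[OF x A_def Ax] unfolding m M_def T_def .
    also have "2 * of_real pi * D N - of_real (2 * pi * T) = of_real (2 * pi) * (D N - of_real T)"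
      by (simp add: algebra_simps)
    also have "norm \<dots> = 2 * pi * norm (D N - of_real T)" by (simp add: norm_mult)
    finally have "2 * pi * norm (D N - of_real T) \<le> M * (x\<^sup>2 * sqrt x) * exp (2 * A)" .
    moreover have "1 * norm (D N - of_real T) \<le> 2 * pi * norm (D N - of_real T)"
      using pi_gt3 by (intro mult_right_mono) auto
    moreover have "x\<^sup>2 * sqrt x = c powr (5/2) * n powr (-5/4)"
    proof -
      have "x\<^sup>2 * sqrt x = x powr (5/2)"
      proof -
        have "x\<^sup>2 * sqrt x = x powr 2 * x powr (1/2)" using x by (simp add: powr_half_sqrt powr_numeral)
        also have "\<dots> = x powr (5/2)" by (simp flip: powr_add)
        finally show ?thesis .
      qed
      also have "x powr (5/2) = (c * n powr (-1/2)) powr (5/2)" using n by (simp add: x_def powr_minus_divide powr_half_sqrt)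
      also have "(c * n powr (-1/2)) powr (5/2) = c powr (5/2) * n powr (-5/4)"
        using n c by (simp add: powr_mult powr_powr)
      finally show ?thesis .
    qed
    ultimately have "norm (D N - of_real T) \<le> M * (c powr (5/2) * n powr (-5/4)) * exp (2 * A)" by simp
    from this [unfolded T_def A2 n_def] show ?case by (simp only: mult.assoc)
  qed
  thus ?thesis by blast
qed

subsection \<open>The Bessel function of order \<open>- 3/2\<close>\<close>

lemma rGamma_half_plus_nat: "rGamma (real k + 1/2) = 4 ^ k * fact k / (fact (2 * k) * sqrt pi)"
proof (induction k)
  case 0
  have "rGamma (1/2 :: real) = 1 / sqrt pi"
    using Gamma_one_half_real by (simp add: rGamma_inverse_Gamma inverse_eq_divide)
  thus ?case by simp
next
  case (Suc k)
  have "(real k + 1/2) * rGamma (real (Suc k) + 1/2) = rGamma (real k + 1/2)"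
    using rGamma_plus1[of "real k + 1/2"] by (simp add: add_ac)
  have "rGamma (real (Suc k) + 1/2) = 4 ^ k * fact k / (fact (2 * k) * sqrt pi) / (real k + 1/2)"
  proof -
    have "a = b / q" if "q * a = b" "q > 0" for a b q :: real using that by auto
    moreover have "real k + 1/2 > 0" by simp
    ultimately show ?thesis using \<open>(real k + 1/2) * rGamma (real (Suc k) + 1/2) = _\<close> Suc by metis
  qed
  also have "\<dots> = 4 ^ Suc k * fact (Suc k) / (fact (2 * Suc k) * sqrt pi)"
  proof -
    have "fact (2 * Suc k) = (4 * (real k + 1) * (real k + 1/2)) * fact (2 * k)"
      by (simp add: algebra_simps)
    moreover have "fact (Suc k) = (real k + 1) * fact k" by simp
    moreover have "real k + 1 > 0" "real k + 1/2 > 0" by auto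
    moreover have "a * b / (e * s) / q = (4 * a) * (p * b) / ((4 * p * q) * e * s)" if "p > 0" "q > 0" for a b e s p q :: real
      using that by (simp add: divide_simps)
    ultimately show ?thesis by (simp only: power_Suc)
  qed
  finally show ?case .
qed

text \<open>The value 1/Gamma(k - 1/2) = (k - 1/2)/Gamma(k + 1/2) contributes a factor 2 k - 1 to
  x^(2 k)/(2 k)!. The part with 2 k sums to x sinh x and the part with 1 to cosh x.\<close>

lemma bessel_I_minus_three_halves:
  assumes "x > 0"
  shows "bessel_I (-3/2) x = sqrt (2 / (pi * x)) * (sinh x - cosh x / x)"
proof -
  have cosh: "(\<lambda>k. x ^ (2 * k) / fact (2 * k)) sums cosh x"
  proof -
    have "(\<lambda>k. (\<lambda>n. if even n then x ^ n /\<^sub>R fact n else 0) (2 * k)) sums cosh x \<longleftrightarrow> (\<lambda>n. if even n then x ^ n /\<^sub>R fact n else 0) sums cosh x"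
      by (rule sums_mono_reindex) (auto simp: strict_mono_def elim!: evenE)
    with cosh_converges[of x] show ?thesis by (simp add: field_simps)
  qed
  have "(\<lambda>k. (\<lambda>n. if even n then 0 else x ^ n /\<^sub>R fact n) (2 * k + 1)) sums sinh x \<longleftrightarrow> (\<lambda>n. if even n then 0 else x ^ n /\<^sub>R fact n) sums sinh x"
    by (rule sums_mono_reindex) (auto simp: strict_mono_def elim!: oddE)
  with sinh_converges[of x] have "(\<lambda>k. x ^ (2 * k + 1) / fact (2 * k + 1)) sums sinh x" by (simp add: field_simps)
  hence "(\<lambda>k. x * (x ^ (2 * k + 1) / fact (2 * k + 1))) sums (x * sinh x)" by (rule sums_mult)
  moreover have "x * (x ^ (2 * k + 1) / fact (2 * k + 1)) = real (2 * Suc k) * x ^ (2 * Suc k) / fact (2 * Suc k)" for k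
  proof -
    have "fact (2 * Suc k) = real (2 * Suc k) * fact (2 * k + 1)" by (simp add: algebra_simps)
    moreover have "x ^ (2 * Suc k) = x * x ^ (2 * k + 1)" by simp
    ultimately show ?thesis by (simp only: mult_divide_mult_cancel_left) simp
  qed
  ultimately have "(\<lambda>k. real (2 * Suc k) * x ^ (2 * Suc k) / fact (2 * Suc k)) sums (x * sinh x)" by simp
  hence "(\<lambda>k. real (2 * k) * x ^ (2 * k) / fact (2 * k)) sums (x * sinh x)"
    by (subst (asm) sums_Suc_iff[where f = "\<lambda>k. real (2 * k) * x ^ (2 * k) / fact (2 * k)"]) simp
  from sums_mult[OF sums_diff[OF this cosh], of "(x / 2) powr (-3/2) / (2 * sqrt pi)"]
  have S: "(\<lambda>k. (x / 2) powr (-3/2) / (2 * sqrt pi) * (real (2 * k) * x ^ (2 * k) / fact (2 * k) - x ^ (2 * k) / fact (2 * k)))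
      sums ((x / 2) powr (-3/2) / (2 * sqrt pi) * (x * sinh x - cosh x))" .
  have "(x / 2) powr (2 * real k + -3/2) * rGamma (real k + -3/2 + 1) / fact k =
      (x / 2) powr (-3/2) / (2 * sqrt pi) * (real (2 * k) * x ^ (2 * k) / fact (2 * k) - x ^ (2 * k) / fact (2 * k))" for k
  proof -
    have 1: "(x / 2) powr (2 * real k + -3/2) = (x / 2) powr (-3/2) * (x / 2) ^ (2 * k)"
    proof -
      have "(x / 2) powr real (2 * k) = (x / 2) ^ (2 * k)" using assms by (intro powr_realpow) auto
      moreover have "2 * real k + -3/2 = -3/2 + real (2 * k)" by simp
      ultimately show ?thesis by (simp only: powr_add)
    qed
    have 2: "(x / 2) ^ (2 * k) = x ^ (2 * k) / 4 ^ k"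
      by (simp add: power_divide power_mult)
    have 3: "rGamma (real k + -3/2 + 1) = (real k - 1/2) * rGamma (real k + 1/2)"
      using rGamma_plus1[of "real k - 1/2"] by (simp add: add.commute)
    have 4: "P * (Q / e) * ((a - 1/2) * (e * f / (h * s))) / f = P / (2 * s) * (2 * a * Q / h - Q / h)"
      if "e > 0" "f > 0" "h > 0" "s > 0" for P Q e f h s a :: real
      using that by (simp add: field_simps)
    show ?thesis unfolding 1 2 3 rGamma_half_plus_nat of_nat_mult of_nat_numeral by (rule 4) auto
  qed
  hence "bessel_I (-3/2) x = (x / 2) powr (-3/2) / (2 * sqrt pi) * (x * sinh x - cosh x)"
    using S unfolding bessel_I_def by (simp only: sums_iff)
  also have "(x / 2) powr (-3/2) / (2 * sqrt pi) = sqrt (2 / (pi * x)) / x"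
  proof -
    have "(x / 2) powr (-3/2) = (x / 2) powr (-1) * (x / 2) powr (-1/2)" by (simp only: powr_add [symmetric]) simp
    also have "\<dots> = (2 / x) * (1 / sqrt (x / 2))"
      using assms by (simp add: powr_minus_divide powr_half_sqrt)
    finally show ?thesis using assms by (simp add: real_sqrt_divide real_sqrt_mult field_simps)
  qed
  also have "sqrt (2 / (pi * x)) / x * (x * sinh x - cosh x) = sqrt (2 / (pi * x)) * (sinh x - cosh x / x)"
    using assms by (simp add: field_simps)
  finally show ?thesis .
qed

lemma bessel_main_term:
  assumes "n > 0"
  defines "X \<equiv> pi * sqrt (2 * n / 3)"
  shows "pi / (16 * 54 powr (1/4)) * n powr (-3/4) * bessel_I (-3/2) X =
    1 / (32 * sqrt 3 * n) * (exp X - exp (-X) - (exp X + exp (-X)) / X)"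
proof -
  define r where "r = n powr (1/4)"
  define s where "s = (6::real) powr (1/4)"
  have r: "r > 0" "r ^ 4 = n" "n powr (-3/4) = 1 / r ^ 3"
  proof -
    show "r > 0" using assms by (simp add: r_def)
    have "r powr 4 = n" unfolding r_def using assms by (simp add: powr_powr)
    thus "r ^ 4 = n" using \<open>r > 0\<close> by (simp add: powr_numeral)
    have "r powr 3 = n powr (3/4)" unfolding r_def by (simp add: powr_powr)
    hence "r ^ 3 = n powr (3/4)" using \<open>r > 0\<close> by (simp add: powr_numeral)
    thus "n powr (-3/4) = 1 / r ^ 3" by (simp add: powr_minus_divide)
  qed
  have X: "X > 0" using assms by (simp add: X_def)
  have "pi / (16 * 54 powr (1/4)) * n powr (-3/4) * sqrt (2 / (pi * X)) = 1 / (16 * sqrt 3 * n)"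
  \<comment> \<open>Both sides are positive and all radicals involved are square or fourth roots, so
    the identity is checked on fourth powers.\<close>
  proof (rule power_eq_imp_eq_base[where n = 4])
    have s1: "sqrt (2 / (pi * X)) ^ 4 = (2 / (pi * X))\<^sup>2"
    proof -
      have "sqrt (2 / (pi * X)) ^ 4 = (sqrt (2 / (pi * X)) ^ 2) ^ 2" by (simp flip: power_mult)
      thus ?thesis using X by simp
    qed
    have X2: "X\<^sup>2 = pi\<^sup>2 * (2 * n / 3)" using assms by (simp add: X_def power_mult_distrib)
    have p: "(54 powr (1/4)) ^ 4 = (54::real)" by (simp add: powr_powr flip: powr_numeral)
    have q: "(n powr (-3/4)) ^ 4 = 1 / n ^ 3"
    proof -
      have "(n powr (-3/4)) ^ 4 = 1 / (r ^ 4) ^ 3" unfolding r(3) by (simp add: power_divide flip: power_mult)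
      thus ?thesis by (simp only: r)
    qed
    have s3: "sqrt 3 ^ 4 = (9::real)"
    proof -
      have "(sqrt 3)\<^sup>2 = (3::real)" by simp
      hence "((sqrt 3)\<^sup>2)\<^sup>2 = (3::real)\<^sup>2" by (simp only:)
      thus ?thesis by (simp only: power_mult [symmetric]) simp
    qed
    show "(pi / (16 * 54 powr (1/4)) * n powr (-3/4) * sqrt (2 / (pi * X))) ^ 4 = (1 / (16 * sqrt 3 * n)) ^ 4"
      using assms(1) unfolding power_mult_distrib power_divide s1 p q s3 X2
      by (simp add: field_simps eval_nat_numeral)
  qed (use assms X in auto)
  hence h: "pi / (16 * 54 powr (1/4)) * n powr (-3/4) * (sqrt (2 / (pi * X)) * Z) = 1 / (16 * sqrt 3 * n) * Z" for Z
    by (simp only: mult.assoc [symmetric])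
  have e: "sinh X - cosh X / X = (exp X - exp (-X) - (exp X + exp (-X)) / X) / 2"
    by (simp add: sinh_field_def cosh_field_def diff_divide_distrib add_divide_distrib)
  show ?thesis by (simp only: bessel_I_minus_three_halves[OF X] h e) simp
qed

subsection \<open>The difference of the string counts\<close>

definition gdiff :: "nat \<Rightarrow> complex \<Rightarrow> complex" where
  "gdiff m z = hsum z - of_nat m * hsum (of_nat m * z)"

lemma C_diff_has_integral:
  assumes m: "1 \<le> m" and x: "x > 0"
  shows "((\<lambda>y. exp (lambert (Complex x y)) * gdiff m (Complex x y) * exp (of_nat N * Complex x y)) has_integral
    2 * of_real pi * of_real (real (C 1 N) - real m * real (C m N))) {-pi..pi}"
proof -
  have I: "((\<lambda>y. eval_fps (C_fps k) (exp (- Complex x y)) * exp (of_nat N * Complex x y)) has_integral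
      2 * of_real pi * of_nat (C k N)) {-pi..pi}" if "1 \<le> k" for k
    using fps_nth_has_integral[OF fps_conv_radius_C[OF that] x, of N] by (simp add: C_fps_def)
  have "((\<lambda>y. eval_fps (C_fps 1) (exp (- Complex x y)) * exp (of_nat N * Complex x y) -
        of_nat m * (eval_fps (C_fps m) (exp (- Complex x y)) * exp (of_nat N * Complex x y))) has_integral
      2 * of_real pi * of_nat (C 1 N) - of_nat m * (2 * of_real pi * of_nat (C m N))) {-pi..pi}"
    using m by (intro has_integral_diff has_integral_mult_right I) auto
  moreover have "eval_fps (C_fps 1) (exp (- Complex x y)) * exp (of_nat N * Complex x y) -
        of_nat m * (eval_fps (C_fps m) (exp (- Complex x y)) * exp (of_nat N * Complex x y)) =
      exp (lambert (Complex x y)) * gdiff m (Complex x y) * exp (of_nat N * Complex x y)" for y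
    using eval_C_fps[of 1 "Complex x y"] eval_C_fps[OF m, of "Complex x y"] x by (simp add: gdiff_def algebra_simps)
  ultimately show ?thesis by (simp add: algebra_simps)
qed

lemma gdiff_major:
  assumes m: "m \<ge> (1::nat)"
  shows "\<exists>B x0. B \<ge> 0 \<and> x0 > 0 \<and> (\<forall>x y. 0 < x \<and> x < x0 \<and> \<bar>y\<bar> \<le> x \<longrightarrow>
    norm (gdiff m (Complex x y) - of_real ((real m - 1) / 8)) \<le> B * sqrt x)"
proof -
  obtain B where B: "\<And>z. Re z > 0 \<Longrightarrow> \<bar>Im z\<bar> \<le> Re z \<Longrightarrow> norm z \<le> 1 / (2 * real m) \<Longrightarrow>
    norm (gdiff m z - of_real ((real m - 1) / 8)) \<le> B * sqrt (norm z)"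
    using hsum_diff_asymp[OF m] unfolding gdiff_def by blast
  have "norm (gdiff m (Complex x y) - of_real ((real m - 1) / 8)) \<le> (2 * \<bar>B\<bar>) * sqrt x"
    if "0 < x" "x < 1 / (4 * real m)" "\<bar>y\<bar> \<le> x" for x y
  proof -
    define z where "z = Complex x y"
    have z: "norm z \<le> 2 * x" using cone_norm_le[of z] that by (simp add: z_def)
    have "2 * x \<le> 1 / (2 * real m)" using that m by (simp add: field_simps)
    hence "norm (gdiff m z - of_real ((real m - 1) / 8)) \<le> B * sqrt (norm z)"
      using z that by (intro B) (auto simp: z_def)
    also have "\<dots> \<le> \<bar>B\<bar> * sqrt (norm z)" by (intro mult_right_mono) auto
    also have "sqrt (norm z) \<le> sqrt (4 * x)" using z that by simp
    also have "sqrt (4 * x) = 2 * sqrt x" by (simp add: real_sqrt_mult)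
    finally show ?thesis by (simp add: z_def mult_left_mono)
  qed
  thus ?thesis using m by (intro exI[of _ "2 * \<bar>B\<bar>"] exI[of _ "1 / (4 * real m)"]) auto
qed

lemma norm_gdiff_le:
  assumes "x > 0" "m \<ge> (1::nat)"
  shows "norm (gdiff m (Complex x y)) \<le> (1 + real m) * (4 / (1 - exp (-x))\<^sup>2)"
proof -
  let ?b = "4 / (1 - exp (-x))\<^sup>2"
  have "norm (hsum (of_nat m * Complex x y)) \<le> 4 / (1 - exp (- (real m * x)))\<^sup>2"
    using norm_hsum_le[of "of_nat m * Complex x y"] assms by simp
  also have "\<dots> \<le> ?b"
  proof -
    have "1 * x \<le> real m * x" using assms by (intro mult_right_mono) auto
    hence "exp (- (real m * x)) \<le> exp (-x)" by simp
    moreover have "exp (-x) < 1" using assms by simp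
    ultimately show ?thesis by (intro divide_left_mono power_mono mult_pos_pos zero_less_power) auto
  qed
  finally have "real m * norm (hsum (of_nat m * Complex x y)) \<le> real m * ?b" by (intro mult_left_mono) auto
  moreover have "norm (hsum (Complex x y)) \<le> ?b" using norm_hsum_le[of "Complex x y"] assms by simp
  moreover have "norm (gdiff m (Complex x y)) \<le> norm (hsum (Complex x y)) + real m * norm (hsum (of_nat m * Complex x y))"
    unfolding gdiff_def using norm_triangle_ineq4[of "hsum (Complex x y)" "of_nat m * hsum (of_nat m * Complex x y)"]
    by (simp add: norm_mult)
  ultimately have "norm (gdiff m (Complex x y)) \<le> ?b + real m * ?b" by linarith
  thus ?thesis by (simp only: distrib_right mult_1_left)
qed

text \<open>The leading constant is the product of (2 pi)^(-1/2) from P and (m - 1)/8 from the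
  string series; the error constant is the sum of those found on the two arcs.\<close>

lemma circle_method_C_diff:
  assumes m: "m \<ge> (1::nat)"
  shows "\<exists>B x0. circle_method (\<lambda>z. exp (lambert z) * gdiff m z) (\<lambda>N. of_real (real (C 1 N) - real m * real (C m N)))
    ((real m - 1) / (8 * sqrt (2 * pi))) B x0"
proof -
  define g where "g = (real m - 1) / 8"
  have g: "g \<ge> 0" using m by (simp add: g_def)
  obtain B1 x1 where B1: "B1 \<ge> 0" "x1 > 0" "\<And>x y. 0 < x \<Longrightarrow> x < x1 \<Longrightarrow> \<bar>y\<bar> \<le> x \<Longrightarrow>
     norm (exp (lambert (Complex x y)) - of_real (sqrt (x / (2 * pi))) * peak (Complex x y))
      \<le> B1 * sqrt x * norm (peak (Complex x y)) * (x + \<bar>y\<bar> / x)"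
    using exp_lambert_major by blast
  obtain B2 x2 where B2: "B2 \<ge> 0" "x2 > 0" "\<And>x y. 0 < x \<Longrightarrow> x < x2 \<Longrightarrow> \<bar>y\<bar> \<le> x \<Longrightarrow>
     norm (gdiff m (Complex x y) - of_real g) \<le> B2 * sqrt x"
    using gdiff_major[OF m] unfolding g_def by blast
  obtain B3 x3 where B3: "B3 \<ge> 0" "x3 > 0" "\<And>x y. 0 < x \<Longrightarrow> x < x3 \<Longrightarrow> x \<le> \<bar>y\<bar> \<Longrightarrow> \<bar>y\<bar> \<le> pi \<Longrightarrow>
     norm (exp (lambert (Complex x y))) \<le> B3 * exp (pi\<^sup>2 / (6 * x)) * exp (- 1 / (10 * x))"
    using exp_lambert_minor by blast
  \<comment> \<open>The exponential saving of the minor arc outweighs both the growth of the string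
    series and the required factor x^(5/2).\<close>
  have "eventually (\<lambda>x. exp (- 1 / (10 * x)) * (4 / (1 - exp (-x))\<^sup>2) \<le> x\<^sup>2 * sqrt x) (at_right (0::real))"
    by real_asymp
  then obtain x4 :: real where x4: "x4 > 0" "\<And>x. 0 < x \<Longrightarrow> x < x4 \<Longrightarrow> exp (- 1 / (10 * x)) * (4 / (1 - exp (-x))\<^sup>2) \<le> x\<^sup>2 * sqrt x"
    unfolding eventually_at_right_field by blast
  define Ba where "Ba = B1 * (g + B2) + B2"
  define Bb where "Bb = B3 * (1 + real m)"
  have Bab: "Ba \<ge> 0" "Bb \<ge> 0" using B1 B2 B3 g by (auto simp: Ba_def Bb_def)
  define x0 where "x0 = min (min (min x1 x2) (min x3 x4)) 1"
  have x0: "x0 > 0" "x0 \<le> 1" "x0 \<le> x1" "x0 \<le> x2" "x0 \<le> x3" "x0 \<le> x4"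
    using B1 B2 B3 x4 by (auto simp: x0_def)
  have "circle_method (\<lambda>z. exp (lambert z) * gdiff m z) (\<lambda>N. of_real (real (C 1 N) - real m * real (C m N)))
    ((real m - 1) / (8 * sqrt (2 * pi))) (Ba + Bb) x0"
  proof
    fix x y :: real assume x: "0 < x" "x < x0" and y: "\<bar>y\<bar> \<le> x"
    define z where "z = Complex x y"
    define E where "E = peak z"
    define P0 where "P0 = of_real (sqrt (x / (2 * pi))) * E"
    define w where "w = sqrt x + \<bar>y\<bar> / x"
    have w: "w \<ge> sqrt x" "w \<ge> 0" using x by (auto simp: w_def)
    have x1: "x \<le> 1" using x x0 by linarith
    have sx: "sqrt x \<le> 1" "x \<le> sqrt x" using x x1 real_le_rsqrt[of x x] by (auto simp: power2_eq_square mult_left_le)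
    have G: "norm (gdiff m z - of_real g) \<le> B2 * sqrt x" using B2(3)[of x y] x x0 y by (simp add: z_def)
    also have "\<dots> \<le> B2 * 1" using B2 sx by (intro mult_left_mono) auto
    finally have G': "norm (gdiff m z) \<le> g + B2"
      using norm_triangle_ineq2[of "gdiff m z" "of_real g"] g by simp
    have "norm (exp (lambert z) - P0) \<le> B1 * sqrt x * norm E * (x + \<bar>y\<bar> / x)"
      using B1(3)[of x y] x x0 y by (simp add: z_def P0_def E_def)
    also have "\<dots> \<le> B1 * sqrt x * norm E * w"
      using B1 x sx by (intro mult_left_mono) (auto simp: w_def)
    finally have P: "norm (exp (lambert z) - P0) \<le> B1 * sqrt x * norm E * w" .
    have P0: "norm P0 \<le> sqrt x * norm E"
      using sqrt_div_2pi_le[OF x(1)] x unfolding P0_def norm_mult norm_of_real by (intro mult_right_mono) auto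
    have "of_real ((real m - 1) / (8 * sqrt (2 * pi)) * sqrt x) * E = P0 * of_real g"
      by (simp add: P0_def g_def real_sqrt_divide mult_ac)
    \<comment> \<open>A product of two approximations: the error of the first factor is multiplied
      by the bounded second one, the error of the second by the leading term of the first.\<close>
    hence "exp (lambert z) * gdiff m z - of_real ((real m - 1) / (8 * sqrt (2 * pi)) * sqrt x) * E =
        (exp (lambert z) - P0) * gdiff m z + P0 * (gdiff m z - of_real g)"
      by (simp add: algebra_simps)
    also have "norm \<dots> \<le> (B1 * sqrt x * norm E * w) * (g + B2) + (sqrt x * norm E) * (B2 * sqrt x)"
      using P P0 G G' B1 B2 w x
      by (intro order_trans[OF norm_triangle_ineq] add_mono) (auto simp: norm_mult intro!: mult_mono)
    also have "(sqrt x * norm E) * (B2 * sqrt x) \<le> (sqrt x * norm E) * (B2 * w)"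
      using B2 w x by (intro mult_left_mono) auto
    also have "(B1 * sqrt x * norm E * w) * (g + B2) + (sqrt x * norm E) * (B2 * w) = Ba * (sqrt x * norm E * w)"
      by (simp add: Ba_def algebra_simps)
    also have "\<dots> \<le> (Ba + Bb) * (sqrt x * norm E * w)"
      using Bab w x by (intro mult_right_mono) auto
    finally show "norm (exp (lambert (Complex x y)) * gdiff m (Complex x y) -
        of_real ((real m - 1) / (8 * sqrt (2 * pi)) * sqrt x) * peak (Complex x y))
       \<le> (Ba + Bb) * sqrt x * norm (peak (Complex x y)) * (sqrt x + \<bar>y\<bar> / x)"
      by (simp only: z_def E_def w_def mult.assoc)
  next
    fix x y :: real assume x: "0 < x" "x < x0" and y: "x \<le> \<bar>y\<bar>" "\<bar>y\<bar> \<le> pi"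
    have "norm (exp (lambert (Complex x y)) * gdiff m (Complex x y)) \<le>
        (B3 * exp (pi\<^sup>2 / (6 * x)) * exp (- 1 / (10 * x))) * ((1 + real m) * (4 / (1 - exp (-x))\<^sup>2))"
      unfolding norm_mult using B3(1) B3(3)[of x y] norm_gdiff_le[OF x(1) m, of y] x x0 y by (intro mult_mono) auto
    also have "\<dots> = Bb * exp (pi\<^sup>2 / (6 * x)) * (exp (- 1 / (10 * x)) * (4 / (1 - exp (-x))\<^sup>2))"
      by (simp only: Bb_def mult_ac)
    also have "\<dots> \<le> Bb * exp (pi\<^sup>2 / (6 * x)) * (x\<^sup>2 * sqrt x)"
      using Bab x4(2)[of x] x x0 by (intro mult_left_mono) auto
    also have "\<dots> \<le> (Ba + Bb) * exp (pi\<^sup>2 / (6 * x)) * (x\<^sup>2 * sqrt x)"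
      using Bab x by (intro mult_right_mono) auto
    finally show "norm (exp (lambert (Complex x y)) * gdiff m (Complex x y)) \<le> (Ba + Bb) * (x\<^sup>2 * sqrt x) * exp (pi\<^sup>2 / (6 * x))"
      by (simp only: mult_ac)
  next
    fix N and x :: real assume "0 < x"
    thus "((\<lambda>y. exp (lambert (Complex x y)) * gdiff m (Complex x y) * exp (of_nat N * Complex x y)) has_integral
        2 * of_real pi * of_real (real (C 1 N) - real m * real (C m N))) {-pi..pi}"
      by (rule C_diff_has_integral[OF m])
  qed (use m x0 Bab in auto)
  thus ?thesis by blast
qed

theorem theorem2p9:
  fixes m :: nat
  assumes "2 \<le> m"
  shows "(\<lambda>N::nat. real (C 1 N) - real m * real (C m N)
            - (real m - 1) * (pi / (16 * 54 powr (1/4))) * real N powr (-3/4)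
              * bessel_I (-3/2) (pi * sqrt (2 * real N / 3)))
         \<in> O(\<lambda>N::nat. real N powr (-5/4) * exp (pi * sqrt (2 * real N / 3)))"
proof -
  define X where "X = (\<lambda>N::nat. pi * sqrt (2 * real N / 3))"
  define Y where "Y = (\<lambda>N::nat. real N powr (-5/4) * exp (X N))"
  \<comment> \<open>What separates exp(X) from the exact expression sinh X - cosh X / X, after
    doubling.\<close>
  define R where "R = (\<lambda>N. exp (- X N) + (exp (X N) + exp (- X N)) / X N)"
  define d where "d = (\<lambda>N. real (C 1 N) - real m * real (C m N))"
  have m: "1 \<le> m" using assms by simp
  obtain B x0 where "circle_method (\<lambda>z. exp (lambert z) * gdiff m z) (\<lambda>N. of_real (d N)) ((real m - 1) / (8 * sqrt (2 * pi))) B x0"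
    using circle_method_C_diff[OF m] unfolding d_def by blast
  from circle_method.coefficient_asymp[OF this] obtain M where
    M: "eventually (\<lambda>N. norm (of_real (d N) - of_real ((real m - 1) / (8 * sqrt (2 * pi)) * sqrt (6 * pi) / (12 * real N) * exp (X N)) :: complex) \<le> M * Y N) sequentially"
    unfolding X_def Y_def by blast
  \<comment> \<open>(6 pi)^(1/2) / (2 pi)^(1/2) = 3^(1/2), and 3^(1/2)/96 = 1/(32 *
    3^(1/2)).\<close>
  have const: "(real m - 1) / (8 * sqrt (2 * pi)) * sqrt (6 * pi) / (12 * real N) = (real m - 1) / (32 * sqrt 3 * real N)" for N
  proof -
    have "sqrt (6 * pi) / sqrt (2 * pi) = sqrt 3" by (simp flip: real_sqrt_divide)
    moreover have "sqrt 3 / 3 = 1 / sqrt (3::real)" by (simp add: real_div_sqrt field_simps)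
    ultimately have "sqrt (6 * pi) / sqrt (2 * pi) / 3 = 1 / sqrt 3" by simp
    hence "(real m - 1) / (32 * real N) * (sqrt (6 * pi) / sqrt (2 * pi) / 3) = (real m - 1) / (32 * real N) * (1 / sqrt 3)"
      by (simp only:)
    thus ?thesis by (simp add: mult_ac)
  qed
  have 1: "(\<lambda>N. d N - (real m - 1) / (32 * sqrt 3 * real N) * exp (X N)) \<in> O(Y)"
  proof (rule bigoI)
    show "eventually (\<lambda>N. norm (d N - (real m - 1) / (32 * sqrt 3 * real N) * exp (X N)) \<le> M * norm (Y N)) sequentially"
      using M unfolding const
    proof eventually_elim
      case (elim N)
      have "\<bar>Y N\<bar> = Y N" by (simp add: Y_def)
      thus ?case using elim by (simp only: norm_of_real of_real_diff [symmetric] real_norm_def)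
    qed
  qed
  \<comment> \<open>The largest part of R is exp(X)/X, so this term has order N^(-3/2) exp(X), below
    the permitted N^(-5/4) exp(X).\<close>
  have 2: "(\<lambda>N. (real m - 1) / (32 * sqrt 3 * real N) * R N) \<in> O(Y)"
  proof -
    have "(\<lambda>N. 1 / real N * R N) \<in> O(Y)"
      unfolding R_def X_def Y_def by real_asymp
    hence "(\<lambda>N. (real m - 1) / (32 * sqrt 3) * (1 / real N * R N)) \<in> O(Y)"
      using assms by (subst landau_o.big.cmult_in_iff) simp_all
    thus ?thesis by simp
  qed
  from sum_in_bigo(1)[OF 1 2] have "(\<lambda>N. d N - (real m - 1) / (32 * sqrt 3 * real N) * exp (X N) +
      (real m - 1) / (32 * sqrt 3 * real N) * R N) \<in> O(Y)" .
  also have "?this \<longleftrightarrow> (\<lambda>N. d N - (real m - 1) * (pi / (16 * 54 powr (1/4))) * real N powr (-3/4) * bessel_I (-3/2) (X N)) \<in> O(Y)"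
  proof (rule landau_o.big.in_cong)
    show "eventually (\<lambda>N. d N - (real m - 1) / (32 * sqrt 3 * real N) * exp (X N) +
      (real m - 1) / (32 * sqrt 3 * real N) * R N =
      d N - (real m - 1) * (pi / (16 * 54 powr (1/4))) * real N powr (-3/4) * bessel_I (-3/2) (X N)) sequentially"
      using eventually_gt_at_top[of 0]
    proof eventually_elim
      case (elim N)
      define b where "b = 1 / (32 * sqrt 3 * real N)"
      have "(real m - 1) * (pi / (16 * 54 powr (1/4)) * real N powr (-3/4) * bessel_I (-3/2) (X N)) =
          (real m - 1) * (b * (exp (X N) - exp (- X N) - (exp (X N) + exp (- X N)) / X N))"
        using bessel_main_term[of "real N"] elim by (simp only: X_def b_def of_nat_0_less_iff)
      moreover have "(real m - 1) / (32 * sqrt 3 * real N) = (real m - 1) * b" by (simp add: b_def)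
      moreover have "u - k * (c * P) + k * (c * (Q + S)) = u - k * (c * (P - Q - S))" for u k c P Q S :: real
        by (simp add: algebra_simps)
      ultimately show ?case by (simp only: R_def mult.assoc)
    qed
  qed
  finally show ?thesis by (simp only: d_def X_def Y_def)
qed

end
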